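(* Let $n>0$ be an integer and let $N=p_1^{k_1}\cdots p_r^{k_r}$ with $p_1,\dots,p_r$ distinct primes and $k_1,\dots,k_r$ positive integers. For any function $f:(\mathbb{Z}/N\mathbb{Z})^n\to\mathbb{Z}_{\ge0}$ we have $$\sum_{x\in(\mathbb{Z}/N\mathbb{Z})^n}|f(x)|^n\ \ge\ C_{N,n}\,\underset{u\in\mathbb{P}(\mathbb{Z}/N\mathbb{Z})^{n-1}}{\mathbb{E}}\left[|f^*(u)|^n\right]\ =\ \frac{C_{N,n}}{|\mathbb{P}(\mathbb{Z}/N\mathbb{Z})^{n-1}|}\left(\sum_{u\in\mathbb{P}(\mathbb{Z}/N\mathbb{Z})^{n-1}}|f^*(u)|^n\right),$$ where $$C_{N,n}=\left(\frac{1}{2(\log(\mathrm{mweight}(f,p_1))+1)\left\lceil\log_{p_1}(\mathrm{mweight}(f,p_1))+\log_{p_1}(n)\right\rceil}\right)^n\cdot\left(\frac{1}{2(k_r+\lceil\log_{p_r}(n)\rceil)}\prod_{i=2}^{r-1}\frac{1}{2(k_i\log(p_i)+1)(k_i+\lceil\log_{p_i}(n)\rceil)}\right)^n.$$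
   Context: For $N=p_1^{k_1}\cdots p_r^{k_r}$ ($p_i$ distinct primes), the projective space $\mathbb{P}(\mathbb{Z}/N\mathbb{Z})^{n-1}$ consists of the vectors $u\in(\mathbb{Z}/N\mathbb{Z})^n$ such that, for every $i$, $u\bmod p_i^{k_i}$ has at least one coordinate that is a unit, taken up to multiplication by units in $(\mathbb{Z}/N\mathbb{Z})^\times$; one representative in $(\mathbb{Z}/N\mathbb{Z})^n$ is fixed for each element. $\mathbb{E}_u$ denotes the average over all $u\in\mathbb{P}(\mathbb{Z}/N\mathbb{Z})^{n-1}$. A line in direction $u$ is a set $\{a+tu:t\in\mathbb{Z}/N\mathbb{Z}\}$ with $a\in(\mathbb{Z}/N\mathbb{Z})^n$. For $f:(\mathbb{Z}/N\mathbb{Z})^n\to\mathbb{Z}_{\ge0}$ the maximal function $f^*:\mathbb{P}(\mathbb{Z}/N\mathbb{Z})^{n-1}\to\mathbb{Z}_{\ge0}$ is $$f^*(u)=\sup_{a\in(\mathbb{Z}/N\mathbb{Z})^n}\ \sum_{t\in\mathbb{Z}/N\mathbb{Z}}f(a+tu).$$ $p$-maximal weight: write $N=p^kN_1$ with $p$ prime and coprime to $N_1$ ($N_1=1$ is allowed). By the Chinese remainder theorem $(\mathbb{Z}/N\mathbb{Z})^n\cong(\mathbb{Z}/p^k\mathbb{Z})^n\times(\mathbb{Z}/N_1\mathbb{Z})^n$, and every line in $(\mathbb{Z}/N\mathbb{Z})^n$ is a product of a line in $(\mathbb{Z}/p^k\mathbb{Z})^n$ and a line in $(\mathbb{Z}/N_1\mathbb{Z})^n$.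 For each direction $u\in\mathbb{P}(\mathbb{Z}/N\mathbb{Z})^{n-1}$ let $L(u)$ be a line in direction $u$ with $\sum_{x\in L(u)}f(x)=f^*(u)$, and write $L(u)=L_p(u)\times L_1(u)$ with $L_p(u)\subseteq(\mathbb{Z}/p^k\mathbb{Z})^n$ and $L_1(u)\subseteq(\mathbb{Z}/N_1\mathbb{Z})^n$. Then $$\mathrm{mweight}(f,p)=\sup_{u\in\mathbb{P}(\mathbb{Z}/N\mathbb{Z})^{n-1},\ z\in L_1(u)}\ \sum_{x\in L_p(u)}f((x,z)).$$ (When $N_1=1$ this is $\max_uf^*(u)$.) $\log$ denotes the natural logarithm and $\log_p$ the logarithm to base $p$; an empty product is $1$. *)

theory Defs
  imports "HOL-Number_Theory.Number_Theory" "HOL-Probability.Probability"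
begin

abbreviation ZMod :: "nat \<Rightarrow> int ring" where
  "ZMod N \<equiv> residue_ring (int N)"

text \<open>Vectors with \<open>n\<close> coordinates over the integers mod \<open>N\<close>, as extensional functions on \<open>{..<n}\<close>.\<close>

definition mod_vecs :: "nat \<Rightarrow> nat \<Rightarrow> (nat \<Rightarrow> int) set" where
  "mod_vecs n N = {..<n} \<rightarrow>\<^sub>E carrier (ZMod N)"

definition smult_vec :: "nat \<Rightarrow> nat \<Rightarrow> int \<Rightarrow> (nat \<Rightarrow> int) \<Rightarrow> (nat \<Rightarrow> int)" where
  "smult_vec n N c u = (\<lambda>j\<in>{..<n}. c \<otimes>\<^bsub>ZMod N\<^esub> u j)"

definition add_vec :: "nat \<Rightarrow> nat \<Rightarrow> (nat \<Rightarrow> int) \<Rightarrow> (nat \<Rightarrow> int) \<Rightarrow> (nat \<Rightarrow> int)" where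
  "add_vec n N a b = (\<lambda>j\<in>{..<n}. a j \<oplus>\<^bsub>ZMod N\<^esub> b j)"

definition reduce_vec :: "nat \<Rightarrow> nat \<Rightarrow> (nat \<Rightarrow> int) \<Rightarrow> (nat \<Rightarrow> int)" where
  "reduce_vec n M u = (\<lambda>j\<in>{..<n}. u j mod int M)"

text \<open>The exact power of \<open>q\<close> dividing \<open>N\<close>, and the cofactor prime to \<open>q\<close>.\<close>

definition prime_part :: "nat \<Rightarrow> nat \<Rightarrow> nat" where
  "prime_part N q = q ^ multiplicity q N"

definition coprime_part :: "nat \<Rightarrow> nat \<Rightarrow> nat" where
  "coprime_part N q = N div prime_part N q"

definition direction_vecs :: "nat \<Rightarrow> nat \<Rightarrow> (nat \<Rightarrow> int) set" where
  "direction_vecs n N =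
     {u \<in> mod_vecs n N. \<forall>q\<in>prime_factors N. \<exists>j<n.
        reduce_vec n (prime_part N q) u j \<in> Units (ZMod (prime_part N q))}"

definition unit_multiple_rel :: "nat \<Rightarrow> nat \<Rightarrow> ((nat \<Rightarrow> int) \<times> (nat \<Rightarrow> int)) set" where
  "unit_multiple_rel n N =
     {(u, v). u \<in> direction_vecs n N \<and> v \<in> direction_vecs n N \<and>
        (\<exists>c\<in>Units (ZMod N). v = smult_vec n N c u)}"

text \<open>Elements are equivalence classes of vectors; \<open>proj_space n N\<close> has projective dimension \<open>n - 1\<close>.\<close>

definition proj_space :: "nat \<Rightarrow> nat \<Rightarrow> (nat \<Rightarrow> int) set set" where
  "proj_space n N = direction_vecs n N // unit_multiple_rel n N"

definition representatives :: "nat \<Rightarrow> nat \<Rightarrow> ((nat \<Rightarrow> int) set \<Rightarrow> (nat \<Rightarrow> int)) \<Rightarrow> bool" where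
  "representatives n N rep \<longleftrightarrow> (\<forall>u\<in>proj_space n N. rep u \<in> u)"

definition line :: "nat \<Rightarrow> nat \<Rightarrow> (nat \<Rightarrow> int) \<Rightarrow> (nat \<Rightarrow> int) \<Rightarrow> (nat \<Rightarrow> int) set" where
  "line n N a u = {add_vec n N a (smult_vec n N t u) |t. t \<in> carrier (ZMod N)}"

definition maximal_function ::
    "nat \<Rightarrow> nat \<Rightarrow> ((nat \<Rightarrow> int) set \<Rightarrow> (nat \<Rightarrow> int)) \<Rightarrow> ((nat \<Rightarrow> int) \<Rightarrow> nat)
      \<Rightarrow> (nat \<Rightarrow> int) set \<Rightarrow> nat" where
  "maximal_function n N rep f u =
     (SUP a\<in>mod_vecs n N. \<Sum>t\<in>carrier (ZMod N). f (add_vec n N a (smult_vec n N t (rep u))))"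

text \<open>\<open>L\<close> assigns to each direction a line attaining the maximal function. Such lines need not be
  unique, and \<open>mweight\<close> below depends on which are chosen.\<close>

definition maximal_lines ::
    "nat \<Rightarrow> nat \<Rightarrow> ((nat \<Rightarrow> int) set \<Rightarrow> (nat \<Rightarrow> int)) \<Rightarrow> ((nat \<Rightarrow> int) \<Rightarrow> nat)
      \<Rightarrow> ((nat \<Rightarrow> int) set \<Rightarrow> (nat \<Rightarrow> int) set) \<Rightarrow> bool" where
  "maximal_lines n N rep f L \<longleftrightarrow>
     (\<forall>u\<in>proj_space n N.
        (\<exists>a\<in>mod_vecs n N. L u = line n N a (rep u)) \<and>
        (\<Sum>x\<in>L u. f x) = maximal_function n N rep f u)"

text \<open>Inverse of the Chinese remainder isomorphism, for coprime \<open>M\<close> and \<open>M'\<close>.\<close>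

definition crt_vec ::
    "nat \<Rightarrow> nat \<Rightarrow> nat \<Rightarrow> (nat \<Rightarrow> int) \<times> (nat \<Rightarrow> int) \<Rightarrow> (nat \<Rightarrow> int)" where
  "crt_vec n M M' =
     inv_into (mod_vecs n (M * M')) (\<lambda>y. (reduce_vec n M y, reduce_vec n M' y))"

text \<open>The two factors of the line \<open>L u\<close> are its images under reduction.\<close>

definition mweight ::
    "nat \<Rightarrow> nat \<Rightarrow> ((nat \<Rightarrow> int) set \<Rightarrow> (nat \<Rightarrow> int) set) \<Rightarrow> ((nat \<Rightarrow> int) \<Rightarrow> nat) \<Rightarrow> nat \<Rightarrow> nat" where
  "mweight n N L f q =
     (SUP (u, z)\<in>(SIGMA u:proj_space n N. reduce_vec n (coprime_part N q) ` L u).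
        \<Sum>x\<in>reduce_vec n (prime_part N q) ` L u.
          f (crt_vec n (prime_part N q) (coprime_part N q) (x, z)))"

text \<open>Here \<open>m\<close> stands for the maximal weight at \<open>p 1\<close>. The formula is only meaningful for \<open>m > 0\<close>
  and \<open>m * n > 1\<close>. For \<open>m = 0\<close> (that is, \<open>f = 0\<close>) the logarithms of \<open>m\<close> are \<open>0\<close> by convention;
  for \<open>m = n = 1\<close> the first denominator vanishes and the constant is \<open>0\<close> by convention.\<close>

definition kakeya_const ::
    "nat \<Rightarrow> nat \<Rightarrow> (nat \<Rightarrow> nat) \<Rightarrow> (nat \<Rightarrow> nat) \<Rightarrow> nat \<Rightarrow> real" where
  "kakeya_const n r p k m =
     (1 / (2 * (ln (real m) + 1) *
           real_of_int \<lceil>log (real (p 1)) (real m) + log (real (p 1)) (real n)\<rceil>)) ^ n *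
     (1 / (2 * (real (k r) + real_of_int \<lceil>log (real (p r)) (real n)\<rceil>)) *
      (\<Prod>i = 2..r - 1. 1 / (2 * (real (k i) * ln (real (p i)) + 1) *
           (real (k i) + real_of_int \<lceil>log (real (p i)) (real n)\<rceil>)))) ^ n"

end

theory Submission
  imports Defs "Jordan_Normal_Form.Char_Poly"
begin

text \<open>
  The maximal inequality is multiplicative in \<open>N\<close>: applied modulo \<open>p\<^sub>1\<^sup>k\<^sub>1\<close> on the fibres of \<open>f\<close> and then modulo the
  cofactor to the largest fibre weights, it gives the inequality modulo \<open>N\<close>. It remains to treat \<open>M = p\<^sup>k\<close>, averaging
  over direction vectors instead of projective points.

  Place \<open>x\<close> at \<open>(\<zeta>\<^sup>x\<^sup>1, \<dots>, \<zeta>\<^sup>x\<^sup>n)\<close> for a primitive \<open>M\<close>-th root of unity \<open>\<zeta>\<close>. A polynomial vanishing to order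
  \<open>s f x\<close> at every point vanishes, along the curve \<open>y \<mapsto> (\<zeta>\<^sup>a\<^sup>j \<gamma>\<^sub>j y)\<close> with \<open>\<gamma>\<^sub>j y \<equiv> y\<^sup>u\<^sup>j\<close> modulo \<open>y\<^sup>M - 1\<close>, to total order
  \<open>s w\<close>, where \<open>w\<close> is the weight of the line. Under \<open>\<zeta> \<mapsto> 1\<close> modulo \<open>p\<close> this becomes vanishing of order \<open>s w\<close> of
  \<open>P \<circ> \<gamma>\<close> at \<open>y = 1\<close>. Divided differences at nodes chosen like a \<open>p\<close>-ordering recover the coefficient of
  \<open>(z - 1)\<^sup>e\<close> from such conditions of order at most the valuation of a generalised factorial of \<open>e\<close>. Selecting one
  nonzero term in the multilinear expansion of a determinant attaches to each \<open>e\<close> a single condition, so that the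
  conditions stay independent modulo \<open>p\<close>, hence after lifting. Averaging over the automorphisms of
  \<open>(\<int>/M)\<^sup>n\<close>, which act transitively on directions, accounts for all thresholds \<open>w u\<close> simultaneously.
\<close>

section \<open>Determinants as functions of rows\<close>

text \<open>Independence of the conditions is decided modulo \<open>p\<close>, where
  \<open>\<zeta>\<close> becomes 1 and all nodes \<open>\<zeta>^t - 1\<close> collapse to 0. Values
  at the nodes would then become dependent; divided differences degenerate to Taylor coefficients
  instead, so the rows are built from \<open>newton_coeff\<close>. Their determinant is a polynomial
  in \<open>\<zeta>\<close>, and nonvanishing modulo \<open>p\<close> at 1 returns to a primitive
  root because the cyclotomic polynomial of order \<open>p^k\<close> takes the value
  \<open>p\<close> at 1.

  A line of weight \<open>w\<close> reaches degree \<open>w\<close> divided by the mean valuation of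
  a node difference. For the nodes \<open>(1 + x)^l\<close> this mean grows with the logarithm of
  the degree; changing them modulo \<open>(1 + x)^(p^k) - 1\<close> also caps it at
  \<open>k + 2\<close>. These two bounds are the origin of the logarithm of the weight at the first
  prime and of the exponents \<open>k i\<close> at the others.

  Row selection does not control the direction attached to a row, while the threshold
  \<open>w u\<close> depends on it; averaging removes this dependence. The scale \<open>s\<close>
  makes the number of conditions at a point, a binomial coefficient, comparable to
  \<open>(s f x)^n / n!\<close>.\<close>

abbreviation det_fun :: "nat \<Rightarrow> (nat \<Rightarrow> nat \<Rightarrow> 'a :: comm_ring_1) \<Rightarrow> 'a" where
  "det_fun R A \<equiv> Determinant.det (Matrix.mat R R (\<lambda>(i, j). A i j))"

lemma det_fun_leibniz:
  "det_fun R A = (\<Sum>q | q permutes {0..<R}. signof q * (\<Prod>i = 0..<R. A i (q i)))"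
  unfolding det_def
  by (auto intro!: sum.cong prod.cong arg_cong2[where f = "(*)"] simp: permutes_in_image)

lemma det_fun_cong:
  assumes "\<And>i j. i < R \<Longrightarrow> j < R \<Longrightarrow> A i j = B i j"
  shows "det_fun R A = det_fun R B"
  by (rule arg_cong[where f = Determinant.det]) (auto intro!: eq_matI simp: assms)

lemma det_fun_cong_mod:
  assumes "\<And>i j. i < R \<Longrightarrow> j < R \<Longrightarrow> [A i j = B i j] (mod (m :: int))"
  shows "[det_fun R A = det_fun R B] (mod m)"
  unfolding det_fun_leibniz
  by (intro cong_sum cong_mult cong_prod cong_refl assms) (auto simp: permutes_in_image)

lemma det_fun_diag:
  assumes "\<And>i j. i < R \<Longrightarrow> j < R \<Longrightarrow> i \<noteq> j \<Longrightarrow> A i j = 0"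
  shows "det_fun R A = (\<Prod>i = 0..<R. A i i)"
proof -
  have "det_fun R A = prod_list (diag_mat (Matrix.mat R R (\<lambda>(i, j). A i j)))"
    by (rule det_upper_triangular[of _ R]) (auto simp: assms)
  also have "\<dots> = (\<Prod>i = 0..<R. A i i)"
    by (subst prod_list_diag_prod) (auto intro!: prod.cong)
  finally show ?thesis .
qed

lemma det_fun_row_sum:
  assumes "finite S" "k < R"
  shows "det_fun R (\<lambda>i j. if i = k then \<Sum>b\<in>S. c b * F b j else A i j)
         = (\<Sum>b\<in>S. c b * det_fun R (\<lambda>i j. if i = k then F b j else A i j))"
proof -
  have *: "(\<Prod>i = 0..<R. if i = k then G (q i) else A i (q i))
      = G (q k) * (\<Prod>i\<in>{0..<R} - {k}. A i (q i))" for G q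
    using assms(2) by (subst prod.remove[of _ k]) (auto intro!: prod.cong)
  have "det_fun R (\<lambda>i j. if i = k then \<Sum>b\<in>S. c b * F b j else A i j)
      = (\<Sum>q | q permutes {0..<R}. \<Sum>b\<in>S. c b * (signof q * (F b (q k) * (\<Prod>i\<in>{0..<R} - {k}. A i (q i)))))"
    unfolding det_fun_leibniz *[of "\<lambda>j. \<Sum>b\<in>S. c b * F b j"]
    by (simp add: sum_distrib_left sum_distrib_right ac_simps)
  also have "\<dots> = (\<Sum>b\<in>S. c b * det_fun R (\<lambda>i j. if i = k then F b j else A i j))"
    unfolding det_fun_leibniz *[of "F _"] by (subst sum.swap) (simp add: sum_distrib_left)
  finally show ?thesis .
qed

text \<open>Multilinearity of the determinant in its rows plays the role of Steinitz exchange modulo \<open>p\<close>.\<close>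

lemma det_fun_select_rows:
  fixes C :: "nat \<Rightarrow> 'b \<Rightarrow> int"
  assumes S: "\<And>i. i < R \<Longrightarrow> finite (S i)"
    and A: "\<And>i j. i < R \<Longrightarrow> j < R \<Longrightarrow> A i j = (\<Sum>b\<in>S i. C i b * F b j)"
    and det: "\<not> m dvd det_fun R A"
  shows "\<exists>s. (\<forall>i<R. s i \<in> S i) \<and> \<not> m dvd det_fun R (\<lambda>i j. F (s i) j)"
proof -
  have "\<exists>s. (\<forall>i<k. s i \<in> S i) \<and> \<not> m dvd det_fun R (\<lambda>i j. if i < k then F (s i) j else A i j)"
    if "k \<le> R" for k
    using that
  proof (induction k)
    case 0
    show ?case using det by simp
  next
    case (Suc k)
    then obtain s where s: "\<And>i. i < k \<Longrightarrow> s i \<in> S i"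
      and ndvd: "\<not> m dvd det_fun R (\<lambda>i j. if i < k then F (s i) j else A i j)" by auto
    have "det_fun R (\<lambda>i j. if i < k then F (s i) j else A i j)
        = det_fun R (\<lambda>i j. if i = k then \<Sum>b\<in>S k. C k b * F b j
                            else if i < k then F (s i) j else A i j)"
      using Suc.prems by (intro det_fun_cong) (auto simp: A)
    also have "\<dots> = (\<Sum>b\<in>S k. C k b * det_fun R (\<lambda>i j. if i = k then F b j
                            else if i < k then F (s i) j else A i j))"
      using Suc.prems by (intro det_fun_row_sum S) auto
    finally obtain b where b: "b \<in> S k" "\<not> m dvd det_fun R (\<lambda>i j. if i = k then F b j
                            else if i < k then F (s i) j else A i j)"
      using ndvd by (metis (no_types, lifting) dvd_mult dvd_sum)
    have "det_fun R (\<lambda>i j. if i = k then F b j else if i < k then F (s i) j else A i j)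
        = det_fun R (\<lambda>i j. if i < Suc k then F ((s(k := b)) i) j else A i j)"
      by (intro det_fun_cong) auto
    with b s show ?case
      by (intro exI[of _ "s(k := b)"]) (auto simp: less_Suc_eq)
  qed
  from this[of R] obtain s where s: "\<forall>i<R. s i \<in> S i"
    and ndvd: "\<not> m dvd det_fun R (\<lambda>i j. if i < R then F (s i) j else A i j)" by auto
  have "det_fun R (\<lambda>i j. if i < R then F (s i) j else A i j) = det_fun R (\<lambda>i j. F (s i) j)"
    by (intro det_fun_cong) auto
  with s ndvd show ?thesis by auto
qed

lemma mat_mult_vec_index:
  "i < R \<Longrightarrow> vec_index (Matrix.mat R R (\<lambda>(i, j). A i j) *\<^sub>v Matrix.vec R c) i = (\<Sum>j<R. A i j * c j)"
  by (auto simp: scalar_prod_def lessThan_atLeast0 intro!: sum.cong)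

lemma det_fun_kernel:
  fixes A :: "nat \<Rightarrow> nat \<Rightarrow> 'a :: field"
  assumes "det_fun R A \<noteq> 0" "\<And>i. i < R \<Longrightarrow> (\<Sum>j<R. A i j * c j) = 0" "j < R"
  shows "c j = 0"
proof -
  have "Matrix.mat R R (\<lambda>(i, j). A i j) *\<^sub>v Matrix.vec R c = 0\<^sub>v R"
    using assms(2) by (intro eq_vecI) (auto simp: mat_mult_vec_index simp del: index_mult_mat_vec)
  with assms(1) have "Matrix.vec R c = 0\<^sub>v R"
    using det_0_iff_vec_prod_zero_field[of "Matrix.mat R R (\<lambda>(i, j). A i j)" R]
    by (metis mat_carrier vec_carrier)
  with assms(3) show ?thesis by (metis index_vec index_zero_vec(1))
qed

text \<open>Zero rows pad the fewer than \<open>R\<close> equations to a square system, whose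
  determinant vanishes because row \<open>card Q\<close> is zero.\<close>

lemma homogeneous_system_solution:
  fixes F :: "'q \<Rightarrow> nat \<Rightarrow> 'a :: field"
  assumes "finite Q" "card Q < R"
  obtains c where "\<exists>j<R. c j \<noteq> 0" "\<And>q. q \<in> Q \<Longrightarrow> (\<Sum>j<R. F q j * c j) = 0"
proof -
  obtain h where h: "bij_betw h {0..<card Q} Q"
    using ex_bij_betw_nat_finite[OF assms(1)] by blast
  define A where "A i j = (if i < card Q then F (h i) j else 0)" for i j
  have "det_fun R A = 0"
    unfolding det_fun_leibniz
    using assms(2) by (intro sum.neutral ballI) (auto simp: A_def intro!: bexI[of _ "card Q"])
  then obtain v where v: "v \<in> carrier_vec R" "v \<noteq> 0\<^sub>v R"
      "Matrix.mat R R (\<lambda>(i, j). A i j) *\<^sub>v v = 0\<^sub>v R"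
    using det_0_iff_vec_prod_zero_field[of "Matrix.mat R R (\<lambda>(i, j). A i j)" R] by auto
  define c where "c = vec_index v"
  have vc: "v = Matrix.vec R c" using v(1) by (intro eq_vecI) (auto simp: c_def)
  show ?thesis
  proof
    show "\<exists>j<R. c j \<noteq> 0"
      using v(2) unfolding vc by (metis (no_types, lifting) dim_vec eq_vecI index_vec index_zero_vec)
  next
    fix q assume "q \<in> Q"
    then obtain i where i: "i < card Q" "h i = q" using h unfolding bij_betw_def by force
    have "(\<Sum>j<R. A i j * c j) = 0"
      using mat_mult_vec_index[of i R A c] v(3) i(1) assms(2) unfolding vc by simp
    with i show "(\<Sum>j<R. F q j * c j) = 0" by (simp add: A_def)
  qed
qed

section \<open>Interpolation nodes\<close>

text \<open>The order of vanishing at 0, modulo \<open>p\<close>, of the difference of two nodes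
  whose indices are \<open>l\<close> apart. Each factor \<open>p\<close> of \<open>l\<close>
  substitutes \<open>(1 + x)^p - 1\<close>, which is \<open>x^p\<close> modulo \<open>p\<close>, and
  so multiplies the order by \<open>p\<close>; after \<open>k\<close> levels only
  \<open>digit_poly\<close> is left, whose contribution is additive.\<close>

fun node_val :: "nat \<Rightarrow> nat \<Rightarrow> nat \<Rightarrow> nat" where
  "node_val p 0 l = 1 + multiplicity p l"
| "node_val p (Suc k) l = (if p dvd l then p * node_val p k (l div p) else 1)"

text \<open>The order of the product of the node differences over the gaps 1 to \<open>e\<close>:
  the generalised factorial that occurs as the denominator of a divided difference.\<close>

definition node_fact_val :: "nat \<Rightarrow> nat \<Rightarrow> nat \<Rightarrow> nat" where
  "node_fact_val p k e = (\<Sum>l = 1..e. node_val p k l)"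

fun digit_poly :: "nat \<Rightarrow> nat \<Rightarrow> int poly" where
  "digit_poly p l = (if l = 0 \<or> p < 2 then 0 else pCons (int (l mod p)) (digit_poly p (l div p)))"

declare digit_poly.simps [simp del]

text \<open>A node is congruent to \<open>(1 + x)\<^sup>l\<close> modulo \<open>(1 + x)\<close> to the power \<open>p ^ k\<close> minus \<open>1\<close>. Only the lowest \<open>k\<close> digits of \<open>l\<close>
  enter as exponents; the others enter through \<open>digit_poly\<close>, so that the valuation of a difference of nodes exceeds
  \<open>p ^ k\<close> only logarithmically.\<close>

fun node_poly :: "nat \<Rightarrow> nat \<Rightarrow> nat \<Rightarrow> int poly" where
  "node_poly p 0 l = 1 + pCons 0 (digit_poly p l)"
| "node_poly p (Suc k) l =
     [:1, 1:] ^ (l mod p) * pcompose (node_poly p k (l div p)) ([:1, 1:] ^ p - 1)"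

section \<open>Growth of the generalised factorial\<close>

lemma sum_split_multiples:
  fixes g :: "nat \<Rightarrow> nat"
  assumes "p > 0"
  shows "(\<Sum>l = 1..e. if p dvd l then g (l div p) else 0) = (\<Sum>l = 1..e div p. g l)"
proof -
  have "(\<Sum>l = 1..e. if p dvd l then g (l div p) else 0) = (\<Sum>l\<in>{l \<in> {1..e}. p dvd l}. g (l div p))"
    by (subst sum.inter_filter) auto
  also have "\<dots> = (\<Sum>l = 1..e div p. g l)"
    using assms
    by (intro sum.reindex_bij_witness[of _ "\<lambda>l. p * l" "\<lambda>l. l div p"])
       (auto simp: less_eq_div_iff_mult_less_eq mult.commute div_le_mono dvd_div_eq_0_iff
             intro: Suc_leI elim!: dvdE)
  finally show ?thesis .
qed

lemma multiplicity_div_prime: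
  fixes p l :: nat
  assumes "prime p" "p dvd l" "l > 0"
  shows "multiplicity p l = Suc (multiplicity p (l div p))"
proof -
  from assms obtain m where l: "l = p * m" "m > 0" by (auto elim!: dvdE)
  with assms show ?thesis
    using multiplicity_times_same[of m p] by (auto dest: prime_gt_1_nat)
qed

lemma node_fact_val_0:
  assumes "prime p"
  shows "node_fact_val p 0 e = e + node_fact_val p 0 (e div p)"
proof -
  have "node_fact_val p 0 e = (\<Sum>l = 1..e. 1 + (if p dvd l then node_val p 0 (l div p) else 0))"
    unfolding node_fact_val_def
    by (intro sum.cong) (auto simp: multiplicity_div_prime[OF assms] not_dvd_imp_multiplicity_0)
  also have "\<dots> = e + node_fact_val p 0 (e div p)"
    unfolding node_fact_val_def sum.distrib
    using sum_split_multiples[OF prime_gt_0_nat[OF assms], of "node_val p 0" e]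
    by (simp del: node_val.simps)
  finally show ?thesis .
qed

lemma node_fact_val_Suc:
  assumes "prime p"
  shows "node_fact_val p (Suc k) e \<le> e + p * node_fact_val p k (e div p)"
proof -
  have "node_fact_val p (Suc k) e \<le> (\<Sum>l = 1..e. 1 + (if p dvd l then p * node_val p k (l div p) else 0))"
    unfolding node_fact_val_def by (intro sum_mono) auto
  also have "\<dots> = e + p * node_fact_val p k (e div p)"
    unfolding node_fact_val_def sum.distrib
    using sum_split_multiples[OF prime_gt_0_nat[OF assms], of "\<lambda>l. p * node_val p k l" e]
    by (simp add: sum_distrib_left)
  finally show ?thesis .
qed

text \<open>Of the gaps up to \<open>e\<close> only the \<open>e div p\<close> multiples of
  \<open>p\<close> pass to the next level, and the factor \<open>p\<close> there compensates their
  scarcity, so each of the \<open>k\<close> levels costs at most \<open>e\<close>. The bottom level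
  costs at most \<open>e + e/p + e/p^2 + ...\<close>, hence at most \<open>2 * e\<close>.\<close>

lemma node_fact_val_le:
  assumes "prime p"
  shows "node_fact_val p k e \<le> e * (k + 2)"
proof (induction k arbitrary: e)
  case 0
  show ?case
  proof (induction e rule: less_induct)
    case (less e)
    show ?case
    proof (cases "e = 0")
      case False
      with assms have "e div p < e" using prime_gt_1_nat by (intro div_less_dividend) auto
      from less[OF this] have "node_fact_val p 0 e \<le> e + 2 * (e div p)"
        by (subst node_fact_val_0[OF assms]) auto
      also have "2 * (e div p) \<le> p * (e div p)" using prime_ge_2_nat[OF assms] by simp
      also have "\<dots> \<le> e" by simp
      finally show ?thesis by simp
    qed (simp add: node_fact_val_def)
  qed
next
  case (Suc k)
  have "node_fact_val p (Suc k) e \<le> e + p * ((e div p) * (k + 2))"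
    using node_fact_val_Suc[OF assms, of k e] Suc.IH[of "e div p"]
    by (meson add_left_mono le_trans mult_le_mono2)
  also have "p * ((e div p) * (k + 2)) = (p * (e div p)) * (k + 2)" by (simp only: mult.assoc)
  also have "\<dots> \<le> e * (k + 2)" by (intro mult_right_mono) auto
  finally show ?case by simp
qed

text \<open>Again every level costs at most \<open>e\<close>, but now the levels are counted by the
  digits of \<open>e\<close>: after \<open>T\<close> divisions by \<open>p\<close> no gap is left.
  The induction is on \<open>T\<close> with \<open>k\<close> arbitrary because the recursion stays
  at level 0 once it is there.\<close>

lemma node_fact_val_le_log:
  assumes "prime p" "e < p ^ T"
  shows "node_fact_val p k e \<le> e * T"
  using assms(2)
proof (induction T arbitrary: e k)
  case 0
  then show ?case by (simp add: node_fact_val_def)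
next
  case (Suc T)
  from Suc.prems have lt: "e div p < p ^ T"
    using prime_gt_0_nat[OF assms(1)] by (simp add: less_mult_imp_div_less mult.commute)
  show ?case
  proof (cases k)
    case 0
    have "node_fact_val p k e \<le> e + (e div p) * T"
      using Suc.IH[OF lt, of 0] unfolding 0 by (subst node_fact_val_0[OF assms(1)]) auto
    also have "\<dots> \<le> e + e * T" by (intro add_left_mono mult_right_mono) auto
    finally show ?thesis by simp
  next
    case (Suc k')
    have "node_fact_val p k e \<le> e + p * ((e div p) * T)"
      using node_fact_val_Suc[OF assms(1), of k' e] Suc.IH[OF lt, of k'] unfolding Suc
      by (meson add_left_mono le_trans mult_le_mono2)
    also have "p * ((e div p) * T) = (p * (e div p)) * T" by simp
    also have "\<dots> \<le> e * T" by (intro mult_right_mono) auto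
    finally show ?thesis by simp
  qed
qed

text \<open>At the bottom level \<open>z = 1\<close>, so the argument is 0 and the digit polynomial
  is invisible. On the relevant roots of unity a node curve therefore passes through the same points
  as a monomial curve.\<close>

lemma poly_node_poly_root_of_unity:
  fixes z :: "'a :: comm_ring_1"
  assumes "z ^ (p ^ k) = 1"
  shows "poly (map_poly of_int (node_poly p k l)) (z - 1) = z ^ l"
  using assms
proof (induction k arbitrary: z l)
  case 0
  then show ?case by (simp add: hom_distribs)
next
  case (Suc k)
  have "(z ^ p) ^ (p ^ k) = 1" using Suc.prems by (simp add: power_mult)
  note IH = Suc.IH[OF this, of "l div p"]
  have lin: "poly (map_poly of_int ([:1, 1:] ^ r)) (z - 1) = z ^ r" for r
    by (simp add: hom_distribs)
  have "poly (map_poly of_int (node_poly p (Suc k) l)) (z - 1) = z ^ (l mod p) * (z ^ p) ^ (l div p)"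
    using IH lin[of "l mod p"] lin[of p] by (simp add: hom_distribs poly_pcompose)
  also have "\<dots> = z ^ (l mod p + p * (l div p))" by (simp only: power_add power_mult)
  also have "l mod p + p * (l div p) = l" by simp
  finally show ?case .
qed

lemma poly_node_poly_0 [simp]: "poly (node_poly p k l) 0 = 1"
  by (induction k arbitrary: l) (simp_all add: poly_pcompose)

text \<open>The base \<open>p\<close> digits of \<open>l\<close> and \<open>m\<close> first differ
  at position \<open>multiplicity p (m - l)\<close>, and two different digits are incongruent modulo
  \<open>p\<close>.\<close>

lemma digit_poly_diff:
  assumes p: "prime p" and "l < m"
  shows "\<exists>U. digit_poly p m - digit_poly p l = monom 1 (multiplicity p (m - l)) * U
             \<and> \<not> int p dvd coeff U 0"
  using assms(2)
proof (induction m arbitrary: l rule: less_induct)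
  case (less m)
  have p2: "p \<ge> 2" using p by (rule prime_ge_2_nat)
  have rec: "digit_poly p j = pCons (int (j mod p)) (digit_poly p (j div p))" for j
    using p2 by (subst digit_poly.simps) (auto simp: digit_poly.simps)
  let ?D = "digit_poly p (m div p) - digit_poly p (l div p)"
  have eq: "digit_poly p m - digit_poly p l = pCons (int (m mod p) - int (l mod p)) ?D"
    by (subst (1 2) rec) simp
  show ?case
  proof (cases "m mod p = l mod p")
    case True
    have ml: "m - l = p * (m div p - l div p)"
      using True by (metis minus_mod_eq_mult_div mod_mult_div_eq diff_mult_distrib2 add_diff_cancel_left)
    have "m div p - l div p \<noteq> 0" using ml less.prems by (intro notI) simp
    then have lt: "l div p < m div p" by simp
    have "m div p < m" using p2 less.prems by (intro div_less_dividend) auto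
    from less.IH[OF this lt] obtain U where
      U: "?D = monom 1 (multiplicity p (m div p - l div p)) * U" "\<not> int p dvd coeff U 0" by auto
    have "multiplicity p (m - l) = Suc (multiplicity p (m div p - l div p))"
      using multiplicity_div_prime[OF p, of "m - l"] less.prems p2 lt by (simp add: ml)
    with U show ?thesis unfolding eq True by (auto intro!: exI[of _ U] simp: monom_Suc)
  next
    case False
    have "\<not> p dvd m - l" using False less.prems
      by (metis mod_eq_dvd_iff_nat less_imp_le_nat)
    moreover have "\<not> int p dvd int (m mod p) - int (l mod p)"
      using False by (metis mod_eq_dvd_iff mod_mod_trivial of_nat_mod of_nat_eq_iff)
    ultimately show ?thesis
      unfolding eq by (intro exI[of _ "pCons (int (m mod p) - int (l mod p)) ?D"])
        (auto simp: not_dvd_imp_multiplicity_0)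
  qed
qed

lemma one_plus_x_power_prime:
  assumes "prime p"
  shows "\<exists>Q. [:1, 1:] ^ p - 1 = monom 1 p + smult (int p) Q"
proof -
  have "[:1, 1 :: int:] ^ p = (1 + monom 1 1) ^ p" by (simp add: monom_Suc one_pCons)
  also have "\<dots> = (\<Sum>i\<le>p. of_nat (p choose i) * monom 1 i)"
    by (subst add.commute, subst binomial_ring) (simp add: monom_power)
  also have "{..p} = insert 0 (insert p {0<..<p})" by auto
  also have "(\<Sum>i\<in>\<dots>. of_nat (p choose i) * monom 1 i) =
     1 + (monom 1 p + (\<Sum>i\<in>{0<..<p}. of_nat (p choose i) * monom (1::int) i))"
    using prime_gt_0_nat[OF assms] by (subst sum.insert; simp)+
  also have "(\<Sum>i\<in>{0<..<p}. of_nat (p choose i) * monom 1 i) =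
      (\<Sum>i\<in>{0<..<p}. smult (int p) (of_nat ((p choose i) div p) * monom (1::int) i))"
  proof (intro sum.cong refl)
    fix i assume "i \<in> {0<..<p}"
    then have "p dvd p choose i" using assms by (intro dvd_choose_prime) auto
    then have "int (p choose i) = int p * int ((p choose i) div p)" by (metis dvd_mult_div_cancel of_nat_mult)
    then show "of_nat (p choose i) * monom (1::int) i = smult (int p) (of_nat ((p choose i) div p) * monom 1 i)"
      by (simp add: of_nat_poly smult_monom)
  qed
  also have "\<dots> = smult (int p) (\<Sum>i\<in>{0<..<p}. of_nat ((p choose i) div p) * monom (1::int) i)"
    by (rule smult_sum2 [symmetric])
  finally show ?thesis by (metis add_diff_cancel_left')
qed

lemma power_add_smult:
  "\<exists>Q'. (a + smult m Q) ^ j = a ^ j + smult m Q'" for a Q :: "int poly"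
proof (induction j)
  case (Suc j)
  then obtain Q' where "(a + smult m Q) ^ j = a ^ j + smult m Q'" by auto
  then have "(a + smult m Q) ^ Suc j = a ^ Suc j + smult m (a * Q' + Q * a ^ j + smult m (Q * Q'))"
    by (simp add: algebra_simps smult_add_right)
  then show ?case by blast
qed (auto intro: exI[of _ 0])

lemma coeff_1_eq_pderiv: "coeff q 1 = poly (pderiv q) 0" for q :: "int poly"
  by (simp add: poly_0_coeff_0 coeff_pderiv)

text \<open>If the lowest digits agree, their common power of \<open>1 + x\<close> factors out and
  the substitution acts as Frobenius modulo \<open>p\<close>, multiplying the order by
  \<open>p\<close>. If they differ, the linear coefficients already differ modulo \<open>p\<close>
  and the order is 1. Congruence modulo \<open>p\<close> is carried as an explicit term
  \<open>smult (int p) H\<close> over the integers.\<close>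

lemma node_poly_diff:
  assumes p: "prime p" and "l < m"
  shows "\<exists>U H. node_poly p k m - node_poly p k l = monom 1 (node_val p k (m - l)) * U + smult (int p) H
               \<and> \<not> int p dvd coeff U 0"
  using assms(2)
proof (induction k arbitrary: l m)
  case 0
  from digit_poly_diff[OF p 0] obtain U where
    U: "digit_poly p m - digit_poly p l = monom 1 (multiplicity p (m - l)) * U" "\<not> int p dvd coeff U 0"
    by auto
  have "node_poly p 0 m - node_poly p 0 l = pCons 0 (digit_poly p m - digit_poly p l)" by simp
  also have "\<dots> = monom 1 (node_val p 0 (m - l)) * U + smult (int p) 0"
    unfolding U by (simp add: monom_Suc)
  finally show ?case using U(2) by blast
next
  case (Suc k)
  define q :: "int poly" where "q = [:1, 1:] ^ p - 1"
  have q0: "poly q 0 = 0" by (simp add: q_def)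
  have rec: "node_poly p (Suc k) j = [:1, 1:] ^ (j mod p) * pcompose (node_poly p k (j div p)) q" for j
    by (simp add: q_def)
  show ?case
  proof (cases "m mod p = l mod p")
    case True
    have ml: "m - l = p * (m div p - l div p)"
      using True by (metis minus_mod_eq_mult_div mod_mult_div_eq diff_mult_distrib2 add_diff_cancel_left)
    have "m div p - l div p \<noteq> 0" using ml Suc.prems by (intro notI) simp
    then have lt: "l div p < m div p" by simp
    let ?v = "node_val p k (m div p - l div p)"
    from Suc.IH[OF lt] obtain U H where U: "node_poly p k (m div p) - node_poly p k (l div p)
        = monom 1 ?v * U + smult (int p) H" "\<not> int p dvd coeff U 0" by blast
    obtain Q where Q: "q = monom 1 p + smult (int p) Q"
      using one_plus_x_power_prime[OF p] by (auto simp: q_def)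
    obtain Q' where Q': "q ^ ?v = monom 1 (p * ?v) + smult (int p) Q'"
      using power_add_smult[of "monom 1 p" "int p" Q ?v] by (auto simp: Q monom_power)
    have pm: "pcompose (monom 1 j) q = q ^ j" for j
      by (induction j) (simp_all add: monom_Suc pcompose_pCons one_pCons)
    define W where "W = [:1, 1:] ^ (m mod p) * pcompose U q"
    have "node_poly p (Suc k) m - node_poly p (Suc k) l =
        [:1, 1:] ^ (m mod p) * pcompose (node_poly p k (m div p) - node_poly p k (l div p)) q"
      unfolding rec True by (simp add: pcompose_diff algebra_simps)
    also have "\<dots> = [:1, 1:] ^ (m mod p) * (q ^ ?v * pcompose U q + smult (int p) (pcompose H q))"
      unfolding U(1) by (simp add: pcompose_add pcompose_mult pcompose_smult pm)
    also have "\<dots> = monom 1 (p * ?v) * W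
        + smult (int p) (Q' * W + [:1, 1:] ^ (m mod p) * pcompose H q)"
      unfolding Q' W_def by (simp add: algebra_simps smult_add_right)
    finally have eq: "node_poly p (Suc k) m - node_poly p (Suc k) l = \<dots>" .
    have "coeff W 0 = coeff U 0" unfolding poly_0_coeff_0[symmetric] W_def by (simp add: poly_pcompose q0)
    moreover have "node_val p (Suc k) (m - l) = p * ?v" using prime_gt_0_nat[OF p] by (simp add: ml)
    ultimately show ?thesis using eq U(2) by metis
  next
    case False
    have ndvd: "\<not> p dvd m - l" using False Suc.prems by (metis mod_eq_dvd_iff_nat less_imp_le_nat)
    define A where "A j = node_poly p (Suc k) j" for j
    define U where "U = synthetic_div (A m - A l) 0"
    have "poly (A m - A l) 0 = 0" by (simp add: A_def del: node_poly.simps)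
    then have U: "A m - A l = monom 1 1 * U"
      using synthetic_div_correct'[of 0 "A m - A l"] by (simp add: U_def monom_Suc)
    \<comment> \<open>The derivative of \<open>q\<close> at 0 is \<open>p\<close>, so the composed
      factor changes the linear coefficient only by a multiple of \<open>p\<close>.\<close>
    have "coeff (A j) 1 = int (j mod p) + poly (pderiv (node_poly p k (j div p))) 0 * int p" for j
      unfolding coeff_1_eq_pderiv A_def rec pderiv_mult pderiv_pcompose poly_add poly_mult
      by (simp add: poly_pcompose q0 pderiv_power pderiv_pCons) (simp add: q_def pderiv_diff pderiv_power pderiv_pCons)
    then have "coeff U 0 = int (m mod p) - int (l mod p) + int p * 
        (poly (pderiv (node_poly p k (m div p))) 0 - poly (pderiv (node_poly p k (l div p))) 0)"
      using arg_cong[OF U, of "\<lambda>q. coeff q 1"] by (simp add: monom_Suc algebra_simps)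
    moreover have "\<not> int p dvd int (m mod p) - int (l mod p)"
      using False by (metis mod_eq_dvd_iff mod_mod_trivial of_nat_mod of_nat_eq_iff)
    ultimately have "\<not> int p dvd coeff U 0" by (metis dvd_add_times_triv_right_iff mult.commute)
    moreover have "A m - A l = monom 1 (node_val p (Suc k) (m - l)) * U + smult (int p) 0"
      using U ndvd by simp
    ultimately show ?thesis unfolding A_def by blast
  qed
qed

section \<open>Divided differences\<close>

text \<open>The divided difference at the listed nodes, that is, the last coefficient of Newton's
  interpolation form. Iterated synthetic division involves no denominators, so repeated nodes and
  arbitrary commutative rings are allowed. The value 0 at the empty list is what makes
  \<open>newton_coeff_pCons_0\<close> hold for a single node.\<close>

fun newton_coeff :: "'a :: comm_ring_1 list \<Rightarrow> 'a poly \<Rightarrow> 'a" where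
  "newton_coeff [] F = 0"
| "newton_coeff [x] F = poly F x"
| "newton_coeff (x # y # ys) F = newton_coeff (y # ys) (synthetic_div F x)"

lemma newton_coeff_Cons: "xs \<noteq> [] \<Longrightarrow> newton_coeff (x # xs) F = newton_coeff xs (synthetic_div F x)"
  by (cases xs) auto

lemma synthetic_div_linear_mult [simp]: "synthetic_div ([:-c, 1:] * Q) c = Q"
  for Q :: "'a :: comm_ring_1 poly"
  using synthetic_div_unique[of "[:-c, 1:] * Q" c Q 0] by simp

lemma synthetic_div_add: "synthetic_div (F + G) c = synthetic_div F c + synthetic_div G c"
  for F G :: "'a :: comm_ring_1 poly"
proof -
  have "F + G + smult c (synthetic_div F c + synthetic_div G c)
     = pCons (poly (F + G) c) (synthetic_div F c + synthetic_div G c)"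
    using synthetic_div_correct[of F c] synthetic_div_correct[of G c]
    by (simp add: smult_add_right) (metis (no_types, lifting) add.commute add.left_commute add_pCons)
  then show ?thesis using synthetic_div_unique by metis
qed

lemma newton_coeff_add: "newton_coeff rs (F + G) = newton_coeff rs F + newton_coeff rs G"
  by (induction rs F arbitrary: G rule: newton_coeff.induct) (auto simp: synthetic_div_add)

lemma newton_coeff_0 [simp]: "newton_coeff rs 0 = 0"
  by (induction rs "0 :: 'a poly" rule: newton_coeff.induct) auto

lemma synthetic_div_smult: "synthetic_div (smult a F) c = smult a (synthetic_div F c)"
  for F :: "'a :: comm_ring_1 poly"
proof -
  have "smult a F + smult c (smult a (synthetic_div F c)) = pCons (poly (smult a F) c) (smult a (synthetic_div F c))"
    using arg_cong[OF synthetic_div_correct[of F c], of "smult a"] by (simp add: smult_add_right mult.commute)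
  then show ?thesis using synthetic_div_unique by metis
qed

lemma newton_coeff_smult: "newton_coeff rs (smult a F) = a * newton_coeff rs F"
  by (induction rs F rule: newton_coeff.induct) (auto simp: synthetic_div_smult)

lemma newton_coeff_sum: "newton_coeff rs (\<Sum>i\<in>I. F i) = (\<Sum>i\<in>I. newton_coeff rs (F i))"
  by (induction I rule: infinite_finite_induct) (auto simp: newton_coeff_add)

lemma newton_coeff_diff: "newton_coeff rs (F - G) = newton_coeff rs F - newton_coeff rs G"
  using newton_coeff_add[of rs "F - G" G] by simp

lemma newton_coeff_const: "newton_coeff rs [:c:] = (if length rs = 1 then c else 0)"
proof (cases rs)
  case (Cons x xs)
  then show ?thesis by (cases xs) auto
qed simp

lemma newton_coeff_pCons: "newton_coeff rs (pCons a F) = newton_coeff rs [:a:] + newton_coeff rs (pCons 0 F)"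
  unfolding newton_coeff_add[symmetric] by simp

text \<open>The Leibniz rule for multiplication by the variable. It splits off the last node,
  whereas the recursion of \<open>newton_coeff\<close> removes the first; together they give the
  two-ended recurrence.\<close>

lemma newton_coeff_pCons_0:
  "newton_coeff (ys @ [y]) (pCons 0 G) = y * newton_coeff (ys @ [y]) G + newton_coeff ys G"
proof (induction ys arbitrary: G)
  case (Cons x xs)
  have *: "newton_coeff ((x # xs) @ [y]) F = newton_coeff (xs @ [y]) (synthetic_div F x)" for F
    by (simp add: newton_coeff_Cons)
  have "newton_coeff ((x # xs) @ [y]) (pCons 0 G)
      = newton_coeff (xs @ [y]) [:poly G x:] + newton_coeff (xs @ [y]) (pCons 0 (synthetic_div G x))"
    unfolding * synthetic_div_pCons by (rule newton_coeff_pCons)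
  also have "\<dots> = (if xs = [] then poly G x else 0)
      + (y * newton_coeff (xs @ [y]) (synthetic_div G x) + newton_coeff xs (synthetic_div G x))"
    unfolding Cons.IH newton_coeff_const by simp
  also have "\<dots> = y * newton_coeff ((x # xs) @ [y]) G + newton_coeff (x # xs) G"
    unfolding * by (cases xs) auto
  finally show ?case .
qed auto

text \<open>The classical recurrence, multiplied out because node differences need not be
  invertible.\<close>

lemma newton_coeff_recurrence:
  "(y - x) * newton_coeff (x # xs @ [y]) F = newton_coeff (xs @ [y]) F - newton_coeff (x # xs) F"
proof -
  define G where "G = synthetic_div F x"
  have F: "F = pCons 0 G - smult x G + [:poly F x:]"
    using synthetic_div_correct'[of x F] by (simp add: G_def algebra_simps)
  have "newton_coeff (xs @ [y]) F = y * newton_coeff (xs @ [y]) G + newton_coeff xs G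
      - x * newton_coeff (xs @ [y]) G + (if xs = [] then poly F x else 0)"
    by (subst F) (simp add: newton_coeff_add newton_coeff_diff newton_coeff_pCons_0 newton_coeff_smult newton_coeff_const)
  moreover have "newton_coeff (x # xs) F = newton_coeff xs G + (if xs = [] then poly F x else 0)"
    by (auto simp: newton_coeff_Cons G_def)
  ultimately show ?thesis by (simp add: newton_coeff_Cons G_def algebra_simps)
qed

lemma newton_coeff_hom:
  assumes "comm_ring_hom h"
  shows "h (newton_coeff rs F) = newton_coeff (map h rs) (map_poly h F)"
proof -
  interpret h: comm_ring_hom h by fact
  have "map_poly h (synthetic_div F x) = synthetic_div (map_poly h F) (h x)" for F x
    by (induction F) (simp_all add: h.map_poly_pCons_hom)
  then show ?thesis
    by (induction rs F rule: newton_coeff.induct) auto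
qed

text \<open>The confluent case: this is what a divided difference becomes when
  \<open>\<zeta>\<close> is specialised to 1 and all nodes merge.\<close>

lemma newton_coeff_replicate_0: "newton_coeff (replicate (Suc i) 0) F = coeff F i"
proof (induction i arbitrary: F)
  case (Suc i)
  have "coeff (synthetic_div F 0) i = coeff F (Suc i)"
    using arg_cong[OF synthetic_div_correct[of F 0], of "\<lambda>q. coeff q (Suc i)"] by simp
  with Suc show ?case by simp
qed (simp add: poly_0_coeff_0)

lemma newton_coeff_replicate_power:
  "newton_coeff (replicate (Suc e) c) ([:-c, 1:] ^ e') = (if e = e' then 1 else 0)"
proof (induction e arbitrary: e')
  case 0
  show ?case by (cases e') auto
next
  case (Suc e)
  show ?case
  proof (cases e')
    case 0
    then show ?thesis
      using newton_coeff_const[of "replicate (Suc (Suc e)) c" 1] by (simp add: one_pCons)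
  next
    case (Suc f)
    show ?thesis using Suc.IH[of f] by (simp only: Suc power_Suc replicate_Suc newton_coeff.simps synthetic_div_linear_mult) auto
  qed
qed

lemma newton_coeff_eq_0:
  "(\<Prod>r\<leftarrow>rs. [:-r, 1:]) dvd F \<Longrightarrow> newton_coeff rs F = 0"
  for F :: "'a :: comm_ring_1 poly"
proof (induction rs F rule: newton_coeff.induct)
  case (3 x y ys F)
  from "3.prems" obtain Q where "F = (\<Prod>r\<leftarrow>x # y # ys. [:-r, 1:]) * Q" by (rule dvdE)
  then have "F = [:-x, 1:] * ((\<Prod>r\<leftarrow>y # ys. [:-r, 1:]) * Q)"
    by (simp only: list.map prod_list.Cons mult.assoc)
  then have "synthetic_div F x = (\<Prod>r\<leftarrow>y # ys. [:-r, 1:]) * Q" by (simp only: synthetic_div_linear_mult)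
  with "3.IH" show ?case by simp
qed (auto elim!: dvdE)

text \<open>Clearing denominators in the recurrence. As the order \<open>\<nu>\<close> depends on
  the gap alone, the two blocks of length \<open>d\<close> carry the same power of the variable, and
  lengthening the block costs only one further \<open>\<nu> (Suc d)\<close>.\<close>

lemma newton_coeff_combination:
  fixes x :: "nat \<Rightarrow> int poly"
  assumes diff: "\<And>l m. l < m \<Longrightarrow> \<exists>U H. x m - x l = monom 1 (\<nu> (m - l)) * U + smult p H \<and> \<not> p dvd coeff U 0"
    and p: "prime p"
  shows "\<exists>A U. \<not> p dvd coeff U 0 \<and> (\<forall>g. \<exists>H. (\<Sum>l = a..a + d. A l * poly g (x l)) =
           monom 1 (\<Sum>l = 1..d. \<nu> l) * U * newton_coeff (map x [a..<a + Suc d]) g + smult p H)"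
proof (induction d arbitrary: a)
  case 0
  have "\<not> p dvd 1" using p not_prime_unit by blast
  then show ?case by (intro exI[of _ "\<lambda>_. 1"] exI[of _ 1]) (auto intro!: exI[of _ 0] simp: one_pCons monom_0)
next
  case (Suc d)
  let ?V = "\<Sum>l = 1..d. \<nu> l"
  obtain A U where U: "\<not> p dvd coeff U 0" and A: "\<And>g. \<exists>H. (\<Sum>l = a..a + d. A l * poly g (x l)) =
           monom 1 ?V * U * newton_coeff (map x [a..<a + Suc d]) g + smult p H" using Suc.IH[of a] by blast
  obtain B W where W: "\<not> p dvd coeff W 0" and B: "\<And>g. \<exists>H. (\<Sum>l = Suc a..Suc a + d. B l * poly g (x l)) =
           monom 1 ?V * W * newton_coeff (map x [Suc a..<Suc a + Suc d]) g + smult p H" using Suc.IH[of "Suc a"] by blast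
  obtain T H0 where T: "x (a + Suc d) - x a = monom 1 (\<nu> (Suc d)) * T + smult p H0" "\<not> p dvd coeff T 0"
    using diff[of a "a + Suc d"] by auto
  \<comment> \<open>Cross-multiplication by \<open>U\<close> and \<open>W\<close> gives both block
    combinations the same cofactor, so that their difference is governed by the recurrence.\<close>
  define C where "C l = (if l = a then 0 else U * B l) - (if l = a + Suc d then 0 else W * A l)" for l
  show ?case
  proof (rule exI[of _ C], rule exI[of _ "U * W * T"], intro conjI allI)
    show "\<not> p dvd coeff (U * W * T) 0"
      using U W T(2) p by (simp add: coeff_mult_0 prime_dvd_mult_iff)
    fix g
    obtain H1 where H1: "(\<Sum>l = a..a + d. A l * poly g (x l)) =
           monom 1 ?V * U * newton_coeff (map x [a..<a + Suc d]) g + smult p H1" using A by blast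
    obtain H2 where H2: "(\<Sum>l = Suc a..Suc a + d. B l * poly g (x l)) =
           monom 1 ?V * W * newton_coeff (map x [Suc a..<Suc a + Suc d]) g + smult p H2" using B by blast
    define N where "N = newton_coeff (map x [a..<a + Suc (Suc d)]) g"
    have up: "map x [a..<a + Suc (Suc d)] = x a # map x [Suc a..<a + Suc d] @ [x (a + Suc d)]"
      "map x [a..<a + Suc d] = x a # map x [Suc a..<a + Suc d]"
      "map x [Suc a..<Suc a + Suc d] = map x [Suc a..<a + Suc d] @ [x (a + Suc d)]"
      using upt_conv_Cons[of a "a + Suc (Suc d)"] upt_conv_Cons[of a "a + Suc d"]
        upt_Suc_append[of "Suc a" "a + Suc d"] by simp_all
    have rec: "(x (a + Suc d) - x a) * N = newton_coeff (map x [Suc a..<Suc a + Suc d]) g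
        - newton_coeff (map x [a..<a + Suc d]) g"
      using newton_coeff_recurrence[of "x (a + Suc d)" "x a" "map x [Suc a..<a + Suc d]" g]
      by (simp only: up N_def)
    have "(\<Sum>l = a..a + Suc d. C l * poly g (x l)) =
       (\<Sum>l = a..a + Suc d. (if l = a then 0 else U * B l * poly g (x l))) -
       (\<Sum>l = a..a + Suc d. (if l = a + Suc d then 0 else W * A l * poly g (x l)))"
      unfolding sum_subtractf[symmetric] by (intro sum.cong) (auto simp: C_def algebra_simps)
    also have "(\<Sum>l = a..a + Suc d. (if l = a then 0 else U * B l * poly g (x l))) =
       (\<Sum>l = Suc a..Suc a + d. U * B l * poly g (x l))"
      by (intro sum.mono_neutral_cong_right) auto
    also have "(\<Sum>l = a..a + Suc d. (if l = a + Suc d then 0 else W * A l * poly g (x l))) =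
       (\<Sum>l = a..a + d. W * A l * poly g (x l))"
      by (intro sum.mono_neutral_cong_right) auto
    also have "(\<Sum>l = Suc a..Suc a + d. U * B l * poly g (x l)) - (\<Sum>l = a..a + d. W * A l * poly g (x l))
       = U * (\<Sum>l = Suc a..Suc a + d. B l * poly g (x l)) - W * (\<Sum>l = a..a + d. A l * poly g (x l))"
      by (simp only: sum_distrib_left mult.assoc)
    also have "\<dots> = monom 1 ?V * (U * W) * ((x (a + Suc d) - x a) * N) + smult p (U * H2 - W * H1)"
      unfolding H1 H2 rec by (simp add: algebra_simps smult_diff_right)
    also have "\<dots> = (monom 1 ?V * monom 1 (\<nu> (Suc d))) * (U * W * T) * N
        + smult p (U * H2 - W * H1 + monom 1 ?V * U * W * H0 * N)"
      unfolding T(1) by (simp add: algebra_simps smult_add_right smult_diff_right)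
    also have "monom 1 ?V * monom 1 (\<nu> (Suc d)) = monom (1::int) (\<Sum>l = 1..Suc d. \<nu> l)"
      by (simp add: mult_monom)
    finally have "(\<Sum>l = a..a + Suc d. C l * poly g (x l)) = monom 1 (\<Sum>l = 1..Suc d. \<nu> l) * (U * W * T) * newton_coeff (map x [a..<a + Suc (Suc d)]) g
        + smult p (U * H2 - W * H1 + monom 1 ?V * U * W * H0 * N)" unfolding N_def .
    then show "\<exists>H. (\<Sum>l = a..a + Suc d. C l * poly g (x l)) = monom 1 (\<Sum>l = 1..Suc d. \<nu> l) * (U * W * T)
        * newton_coeff (map x [a..<a + Suc (Suc d)]) g + smult p H" by blast
  qed
qed

text \<open>The divided difference is applied to \<open>(X - 1)^e'\<close>. At \<open>x = 0\<close>
  all nodes equal 1, where the divided difference of order \<open>e\<close> of this power is 1 or 0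
  according as \<open>e = e'\<close>. Hence the coefficient of \<open>x\<close> to the power
  \<open>node_fact_val p k e\<close> isolates the exponent \<open>e\<close> modulo
  \<open>p\<close>.\<close>

lemma node_poly_extract:
  assumes p: "prime p"
  shows "\<exists>A u. \<not> int p dvd u \<and> (\<forall>e'. \<exists>D H. (\<Sum>l\<le>e. A l * (node_poly p k l - 1) ^ e') =
           monom 1 (node_fact_val p k e) * D + smult (int p) H \<and> coeff D 0 = (if e = e' then u else 0))"
proof -
  have p': "prime (int p)" using p by simp
  have "\<exists>A U. \<not> int p dvd coeff U 0 \<and> (\<forall>g. \<exists>H. (\<Sum>l = 0..0 + e. A l * poly g (node_poly p k l)) =
      monom 1 (\<Sum>l = 1..e. node_val p k l) * U * newton_coeff (map (node_poly p k) [0..<0 + Suc e]) g + smult (int p) H)"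
  proof (rule newton_coeff_combination)
    show "\<exists>U H. node_poly p k m - node_poly p k l = monom 1 (node_val p k (m - l)) * U + smult (int p) H
        \<and> \<not> int p dvd coeff U 0" if "l < m" for l m
      using node_poly_diff[OF p that] .
  qed (fact p')
  then obtain A U where U: "\<not> int p dvd coeff U 0" and A: "\<And>g. \<exists>H. (\<Sum>l\<le>e. A l * poly g (node_poly p k l)) =
      monom 1 (node_fact_val p k e) * U * newton_coeff (map (node_poly p k) [0..<Suc e]) g + smult (int p) H"
    unfolding add_0 atLeast0AtMost node_fact_val_def by auto
  have hom0: "comm_ring_hom (\<lambda>q :: int poly. poly q 0)" by standard auto
  interpret e0m: map_poly_comm_ring_hom "\<lambda>q :: int poly. poly q 0" ..
  show ?thesis
  proof (intro exI[of _ A] exI[of _ "coeff U 0"] conjI allI)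
    fix e'
    define g :: "int poly poly" where "g = [:-1, 1:] ^ e'"
    define N where "N = newton_coeff (map (node_poly p k) [0..<Suc e]) g"
    have g: "map_poly (\<lambda>q :: int poly. poly q 0) g = [:-1, 1:] ^ e'"
      by (simp add: g_def e0m.hom_power)
    have r: "map (\<lambda>l. 1 :: int) [0..<Suc e] = replicate (Suc e) 1"
      by (simp add: map_replicate_const del: upt_Suc replicate_Suc)
    have "poly N 0 = newton_coeff (replicate (Suc e) 1) ([:-1, 1:] ^ e')"
      unfolding N_def newton_coeff_hom[OF hom0] g map_map comp_def poly_node_poly_0 r ..
    then have "poly N 0 = (if e = e' then 1 else 0)"
      unfolding newton_coeff_replicate_power .
    then have c: "coeff (U * N) 0 = (if e = e' then coeff U 0 else 0)"
      by (simp add: coeff_mult_0 poly_0_coeff_0)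
    obtain H where "(\<Sum>l\<le>e. A l * poly g (node_poly p k l)) =
        monom 1 (node_fact_val p k e) * U * N + smult (int p) H"
      unfolding N_def using A[of g] by (elim exE)
    then have "(\<Sum>l\<le>e. A l * (node_poly p k l - 1) ^ e') =
        monom 1 (node_fact_val p k e) * (U * N) + smult (int p) H"
      by (simp add: mult.assoc g_def)
    with c show "\<exists>D H. (\<Sum>l\<le>e. A l * (node_poly p k l - 1) ^ e') =
        monom 1 (node_fact_val p k e) * D + smult (int p) H \<and> coeff D 0 = (if e = e' then coeff U 0 else 0)"
      by blast
  qed (fact U)
qed

text \<open>Products of the one-variable extractions over the coordinates give a matrix that is
  diagonal modulo \<open>p\<close> with units on the diagonal. Its rows mix many node curves;
  \<open>det_fun_select_rows\<close> replaces each row by one coefficient along one curve.\<close>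

lemma node_poly_basis:
  fixes es :: "nat list list"
  assumes p: "prime p" and dist: "distinct es" and len: "\<And>e. e \<in> set es \<Longrightarrow> length e = n"
  shows "\<exists>g \<iota>. (\<forall>i<length es. \<iota> i \<le> (\<Sum>l<n. node_fact_val p k (es ! i ! l))) \<and>
     \<not> int p dvd det_fun (length es)
        (\<lambda>i j. coeff (\<Prod>l<n. (node_poly p k (g i l) - 1) ^ (es ! j ! l)) (\<iota> i))"
proof -
  let ?R = "length es" and ?m = "\<lambda>g e. \<Prod>l<n. (node_poly p k (g l) - 1) ^ (e ! l)"
  have p': "prime (int p)" using p by simp
  have "\<forall>e. \<exists>A u. \<not> int p dvd u \<and> (\<forall>e'. \<exists>D H. (\<Sum>l\<le>e. A l * (node_poly p k l - 1) ^ e') =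
           monom 1 (node_fact_val p k e) * D + smult (int p) H \<and> coeff D 0 = (if e = e' then u else 0))"
    by (intro allI node_poly_extract[OF p])
  then obtain A u where u: "\<And>e. \<not> int p dvd u e" and A: "\<And>e e'. \<exists>D H. (\<Sum>l\<le>e. A e l * (node_poly p k l - 1) ^ e') =
           monom 1 (node_fact_val p k e) * D + smult (int p) H \<and> coeff D 0 = (if e = e' then u e else 0)"
    unfolding choice_iff by blast
  define V where "V e = (\<Sum>l<n. node_fact_val p k (e ! l))" for e :: "nat list"
  define G where "G e = PiE {..<n} (\<lambda>l. {..e ! l})" for e :: "nat list"
  define M where "M e e' = coeff (\<Prod>l<n. \<Sum>h\<le>e ! l. A (e ! l) h * (node_poly p k h - 1) ^ (e' ! l)) (V e)" for e e'
  \<comment> \<open>An index \<open>b\<close> pairs a choice \<open>g\<close> of one node per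
    coordinate with a coefficient order \<open>j\<close>. Convolution with the extraction
    coefficients, which are polynomials, produces all orders \<open>j \<le> V\<close>; this is the
    source of the bound on \<open>\<iota>\<close>.\<close>
  define C where "C i b = coeff (\<Prod>l<n. A (es ! i ! l) (fst b l)) (V (es ! i) - snd b)" for i and b :: "(nat \<Rightarrow> nat) \<times> nat"
  have expand: "M (es ! i) e' = (\<Sum>b\<in>G (es ! i) \<times> {..V (es ! i)}. C i b * coeff (?m (fst b) e') (snd b))"
    for i e'
  proof -
    have "M (es ! i) e' = coeff (\<Sum>g\<in>G (es ! i). (\<Prod>l<n. A (es ! i ! l) (g l)) * ?m g e') (V (es ! i))"
      unfolding M_def G_def by (subst prod_sum_PiE) (auto simp: prod.distrib)
    also have "\<dots> = (\<Sum>g\<in>G (es ! i). coeff (?m g e' * (\<Prod>l<n. A (es ! i ! l) (g l))) (V (es ! i)))"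
      by (simp only: coeff_sum mult.commute)
    also have "\<dots> = (\<Sum>g\<in>G (es ! i). \<Sum>j\<le>V (es ! i). coeff (?m g e') j * C i (g, j))"
      by (simp only: coeff_mult C_def fst_conv snd_conv)
    also have "\<dots> = (\<Sum>b\<in>G (es ! i) \<times> {..V (es ! i)}. C i b * coeff (?m (fst b) e') (snd b))"
      by (simp add: sum.cartesian_product case_prod_unfold mult.commute)
    finally show ?thesis .
  qed
  have M: "[M e e' = (if e = e' then \<Prod>l<n. u (e ! l) else 0)] (mod int p)"
    if "e \<in> set es" "e' \<in> set es" for e e'
  proof -
    have "\<forall>l. \<exists>D H. (\<Sum>h\<le>e ! l. A (e ! l) h * (node_poly p k h - 1) ^ (e' ! l)) =
        monom 1 (node_fact_val p k (e ! l)) * D + smult (int p) H \<and>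
        coeff D 0 = (if e ! l = e' ! l then u (e ! l) else 0)"
      by (intro allI A)
    then obtain D H where DH: "\<And>l. (\<Sum>h\<le>e ! l. A (e ! l) h * (node_poly p k h - 1) ^ (e' ! l)) =
        monom 1 (node_fact_val p k (e ! l)) * D l + smult (int p) (H l)"
      "\<And>l. coeff (D l) 0 = (if e ! l = e' ! l then u (e ! l) else 0)"
      unfolding choice_iff by blast
    have "\<exists>H'. (\<Prod>l<r. monom 1 (node_fact_val p k (e ! l)) * D l + smult (int p) (H l))
        = monom 1 (\<Sum>l<r. node_fact_val p k (e ! l)) * (\<Prod>l<r. D l) + smult (int p) H'" for r
    proof (induction r)
      case 0
      show ?case by (auto intro!: exI[of _ 0] simp: one_pCons monom_0)
    next
      case (Suc r)
      then obtain H' where "(\<Prod>l<r. monom 1 (node_fact_val p k (e ! l)) * D l + smult (int p) (H l))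
        = monom 1 (\<Sum>l<r. node_fact_val p k (e ! l)) * (\<Prod>l<r. D l) + smult (int p) H'" by blast
      then have "(\<Prod>l<Suc r. monom 1 (node_fact_val p k (e ! l)) * D l + smult (int p) (H l))
        = (monom 1 (\<Sum>l<r. node_fact_val p k (e ! l)) * monom 1 (node_fact_val p k (e ! r))) * (\<Prod>l<Suc r. D l)
          + smult (int p) (H' * (monom 1 (node_fact_val p k (e ! r)) * D r + smult (int p) (H r))
              + monom 1 (\<Sum>l<r. node_fact_val p k (e ! l)) * (\<Prod>l<r. D l) * H r)"
        by (simp add: algebra_simps smult_add_right)
      then show ?case by (auto simp: mult_monom)
    qed
    then obtain H' where "(\<Prod>l<n. \<Sum>h\<le>e ! l. A (e ! l) h * (node_poly p k h - 1) ^ (e' ! l))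
        = monom 1 (V e) * (\<Prod>l<n. D l) + smult (int p) H'" unfolding DH V_def by blast
    then have "M e e' = coeff (\<Prod>l<n. D l) 0 + int p * coeff H' (V e)"
      by (simp add: M_def coeff_monom_mult)
    also have "coeff (\<Prod>l<n. D l) 0 = (\<Prod>l<n. coeff (D l) 0)"
      by (simp add: poly_0_coeff_0[symmetric] poly_prod)
    also have "\<dots> = (if e = e' then \<Prod>l<n. u (e ! l) else 0)"
    proof (cases "e = e'")
      case False
      with len that obtain l where "l < n" "e ! l \<noteq> e' ! l" by (metis nth_equalityI)
      then show ?thesis using False by (auto simp: DH(2) intro!: prod_zero)
    qed (simp add: DH(2))
    finally show ?thesis by (simp add: Cong.cong_def)
  qed
  have "[det_fun ?R (\<lambda>i j. M (es ! i) (es ! j)) =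
      det_fun ?R (\<lambda>i j. if es ! i = es ! j then \<Prod>l<n. u (es ! i ! l) else 0)] (mod int p)"
    by (intro det_fun_cong_mod M) auto
  also have "det_fun ?R (\<lambda>i j. if es ! i = es ! j then \<Prod>l<n. u (es ! i ! l) else 0)
      = (\<Prod>i = 0..<?R. \<Prod>l<n. u (es ! i ! l))"
    using dist by (subst det_fun_diag) (auto simp: nth_eq_iff_index_eq)
  finally have "\<not> int p dvd det_fun ?R (\<lambda>i j. M (es ! i) (es ! j))"
    using u p' by (simp add: cong_dvd_iff prime_dvd_prod_iff)
  moreover have "finite (G (es ! i) \<times> {..V (es ! i)})" for i
    by (auto simp: G_def intro!: finite_PiE)
  ultimately have "\<exists>s. (\<forall>i<?R. s i \<in> G (es ! i) \<times> {..V (es ! i)}) \<and>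
      \<not> int p dvd det_fun ?R (\<lambda>i j. coeff (?m (fst (s i)) (es ! j)) (snd (s i)))"
    by (intro det_fun_select_rows[where C = C and A = "\<lambda>i j. M (es ! i) (es ! j)"] expand)
  then obtain s where s: "\<And>i. i < ?R \<Longrightarrow> s i \<in> G (es ! i) \<times> {..V (es ! i)}"
      "\<not> int p dvd det_fun ?R (\<lambda>i j. coeff (?m (fst (s i)) (es ! j)) (snd (s i)))"
    by blast
  then show ?thesis
    by (intro exI[of _ "\<lambda>i. fst (s i)"] exI[of _ "\<lambda>i. snd (s i)"]) (force simp: V_def)
qed

section \<open>Lifting to roots of unity\<close>

abbreviation int_vecs :: "nat \<Rightarrow> nat \<Rightarrow> (nat \<Rightarrow> int) set" where
  "int_vecs n N \<equiv> {..<n} \<rightarrow>\<^sub>E {0..<int N}"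

definition line_point :: "nat \<Rightarrow> nat \<Rightarrow> (nat \<Rightarrow> int) \<Rightarrow> int \<Rightarrow> (nat \<Rightarrow> int) \<Rightarrow> nat \<Rightarrow> int" where
  "line_point n N a t u = (\<lambda>j\<in>{..<n}. (a j + t * u j) mod int N)"

lemma line_point_in_vecs: "N > 0 \<Longrightarrow> line_point n N a t u \<in> int_vecs n N"
  by (auto simp: line_point_def)

text \<open>Otherwise the remainder of \<open>D\<close> on division by the cyclotomic polynomial
  \<open>\<Phi>\<close> has at least \<open>degree \<Phi>\<close> roots and is zero; then
  \<open>\<Phi>\<close> divides \<open>D\<close> over the integers and
  \<open>poly \<Phi> 1 = p\<close> divides \<open>poly D 1\<close>.\<close>

lemma exists_primitive_root_nonzero:
  fixes D :: "int poly"
  assumes p: "prime p" and "k > 0" and D: "\<not> int p dvd poly D 1"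
  shows "\<exists>\<zeta>::complex. \<zeta> ^ (p ^ k) = 1 \<and> \<zeta> ^ (p ^ (k - 1)) \<noteq> 1 \<and> poly (map_poly of_int D) \<zeta> \<noteq> 0"
proof (rule ccontr)
  assume "\<not> ?thesis"
  then have zero: "poly (map_poly of_int D) \<zeta> = 0" if "\<zeta> ^ (p ^ k) = 1" "\<zeta> ^ (p ^ (k - 1)) \<noteq> 1" for \<zeta> :: complex
    using that by blast
  define q where "q = p ^ (k - 1)"
  have pk: "p ^ k = p * q" using \<open>k > 0\<close> by (simp add: q_def power_eq_if)
  have p1: "p > 1" and q0: "q > 0" using prime_gt_1_nat[OF p] by (auto simp: q_def)
  define \<Phi> :: "int poly" where "\<Phi> = (\<Sum>i<p. monom 1 (i * q))"
  have deg: "degree \<Phi> = (p - 1) * q" and lead: "coeff \<Phi> ((p - 1) * q) = 1"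
  proof -
    have c: "coeff \<Phi> j = (\<Sum>i<p. if i * q = j then 1 else 0)" for j
      by (simp add: \<Phi>_def coeff_sum)
    have "(\<Sum>i<p. if i * q = (p - 1) * q then 1 else 0 :: int) = (\<Sum>i\<in>{p - 1}. 1)"
      using q0 p1 by (intro sum.mono_neutral_cong_right) auto
    then show 1: "coeff \<Phi> ((p - 1) * q) = 1" unfolding c by simp
    have "coeff \<Phi> j = 0" if "j > (p - 1) * q" for j
      unfolding c
    proof (intro sum.neutral ballI)
      fix i assume "i \<in> {..<p}"
      then have "i * q \<le> (p - 1) * q" by (intro mult_right_mono) auto
      with that show "(if i * q = j then 1 else 0) = (0::int)" by auto
    qed
    then show "degree \<Phi> = (p - 1) * q"
      using 1 by (intro antisym degree_le le_degree) auto
  qed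
  \<comment> \<open>As \<open>\<Phi>\<close> is monic, pseudo-division is genuine division over the
    integers.\<close>
  obtain Q R where QR: "pseudo_divmod D \<Phi> = (Q, R)" by fastforce
  have "\<Phi> \<noteq> 0" using lead by auto
  from pseudo_divmod[OF this QR] have eq: "D = \<Phi> * Q + R" and R: "R = 0 \<or> degree R < degree \<Phi>"
    unfolding deg lead by simp_all
  define Z where "Z = {\<zeta>::complex. \<zeta> ^ (p ^ k) = 1} - {\<zeta>. \<zeta> ^ q = 1}"
  have "\<zeta> \<in> {\<zeta>::complex. \<zeta> ^ q = 1} \<Longrightarrow> \<zeta> \<in> {\<zeta>. \<zeta> ^ (p ^ k) = 1}" for \<zeta>
    unfolding pk by (simp add: mult.commute[of p] power_mult)
  then have "card Z = p ^ k - q"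
    unfolding Z_def using q0 p1 finite_roots_unity[of q]
    by (subst card_Diff_subset) (auto simp: card_roots_unity_eq)
  then have cardZ: "card Z = degree \<Phi>" by (simp add: pk deg diff_mult_distrib)
  have "poly (map_poly of_int R) \<zeta> = 0" if "\<zeta> \<in> Z" for \<zeta>
  proof -
    from that have w: "\<zeta> ^ q \<noteq> 1" "(\<zeta> ^ q) ^ p = 1"
      by (auto simp: Z_def pk mult.commute[of p] power_mult)
    have "poly (map_poly of_int \<Phi>) \<zeta> = (\<Sum>i<p. (\<zeta> ^ q) ^ i)"
      by (simp add: \<Phi>_def of_int_poly_hom.hom_sum poly_sum poly_monom power_mult[symmetric] mult.commute)
    also have "\<dots> = 0" using w by (subst geometric_sum) auto
    finally have "poly (map_poly of_int \<Phi>) \<zeta> = 0" .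
    moreover have "poly (map_poly of_int D) \<zeta> = 0" using that by (intro zero) (auto simp: Z_def q_def)
    ultimately show ?thesis unfolding eq by (simp add: hom_distribs)
  qed
  then have sub: "Z \<subseteq> {x. poly (map_poly of_int R) x = 0}" by auto
  have "R = 0"
  proof (rule ccontr)
    assume "R \<noteq> 0"
    then have nz: "map_poly complex_of_int R \<noteq> 0" by simp
    have "card Z \<le> degree (map_poly complex_of_int R)"
      using card_poly_roots_bound[OF nz] card_mono[OF poly_roots_finite[OF nz] sub] by simp
    with R \<open>R \<noteq> 0\<close> cardZ show False by simp
  qed
  moreover have "poly \<Phi> 1 = int p" by (simp add: \<Phi>_def poly_sum poly_monom)
  ultimately show False using D unfolding eq by simp
qed

lemma prod_linear_powers_dvd:
  fixes r :: "'i \<Rightarrow> complex"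
  assumes "finite A" "inj_on r A" "\<And>t. t \<in> A \<Longrightarrow> [:-r t, 1:] ^ m t dvd F"
  shows "(\<Prod>t\<in>A. [:-r t, 1:] ^ m t) dvd F"
  using assms
proof (induction A rule: finite_induct)
  case (insert t A)
  define G where "G = (\<Prod>t\<in>A. [:-r t, 1:] ^ m t)"
  have "G dvd F"
    unfolding G_def by (rule insert.IH) (use insert.prems in \<open>auto simp: inj_on_def\<close>)
  then obtain H where F: "F = G * H" by (rule dvdE)
  have root: "poly G (r t) \<noteq> 0"
    using insert.hyps insert.prems(1) unfolding G_def poly_prod
    by (subst prod_zero_iff) (auto simp: inj_on_def)
  then have "order (r t) G = 0" by (rule order_0I)
  moreover have "[:-r t, 1:] ^ m t dvd G * H" using insert.prems(2)[of t] F by simp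
  moreover have "G \<noteq> 0" using root by auto
  ultimately have "[:-r t, 1:] ^ m t dvd H"
    unfolding order_divides by (cases "H = 0") (simp_all add: order_mult)
  then have "G * [:-r t, 1:] ^ m t dvd F" unfolding F by (rule mult_dvd_mono[OF dvd_refl])
  then show ?case using insert.hyps by (simp add: G_def mult.commute)
qed simp

text \<open>The sums in the hypothesis are the Taylor coefficients at \<open>(1 + b\<^sub>l)\<^sub>l\<close> of the polynomial whose coefficients in the
  powers of \<open>z - 1\<close> are the \<open>c\<^sub>j\<close>.\<close>

lemma power_dvd_along_curve:
  fixes c :: "nat \<Rightarrow> complex" and \<gamma> :: "nat \<Rightarrow> complex poly"
  assumes T: "\<And>\<alpha>. \<alpha> \<in> {..<n} \<rightarrow>\<^sub>E UNIV \<Longrightarrow> (\<Sum>l<n. \<alpha> l) < m \<Longrightarrow>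
      (\<Sum>j<R. (\<Prod>l<n. of_nat (es ! j ! l choose \<alpha> l) * b l ^ (es ! j ! l - \<alpha> l)) * c j) = 0"
    and \<gamma>: "\<And>l. l < n \<Longrightarrow> poly (\<gamma> l) r = b l"
  shows "[:-r, 1:] ^ m dvd (\<Sum>j<R. smult (c j) (\<Prod>l<n. \<gamma> l ^ (es ! j ! l)))"
proof -
  \<comment> \<open>A common bound on all exponents lets every binomial expansion range over one
    index set, so that the sums over \<open>j\<close> and \<open>\<alpha>\<close> can be
    exchanged.\<close>
  define B where "B = (\<Sum>j<R. \<Sum>l<n. es ! j ! l)"
  have B: "es ! j ! l \<le> B" if "j < R" "l < n" for j l
  proof -
    have "es ! j ! l \<le> (\<Sum>l<n. es ! j ! l)" using that by (intro member_le_sum) auto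
    also have "\<dots> \<le> B" unfolding B_def using that by (intro member_le_sum) auto
    finally show ?thesis .
  qed
  define \<delta> where "\<delta> l = \<gamma> l - [:b l:]" for l
  let ?G = "{..<n} \<rightarrow>\<^sub>E {..B}"
  have binom: "\<gamma> l ^ e = (\<Sum>a\<le>B. smult (of_nat (e choose a) * b l ^ (e - a)) (\<delta> l ^ a))" if "e \<le> B" for l e
  proof -
    have "\<gamma> l ^ e = (\<delta> l + [:b l:]) ^ e" by (simp add: \<delta>_def)
    also have "\<dots> = (\<Sum>a\<le>e. of_nat (e choose a) * \<delta> l ^ a * [:b l:] ^ (e - a))"
      by (rule binomial_ring)
    also have "\<dots> = (\<Sum>a\<le>e. smult (of_nat (e choose a) * b l ^ (e - a)) (\<delta> l ^ a))"
      by (intro sum.cong refl) (simp add: of_nat_poly poly_const_pow mult.commute)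
    also have "\<dots> = (\<Sum>a\<le>B. smult (of_nat (e choose a) * b l ^ (e - a)) (\<delta> l ^ a))"
      using that by (intro sum.mono_neutral_left) auto
    finally show ?thesis .
  qed
  have "(\<Prod>l<n. \<gamma> l ^ (es ! j ! l))
      = (\<Sum>\<alpha>\<in>?G. smult (\<Prod>l<n. of_nat (es ! j ! l choose \<alpha> l) * b l ^ (es ! j ! l - \<alpha> l)) (\<Prod>l<n. \<delta> l ^ \<alpha> l))"
    if "j < R" for j
  proof -
    have "(\<Prod>l<n. \<gamma> l ^ (es ! j ! l)) = (\<Prod>l<n. \<Sum>a\<le>B. smult (of_nat (es ! j ! l choose a) * b l ^ (es ! j ! l - a)) (\<delta> l ^ a))"
      using B[OF that] by (intro prod.cong refl binom) auto
    also have "\<dots> = (\<Sum>\<alpha>\<in>?G. \<Prod>l<n. smult (of_nat (es ! j ! l choose \<alpha> l) * b l ^ (es ! j ! l - \<alpha> l)) (\<delta> l ^ \<alpha> l))"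
      by (subst prod_sum_PiE) auto
    finally show ?thesis by (simp only: prod_smult)
  qed
  then have "(\<Sum>j<R. smult (c j) (\<Prod>l<n. \<gamma> l ^ (es ! j ! l)))
      = (\<Sum>j<R. \<Sum>\<alpha>\<in>?G. smult ((\<Prod>l<n. of_nat (es ! j ! l choose \<alpha> l) * b l ^ (es ! j ! l - \<alpha> l)) * c j) (\<Prod>l<n. \<delta> l ^ \<alpha> l))"
    by (simp add: smult_sum2 mult.commute)
  also have "\<dots> = (\<Sum>\<alpha>\<in>?G. smult (\<Sum>j<R. (\<Prod>l<n. of_nat (es ! j ! l choose \<alpha> l) * b l ^ (es ! j ! l - \<alpha> l)) * c j) (\<Prod>l<n. \<delta> l ^ \<alpha> l))"
    by (subst sum.swap) (simp add: smult_sum)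
  also have "[:-r, 1:] ^ m dvd \<dots>"
  proof (rule dvd_sum)
    fix \<alpha> assume \<alpha>: "\<alpha> \<in> ?G"
    show "[:-r, 1:] ^ m dvd smult (\<Sum>j<R. (\<Prod>l<n. of_nat (es ! j ! l choose \<alpha> l) * b l ^ (es ! j ! l - \<alpha> l)) * c j) (\<Prod>l<n. \<delta> l ^ \<alpha> l)"
    proof (cases "(\<Sum>l<n. \<alpha> l) < m")
      case True
      then have "(\<Sum>j<R. (\<Prod>l<n. of_nat (es ! j ! l choose \<alpha> l) * b l ^ (es ! j ! l - \<alpha> l)) * c j) = 0"
        using \<alpha> by (intro T) auto
      then show ?thesis by simp
    next
      case False
      have "[:-r, 1:] dvd \<delta> l" if "l < n" for l
        using \<gamma>[OF that] by (simp add: \<delta>_def poly_eq_0_iff_dvd[symmetric])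
      then have "(\<Prod>l<n. [:-r, 1:] ^ \<alpha> l) dvd (\<Prod>l<n. \<delta> l ^ \<alpha> l)"
        by (intro prod_dvd_prod dvd_power_same) auto
      moreover have "[:-r, 1:] ^ m dvd (\<Prod>l<n. [:-r, 1:] ^ \<alpha> l)"
        using False by (simp add: power_sum[symmetric] le_imp_power_dvd)
      ultimately show ?thesis by (meson dvd_smult dvd_trans)
    qed
  qed
  finally show ?thesis .
qed

section \<open>Counting multi-indices by total degree\<close>

lemma card_sum_list_less:
  assumes "n > 0"
  shows "card {xs :: nat list. length xs = n \<and> sum_list xs < m} = (m + n - 1) choose n"
proof (cases m)
  case (Suc m')
  \<comment> \<open>A slack coordinate turns the inequality into a stars-and-bars equation.\<close>
  have "bij_betw (\<lambda>xs. (m' - sum_list xs) # xs) {xs. length xs = n \<and> sum_list xs < m}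
      {ys. length ys = Suc n \<and> sum_list ys = m'}"
    by (intro bij_betwI[of _ _ _ tl]) (auto simp: Suc length_Suc_conv)
  then have "card {xs. length xs = n \<and> sum_list xs < m} = (m' + Suc n - 1) choose m'"
    by (simp add: bij_betw_same_card card_length_sum_list)
  also have "\<dots> = (m + n - 1) choose n"
    using binomial_symmetric[of n "m' + n"] by (simp add: Suc)
  finally show ?thesis .
next
  case 0
  with assms show ?thesis by simp
qed

lemma bij_betw_multi_indices:
  "bij_betw (\<lambda>\<alpha>. map \<alpha> [0..<n]) {\<alpha> \<in> {..<n} \<rightarrow>\<^sub>E UNIV. (\<Sum>l<n. \<alpha> l) < m}
     {xs :: nat list. length xs = n \<and> sum_list xs < m}"
  by (rule bij_betwI[of _ _ _ "\<lambda>xs. \<lambda>l\<in>{..<n}. xs ! l"])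
     (auto simp: sum_list_sum_nth lessThan_atLeast0 sum_list_distinct_conv_sum_set interv_sum_list_conv_sum_set_nat
        PiE_def intro!: nth_equalityI extensionalityI[of _ "{..<n}"])

lemma card_multi_indices_less:
  assumes "n > 0"
  shows "card {\<alpha> \<in> {..<n} \<rightarrow>\<^sub>E (UNIV :: nat set). (\<Sum>l<n. \<alpha> l) < m} = (m + n - 1) choose n"
  by (subst bij_betw_same_card[OF bij_betw_multi_indices]) (rule card_sum_list_less[OF assms])

lemma finite_sum_list_less: "finite {xs :: nat list. length xs = n \<and> sum_list xs < m}"
proof (rule finite_subset)
  show "{xs :: nat list. length xs = n \<and> sum_list xs < m} \<subseteq> {xs. set xs \<subseteq> {..<m} \<and> length xs = n}"
    by (auto intro: le_less_trans member_le_sum_list)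
qed (simp add: finite_lists_length_eq)

lemma finite_multi_indices_less:
  fixes n :: nat
  shows "finite {\<alpha> \<in> {..<n} \<rightarrow>\<^sub>E (UNIV :: nat set). (\<Sum>l<n. \<alpha> l) < m}"
  by (subst bij_betw_finite[OF bij_betw_multi_indices]) (rule finite_sum_list_less)

lemma prod_list_concat_replicate:
  fixes g :: "'b \<Rightarrow> 'a :: comm_monoid_mult"
  shows "(\<Prod>x\<leftarrow>concat (map (\<lambda>t. replicate (m t) (r t)) [0..<M]). g x) = (\<Prod>t<M. g (r t) ^ m t)"
  by (induction M) (auto simp: mult.commute prod_list_replicate)

lemma length_concat_replicate: "length (concat (map (\<lambda>t. replicate (m t) (r t)) [0..<M])) = (\<Sum>t<M. m t)"
  by (induction M) auto

text \<open>If two powers agreed, Bezout would give \<open>\<zeta>^g = 1\<close> for a proper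
  divisor \<open>g\<close> of \<open>p^k\<close>, and such a divisor divides
  \<open>p^(k - 1)\<close>.\<close>

lemma inj_on_powers_primitive_root:
  fixes \<zeta> :: "'a :: field"
  assumes p: "prime p" and "k > 0" and z: "\<zeta> ^ (p ^ k) = 1" "\<zeta> ^ (p ^ (k - 1)) \<noteq> 1"
  shows "inj_on (\<lambda>t. \<zeta> ^ t) {..<p ^ k}"
proof -
  have nz: "\<zeta> \<noteq> 0" using z(1) prime_gt_0_nat[OF p] by (auto simp: power_0_left)
  have aux: False if "s < t" "t < p ^ k" "\<zeta> ^ s = \<zeta> ^ t" for s t
  proof -
    define d where "d = t - s"
    have d: "0 < d" "d < p ^ k" using that by (auto simp: d_def)
    have "\<zeta> ^ t = \<zeta> ^ s * \<zeta> ^ d" using that(1) unfolding d_def power_add[symmetric] by simp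
    then have zd: "\<zeta> ^ d = 1" using that nz by simp
    define g where "g = gcd d (p ^ k)"
    obtain x y where "d * x = p ^ k * y + g" using d bezout_nat[of d "p ^ k"] by (auto simp: g_def)
    then have "\<zeta> ^ (d * x) = \<zeta> ^ (p ^ k * y) * \<zeta> ^ g" by (simp add: power_add)
    then have zg: "\<zeta> ^ g = 1" by (simp add: power_mult zd z(1))
    have "g dvd p ^ k" by (simp add: g_def)
    then obtain i where i: "g = p ^ i" "i \<le> k" using p by (auto simp: divides_primepow_nat)
    have "g \<le> d" using d by (simp add: g_def)
    then have "i \<noteq> k" using d i by auto
    then have "p ^ (k - 1) = g * p ^ (k - 1 - i)" using i by (simp add: power_add[symmetric])
    then have "\<zeta> ^ (p ^ (k - 1)) = 1" by (simp add: power_mult zg)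
    with z(2) show False by simp
  qed
  show ?thesis
    by (rule inj_onI) (metis aux lessThan_iff linorder_neqE_nat)
qed

lemma map_poly_smult_hom:
  assumes "comm_ring_hom h"
  shows "map_poly h (smult c q) = smult (h c) (map_poly h q)"
proof -
  interpret h: comm_ring_hom h by fact
  show ?thesis by (intro poly_eqI) (simp add: coeff_map_poly h.hom_mult)
qed

text \<open>A dimension count. If the bound failed, the vanishing conditions at all points together
  with the rows outside \<open>S\<close> would be fewer than \<open>R\<close> equations, with a
  nonzero solution \<open>c\<close>. For a row in \<open>S\<close> the resulting polynomial vanishes
  along the line to total order above \<open>\<iota> i\<close>, which annihilates its divided
  difference. So every row annihilates \<open>c\<close>, against the nonzero determinant at a
  suitable \<open>\<zeta>\<close>.\<close>

lemma card_good_rows_le: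
  fixes \<gamma> :: "nat \<Rightarrow> nat \<Rightarrow> int poly" and u :: "nat \<Rightarrow> nat \<Rightarrow> nat" and \<mu> :: "(nat \<Rightarrow> int) \<Rightarrow> nat"
  assumes p: "prime p" and k: "k > 0" and n: "n > 0" and M: "M = p ^ k"
    and \<gamma>: "\<And>i l z. i < R \<Longrightarrow> l < n \<Longrightarrow> (z :: complex) ^ M = 1 \<Longrightarrow>
        poly (map_poly of_int (\<gamma> i l)) (z - 1) = z ^ u i l"
    and det: "\<not> int p dvd det_fun R (\<lambda>i j. coeff (\<Prod>l<n. (\<gamma> i l - 1) ^ (es ! j ! l)) (\<iota> i))"
    and S: "S \<subseteq> {..<R}"
    and good: "\<And>i. i \<in> S \<Longrightarrow> \<exists>a \<in> int_vecs n M. \<iota> i < (\<Sum>t<M. \<mu> (line_point n M a (int t) (\<lambda>l. int (u i l))))"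
  shows "card S \<le> (\<Sum>x\<in>int_vecs n M. (\<mu> x + n - 1) choose n)"
proof (rule ccontr)
  assume contra: "\<not> ?thesis"
  let ?good = "\<lambda>i a. a \<in> int_vecs n M \<and> \<iota> i < (\<Sum>t<M. \<mu> (line_point n M a (int t) (\<lambda>l. int (u i l))))"
  have ex: "\<exists>a. i \<in> S \<longrightarrow> ?good i a" for i
  proof (cases "i \<in> S")
    case True
    from good[OF this] obtain a where "?good i a" by (elim bexE) (simp only: simp_thms)
    then show ?thesis by (intro exI[of _ a] impI)
  qed simp
  have "\<forall>i. \<exists>a. i \<in> S \<longrightarrow> ?good i a" by (rule allI) (rule ex)
  from choice[OF this] obtain a where a': "\<forall>i. i \<in> S \<longrightarrow> ?good i (a i)" by (elim exE)
  then have good_a: "?good i (a i)" if "i \<in> S" for i using that by (elim allE[of _ i] impE)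
  note a = good_a[THEN conjunct1] good_a[THEN conjunct2]
  define x where "x i t = line_point n M (a i) (int t) (\<lambda>l. int (u i l))" for i t
  have M0: "M > 0" using prime_gt_0_nat[OF p] by (simp add: M)
  \<comment> \<open>The variable of these coefficient polynomials stands for \<open>\<zeta>\<close>.
    Each node \<open>\<zeta>^t - 1\<close> is repeated as often as the multiplicity at the
    corresponding point of the line.\<close>
  define rts where "rts i = concat (map (\<lambda>t. replicate (\<mu> (x i t)) (monom 1 t - 1 :: int poly)) [0..<M])" for i
  \<comment> \<open>The outer variable is the parameter of the curve; the translation by
    \<open>a i\<close> appears as the factors \<open>\<zeta>^(a i l)\<close>.\<close>
  define F where "F i j = (\<Prod>l<n. (smult (monom 1 (nat (a i l))) (map_poly (\<lambda>c. [:c:]) (\<gamma> i l)) - 1) ^ (es ! j ! l))" for i j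
  \<comment> \<open>Since \<open>\<iota> i\<close> is below the total multiplicity,
    \<open>Suc (\<iota> i)\<close> nodes are available for \<open>i \<in> S\<close>. The other rows
    are constant in \<open>\<zeta>\<close>, so that at \<open>\<zeta> = 1\<close> all rows agree
    with those of the given determinant.\<close>
  define A :: "nat \<Rightarrow> nat \<Rightarrow> int poly" where
    "A i j = (if i \<in> S then newton_coeff (take (Suc (\<iota> i)) (rts i)) (F i j)
              else [:coeff (\<Prod>l<n. (\<gamma> i l - 1) ^ (es ! j ! l)) (\<iota> i):])" for i j
  have len: "length (rts i) = (\<Sum>t<M. \<mu> (x i t))" for i
    by (simp add: rts_def length_concat_replicate)

  have hom1: "comm_ring_hom (\<lambda>q :: int poly. poly q 1)" by standard auto
  interpret h1m: map_poly_comm_ring_hom "\<lambda>q :: int poly. poly q 1" ..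
  have A1: "poly (A i j) 1 = coeff (\<Prod>l<n. (\<gamma> i l - 1) ^ (es ! j ! l)) (\<iota> i)" for i j
  proof (cases "i \<in> S")
    case True
    have "map (\<lambda>q. poly q 1) (rts i) = replicate (length (rts i)) 0"
      unfolding list_eq_iff_nth_eq by (auto simp: rts_def poly_monom dest!: nth_mem)
    then have r: "map (\<lambda>q. poly q 1) (take (Suc (\<iota> i)) (rts i)) = replicate (Suc (\<iota> i)) 0"
      using a(2)[OF True] by (simp only: take_map[symmetric] take_replicate) (simp add: len x_def min_def)
    have "map_poly (\<lambda>q. poly q 1) (map_poly (\<lambda>c. [:c:]) q) = q" for q :: "int poly"
      by (intro poly_eqI) (simp add: coeff_map_poly)
    then have m: "map_poly (\<lambda>q. poly q 1) (F i j) = (\<Prod>l<n. (\<gamma> i l - 1) ^ (es ! j ! l))"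
      by (simp add: F_def h1m.hom_prod h1m.hom_power h1m.hom_minus map_poly_smult_hom[OF hom1] poly_monom)
    from newton_coeff_hom[OF hom1] show ?thesis
      using True by (simp only: A_def if_True r m newton_coeff_replicate_0)
  qed (simp add: A_def)
  have "poly (det_fun R A) 1 = det_fun R (\<lambda>i j. coeff (\<Prod>l<n. (\<gamma> i l - 1) ^ (es ! j ! l)) (\<iota> i))"
    unfolding det_fun_leibniz by (simp add: poly_sum poly_prod A1)
  with det have "\<not> int p dvd poly (det_fun R A) 1" by simp
  then obtain \<zeta> :: complex where z: "\<zeta> ^ (p ^ k) = 1" "\<zeta> ^ (p ^ (k - 1)) \<noteq> 1"
      and D: "poly (map_poly of_int (det_fun R A)) \<zeta> \<noteq> 0"
    using exists_primitive_root_nonzero[OF p k] by blast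

  define ev where "ev q = poly (map_poly of_int q) \<zeta>" for q :: "int poly"
  have ev_hom: "comm_ring_hom ev" unfolding ev_def by standard (auto simp: hom_distribs)
  interpret ev: comm_ring_hom ev by fact
  interpret evm: map_poly_comm_ring_hom ev ..
  define B where "B i j = ev (A i j)" for i j
  have "det_fun R B = ev (det_fun R A)"
    unfolding det_fun_leibniz B_def by (simp add: ev.hom_sum ev.hom_prod ev.hom_mult)
  with D have detB: "det_fun R B \<noteq> 0" by (simp add: ev_def)

  define b where "b x l = \<zeta> ^ nat (x l) - 1" for x :: "nat \<Rightarrow> int" and l :: nat
  \<comment> \<open>The equations imposed on \<open>c\<close>: one for each point and each
    derivative of order below its multiplicity, and one for each row outside
    \<open>S\<close>.\<close>
  define Q where "Q = (SIGMA x:int_vecs n M. {\<alpha> \<in> {..<n} \<rightarrow>\<^sub>E (UNIV :: nat set). (\<Sum>l<n. \<alpha> l) < \<mu> x}) <+> ({..<R} - S)"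
  define E where "E q j = (case q of Inl (x, \<alpha>) \<Rightarrow>
        (\<Prod>l<n. of_nat (es ! j ! l choose \<alpha> l) * b x l ^ (es ! j ! l - \<alpha> l)) | Inr i \<Rightarrow> B i j)" for q j
  have finX: "finite (int_vecs n M)" by (intro finite_PiE) auto
  have finQ: "finite Q" unfolding Q_def by (intro finite_Plus finite_SigmaI finX finite_multi_indices_less) auto
  have "card Q = (\<Sum>x\<in>int_vecs n M. (\<mu> x + n - 1) choose n) + (R - card S)"
    unfolding Q_def
    using S finX finite_subset[OF S] by (subst card_Plus)
       (auto simp: card_SigmaI finite_multi_indices_less card_multi_indices_less[OF n] card_Diff_subset)
  also have "\<dots> < R" using contra card_mono[OF _ S] by simp
  finally obtain c where c: "\<exists>j<R. c j \<noteq> 0" "\<And>q. q \<in> Q \<Longrightarrow> (\<Sum>j<R. E q j * c j) = 0"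
    using homogeneous_system_solution[OF finQ] by blast

  have "(\<Sum>j<R. B i j * c j) = 0" if i: "i < R" for i
  proof (cases "i \<in> S")
    case False
    with i have "Inr i \<in> Q" by (auto simp: Q_def)
    from c(2)[OF this] show ?thesis by (simp add: E_def)
  next
    case True
    define G where "G l = smult (\<zeta> ^ nat (a i l)) (map_poly of_int (\<gamma> i l)) - 1" for l
    define P where "P = (\<Sum>j<R. smult (c j) (\<Prod>l<n. G l ^ (es ! j ! l)))"
    have "ev [:d:] = of_int d" for d by (cases "d = 0") (simp_all add: ev_def hom_distribs)
    then have "map_poly ev (map_poly (\<lambda>c. [:c:]) q) = map_poly of_int q" for q
      by (intro poly_eqI) (simp add: coeff_map_poly)
    then have m: "map_poly ev (F i j) = (\<Prod>l<n. G l ^ (es ! j ! l))" for j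
      by (simp add: F_def G_def evm.hom_prod evm.hom_power evm.hom_minus map_poly_smult_hom[OF ev_hom])
         (simp add: ev_def map_poly_monom poly_monom)
    have "(\<Sum>j<R. B i j * c j) = (\<Sum>j<R. newton_coeff (map ev (take (Suc (\<iota> i)) (rts i))) (smult (c j) (\<Prod>l<n. G l ^ (es ! j ! l))))"
      using True by (simp add: B_def A_def newton_coeff_hom[OF ev_hom] m newton_coeff_smult mult.commute)
    also have "\<dots> = newton_coeff (map ev (take (Suc (\<iota> i)) (rts i))) P"
      by (simp add: P_def newton_coeff_sum)
    also have "\<dots> = 0"
    proof (rule newton_coeff_eq_0)
      have "ev (monom 1 t - 1) = \<zeta> ^ t - 1" for t
        by (simp add: ev.hom_minus) (simp add: ev_def map_poly_monom poly_monom)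
      then have mr: "map ev (rts i) = concat (map (\<lambda>t. replicate (\<mu> (x i t)) (\<zeta> ^ t - 1)) [0..<M])"
        by (simp add: rts_def map_concat comp_def)
      have "[:-(\<zeta> ^ t - 1), 1:] ^ \<mu> (x i t) dvd P" if t: "t < M" for t
        unfolding P_def
      proof (rule power_dvd_along_curve)
        fix \<alpha> assume \<alpha>: "\<alpha> \<in> {..<n} \<rightarrow>\<^sub>E (UNIV :: nat set)" "(\<Sum>l<n. \<alpha> l) < \<mu> (x i t)"
        have "x i t \<in> int_vecs n M" unfolding x_def using M0 by (rule line_point_in_vecs)
        with \<alpha> have "Inl (x i t, \<alpha>) \<in> Q" by (auto simp: Q_def)
        from c(2)[OF this] show "(\<Sum>j<R. (\<Prod>l<n. of_nat (es ! j ! l choose \<alpha> l) * b (x i t) l ^ (es ! j ! l - \<alpha> l)) * c j) = 0"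
          by (simp add: E_def)
      next
        fix l assume l: "l < n"
        \<comment> \<open>At a root of unity the curve takes monomial values, so at parameter
          \<open>\<zeta>^t - 1\<close> it passes through the image of the point
          \<open>x i t\<close>.\<close>
        have zt: "(\<zeta> ^ t) ^ M = 1" using z(1) by (metis M power_mult mult.commute power_one)
        define y where "y = nat (a i l) + t * u i l"
        have "int y = a i l + int t * int (u i l)" using a(1)[OF True] l by (auto simp: y_def PiE_iff)
        then have "nat (x i t l) = y mod M" using l by (simp add: x_def line_point_def) (metis nat_int zmod_int)
        moreover have "\<zeta> ^ y = \<zeta> ^ (M * (y div M) + y mod M)" by simp
        then have "\<zeta> ^ y = \<zeta> ^ (y mod M)" using z(1) by (simp only: power_add power_mult M) simp
        ultimately show "poly (G l) (\<zeta> ^ t - 1) = b (x i t) l"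
          using \<gamma>[OF i l zt] by (simp add: G_def b_def y_def power_add power_mult)
      qed
      then have "(\<Prod>t<M. [:-(\<zeta> ^ t - 1), 1:] ^ \<mu> (x i t)) dvd P"
        using inj_on_powers_primitive_root[OF p k z]
        by (intro prod_linear_powers_dvd) (auto simp: M inj_on_def)
      then have dvd: "(\<Prod>r\<leftarrow>map ev (rts i). [:-r, 1:]) dvd P"
        unfolding mr prod_list_concat_replicate .
      have "(\<Prod>r\<leftarrow>map ev (rts i). [:-r, 1:]) = (\<Prod>r\<leftarrow>map ev (take (Suc (\<iota> i)) (rts i)). [:-r, 1:])
          * (\<Prod>r\<leftarrow>map ev (drop (Suc (\<iota> i)) (rts i)). [:-r, 1:])"
        by (subst append_take_drop_id[of "Suc (\<iota> i)" "rts i", symmetric])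
           (simp only: map_append prod_list.append)
      with dvd show "(\<Prod>r\<leftarrow>map ev (take (Suc (\<iota> i)) (rts i)). [:-r, 1:]) dvd P"
        by (metis dvd_mult_left)
    qed
    finally show ?thesis .
  qed
  with c(1) det_fun_kernel[OF detB] show False by blast
qed

section \<open>Averaging over linear automorphisms\<close>

definition unimodular_vecs :: "nat \<Rightarrow> nat \<Rightarrow> (nat \<Rightarrow> int) set" where
  "unimodular_vecs n N = {u \<in> int_vecs n N. \<forall>q\<in>prime_factors N. \<exists>j<n. \<not> int q dvd u j}"

lemma unimodular_vecs_prime_power:
  assumes "prime p" "k > 0"
  shows "unimodular_vecs n (p ^ k) = {u \<in> int_vecs n (p ^ k). \<exists>j<n. \<not> int p dvd u j}"
  using assms by (simp add: unimodular_vecs_def prime_factors_power prime_prime_factors)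

lemma finite_int_vecs [simp]: "finite (int_vecs n N)"
  by (intro finite_PiE) auto

lemma finite_unimodular_vecs [simp]: "finite (unimodular_vecs n N)"
  unfolding unimodular_vecs_def by simp

lemma int_vecs_eqI:
  assumes "x \<in> int_vecs n N" "y \<in> int_vecs n N" "\<And>l. l < n \<Longrightarrow> [x l = y l] (mod int N)"
  shows "x = y"
proof (rule PiE_ext[OF assms(1,2)])
  fix l assume "l \<in> {..<n}"
  with assms show "x l = y l" by (auto simp: PiE_iff Cong.cong_def)
qed

text \<open>Compatibility with \<open>a + t u\<close> alone encodes linearity: \<open>a = u\<close>
  and \<open>t = -1\<close> force 0 to be fixed. Extensional maps keep the set finite, so that
  averages over it are finite sums.\<close>

definition lin_auts :: "nat \<Rightarrow> nat \<Rightarrow> ((nat \<Rightarrow> int) \<Rightarrow> nat \<Rightarrow> int) set" where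
  "lin_auts n N = {g \<in> int_vecs n N \<rightarrow>\<^sub>E int_vecs n N. bij_betw g (int_vecs n N) (int_vecs n N) \<and>
     (\<forall>a\<in>int_vecs n N. \<forall>u\<in>int_vecs n N. \<forall>t. g (line_point n N a t u) = line_point n N (g a) t (g u))}"

lemma lin_autsI:
  assumes "g \<in> int_vecs n N \<rightarrow>\<^sub>E int_vecs n N" "bij_betw g (int_vecs n N) (int_vecs n N)"
    and "\<And>a u t. a \<in> int_vecs n N \<Longrightarrow> u \<in> int_vecs n N \<Longrightarrow> g (line_point n N a t u) = line_point n N (g a) t (g u)"
  shows "g \<in> lin_auts n N"
  unfolding lin_auts_def using assms by (intro CollectI conjI ballI allI)

lemma lin_autsD:
  assumes "g \<in> lin_auts n N"
  shows "g \<in> int_vecs n N \<rightarrow>\<^sub>E int_vecs n N" "bij_betw g (int_vecs n N) (int_vecs n N)"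
    and "a \<in> int_vecs n N \<Longrightarrow> g a \<in> int_vecs n N"
    and "a \<in> int_vecs n N \<Longrightarrow> u \<in> int_vecs n N \<Longrightarrow> g (line_point n N a t u) = line_point n N (g a) t (g u)"
proof -
  show g: "g \<in> int_vecs n N \<rightarrow>\<^sub>E int_vecs n N" and "bij_betw g (int_vecs n N) (int_vecs n N)"
    using assms unfolding lin_auts_def mem_Collect_eq by simp_all
  have "\<forall>a\<in>int_vecs n N. \<forall>u\<in>int_vecs n N. \<forall>t. g (line_point n N a t u) = line_point n N (g a) t (g u)"
    using assms unfolding lin_auts_def by (elim CollectE conjE)
  then show "g (line_point n N a t u) = line_point n N (g a) t (g u)"
    if "a \<in> int_vecs n N" "u \<in> int_vecs n N" using that by (simp only: Ball_def)
  show "g a \<in> int_vecs n N" if "a \<in> int_vecs n N" using g(1) that by (rule PiE_mem)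
qed

lemma finite_lin_auts: "finite (lin_auts n N)"
  by (rule finite_subset[of _ "int_vecs n N \<rightarrow>\<^sub>E int_vecs n N"]) (auto intro!: finite_PiE dest: lin_autsD(1) simp del: PiE_iff)

lemma compose_lin_auts:
  assumes "N > 0" "g \<in> lin_auts n N" "h \<in> lin_auts n N"
  shows "compose (int_vecs n N) h g \<in> lin_auts n N"
proof (rule lin_autsI)
  show "bij_betw (compose (int_vecs n N) h g) (int_vecs n N) (int_vecs n N)"
    by (rule bij_betw_compose[OF lin_autsD(2)[OF assms(2)] lin_autsD(2)[OF assms(3)]])
  show "compose (int_vecs n N) h g \<in> int_vecs n N \<rightarrow>\<^sub>E int_vecs n N"
    unfolding compose_def restrict_PiE_iff by (intro ballI lin_autsD(3)[OF assms(2)] lin_autsD(3)[OF assms(3)])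
  show "compose (int_vecs n N) h g (line_point n N a t u)
      = line_point n N (compose (int_vecs n N) h g a) t (compose (int_vecs n N) h g u)"
    if "a \<in> int_vecs n N" "u \<in> int_vecs n N" for a u t
    using that by (simp only: compose_eq line_point_in_vecs[OF assms(1)] lin_autsD(3,4)[OF assms(2)] lin_autsD(4)[OF assms(3)])
qed

text \<open>Unimodularity modulo \<open>p^k\<close> means that the multiple by
  \<open>p^(k - 1)\<close> is nonzero, and this condition is expressible by line points through
  0.\<close>

lemma lin_auts_unimodular:
  assumes p: "prime p" "k > 0" and g: "g \<in> lin_auts n (p ^ k)" and u: "u \<in> unimodular_vecs n (p ^ k)"
  shows "g u \<in> unimodular_vecs n (p ^ k)"
proof -
  let ?M = "p ^ k" and ?V = "int_vecs n (p ^ k)"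
  have M0: "?M > 0" using prime_gt_0_nat[OF p(1)] by simp
  define z where "z = line_point n ?M u (-1) u"
  have z: "z = (\<lambda>l\<in>{..<n}. 0)" by (auto simp: z_def line_point_def)
  have uV: "u \<in> ?V" and gV: "g u \<in> ?V" using u g by (auto simp: unimodular_vecs_def lin_auts_def)
  have zV: "z \<in> ?V" unfolding z_def by (rule line_point_in_vecs[OF M0])
  have "g z = line_point n ?M (g u) (-1) (g u)" unfolding z_def using g uV by (simp add: lin_auts_def)
  then have gz: "g z = z" by (auto simp: z line_point_def)
  have char: "(\<exists>j<n. \<not> int p dvd v j) \<longleftrightarrow> line_point n ?M z (int p ^ (k - 1)) v \<noteq> z" for v
  proof -
    have pk: "int p ^ k = int p ^ (k - 1) * int p" using p(2) by (metis power_minus_mult)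
    have "line_point n ?M z (int p ^ (k - 1)) v = z \<longleftrightarrow> (\<forall>l<n. int p ^ k dvd int p ^ (k - 1) * v l)"
      unfolding z line_point_def by (auto simp: fun_eq_iff mod_eq_0_iff_dvd)
    also have "\<dots> \<longleftrightarrow> (\<forall>l<n. int p dvd v l)" unfolding pk using prime_gt_0_nat[OF p(1)] by simp
    finally show ?thesis by blast
  qed
  have "line_point n ?M z (int p ^ (k - 1)) u \<noteq> z"
    using u char[of u] by (simp add: unimodular_vecs_prime_power[OF p])
  then have "g (line_point n ?M z (int p ^ (k - 1)) u) \<noteq> g z"
    using g zV line_point_in_vecs[OF M0] by (auto simp: lin_auts_def bij_betw_def inj_on_def)
  then have "line_point n ?M z (int p ^ (k - 1)) (g u) \<noteq> z"
    using g zV uV gz by (simp add: lin_auts_def)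
  with char[of "g u"] gV show ?thesis by (simp add: unimodular_vecs_prime_power[OF p])
qed

text \<open>With \<open>c\<close> inverse to \<open>u j\<close>, the map adding
  \<open>c * x j\<close> times \<open>v - u\<close> to \<open>x\<close> sends \<open>u\<close> to
  \<open>v\<close>. It multiplies coordinate \<open>j\<close> by the unit \<open>c * v j\<close>,
  which makes it injective.\<close>

lemma lin_auts_elementary:
  assumes p: "prime p" "k > 0" and u: "u \<in> int_vecs n (p ^ k)" and v: "v \<in> int_vecs n (p ^ k)"
    and j: "j < n" "\<not> int p dvd u j" "\<not> int p dvd v j"
  shows "\<exists>g\<in>lin_auts n (p ^ k). g u = v"
proof -
  let ?M = "p ^ k" and ?V = "int_vecs n (p ^ k)"
  have M0: "?M > 0" using prime_gt_0_nat[OF p(1)] by simp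
  have cop: "coprime x (int ?M)" if "\<not> int p dvd x" for x :: int
    using prime_imp_coprime[of "int p" x] that p by (simp add: coprime_commute)
  obtain c where c: "[u j * c = 1] (mod int ?M)"
    using cong_solve_coprime_int[OF cop[OF j(2)]] by blast
  define g where "g = (\<lambda>x\<in>?V. line_point n ?M x (c * x j) (\<lambda>l. v l - u l))"
  have g: "[g x l = x l + c * x j * (v l - u l)] (mod int ?M)" if "x \<in> ?V" "l < n" for x l
    using that by (simp add: g_def line_point_def Cong.cong_def)
  have gV: "g x \<in> ?V" if "x \<in> ?V" for x using that M0 line_point_in_vecs by (simp add: g_def del: of_nat_power PiE_iff)
  have "inj_on g ?V"
  proof (rule inj_onI)
    fix x y assume xy: "x \<in> ?V" "y \<in> ?V" "g x = g y"
    have eq: "[x l + c * x j * (v l - u l) = y l + c * y j * (v l - u l)] (mod int ?M)" if "l < n" for l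
      using g[OF xy(1) that] g[OF xy(2) that] xy(3) by (metis cong_sym cong_trans)
    have uv: "[z + c * z * (v j - u j) = c * v j * z] (mod int ?M)" for z
    proof -
      have "z + c * z * (v j - u j) = c * v j * z + z * (1 - u j * c)" by (simp add: algebra_simps)
      moreover have "[z * (1 - u j * c) = z * 0] (mod int ?M)"
        using c by (intro cong_mult cong_refl) (simp add: cong_iff_dvd_diff dvd_diff_commute)
      ultimately show ?thesis by (metis add.right_neutral cong_add cong_refl mult_zero_right)
    qed
    have "[c * v j * x j = c * v j * y j] (mod int ?M)"
      using eq[OF j(1)] uv[of "x j"] uv[of "y j"] by (metis cong_sym cong_trans)
    moreover have "coprime (c * v j) (int ?M)"
    proof -
      have "coprime (u j * c) (int ?M)" using c by (metis cong_imp_coprime cong_sym coprime_1_left)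
      then show ?thesis using cop[OF j(3)] p(2) by auto
    qed
    ultimately have "[x j = y j] (mod int ?M)" using cong_mult_lcancel by blast
    then have *: "[c * y j * (v l - u l) = c * x j * (v l - u l)] (mod int ?M)" for l
      by (intro cong_mult cong_refl) (rule cong_sym)
    show "x = y"
    proof (rule int_vecs_eqI[OF xy(1,2)])
      fix l assume "l < n"
      from eq[OF this] *[of l] show "[x l = y l] (mod int ?M)"
        by (metis cong_add_rcancel cong_add_lcancel cong_trans)
    qed
  qed
  moreover have "g ` ?V \<subseteq> ?V" using gV by blast
  ultimately have "bij_betw g ?V ?V"
    unfolding bij_betw_def using endo_inj_surj[OF finite_int_vecs] by blast
  moreover have "g (line_point n ?M a t w) = line_point n ?M (g a) t (g w)"
    if "a \<in> ?V" "w \<in> ?V" for a w t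
  proof (rule int_vecs_eqI)
    fix l assume l: "l < n"
    have 1: "[line_point n ?M a t w l = a l + t * w l] (mod int ?M)" if "l < n" for a w t l
      using that by (simp add: line_point_def Cong.cong_def)
    have "[g (line_point n ?M a t w) l = line_point n ?M a t w l + c * line_point n ?M a t w j * (v l - u l)] (mod int ?M)"
      using l M0 by (intro g line_point_in_vecs) auto
    also have "[line_point n ?M a t w l + c * line_point n ?M a t w j * (v l - u l)
        = (a l + t * w l) + c * (a j + t * w j) * (v l - u l)] (mod int ?M)"
      using l j(1) by (intro cong_add cong_mult cong_refl 1)
    also have "(a l + t * w l) + c * (a j + t * w j) * (v l - u l)
        = (a l + c * a j * (v l - u l)) + t * (w l + c * w j * (v l - u l))"
      by (simp add: algebra_simps)
    also have "[\<dots> = g a l + t * g w l] (mod int ?M)"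
      using that l by (intro cong_add cong_mult cong_refl cong_sym[OF g])
    also have "[g a l + t * g w l = line_point n ?M (g a) t (g w) l] (mod int ?M)"
      using l by (intro cong_sym[OF 1])
    finally show "[g (line_point n ?M a t w) l = line_point n ?M (g a) t (g w) l] (mod int ?M)" .
  qed (intro gV line_point_in_vecs M0 that)+
  moreover have "g \<in> ?V \<rightarrow>\<^sub>E ?V" using gV by (auto simp: g_def simp del: PiE_iff)
  moreover have "g u = v"
  proof (rule int_vecs_eqI[OF gV[OF u] v])
    fix l assume "l < n"
    have "[g u l = u l + c * u j * (v l - u l)] (mod int ?M)" using u \<open>l < n\<close> by (rule g)
    also have "[u l + c * u j * (v l - u l) = u l + 1 * (v l - u l)] (mod int ?M)"
      using c by (intro cong_add cong_mult cong_refl) (simp add: mult.commute)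
    finally show "[g u l = v l] (mod int ?M)" by simp
  qed
  ultimately show ?thesis unfolding lin_auts_def by blast
qed

lemma lin_auts_transitive:
  assumes p: "prime p" "k > 0" and u: "u \<in> unimodular_vecs n (p ^ k)" and v: "v \<in> unimodular_vecs n (p ^ k)"
  shows "\<exists>g\<in>lin_auts n (p ^ k). g u = v"
proof -
  note D = unimodular_vecs_prime_power[OF p]
  have M1: "p ^ k > 1" using prime_gt_1_nat[OF p(1)] p(2) by (intro one_less_power) auto
  from u v obtain i j where i: "i < n" "\<not> int p dvd u i" and j: "j < n" "\<not> int p dvd v j" by (auto simp: D)
  have uV: "u \<in> int_vecs n (p ^ k)" and vV: "v \<in> int_vecs n (p ^ k)" using u v by (auto simp: D)
  \<comment> \<open>A vector that is a unit at both \<open>i\<close> and \<open>j\<close> links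
    \<open>u\<close> to \<open>v\<close> by two elementary maps.\<close>
  define w where "w = (\<lambda>l\<in>{..<n}. if l = i \<or> l = j then 1 else 0 :: int)"
  have w: "w \<in> int_vecs n (p ^ k)" "\<not> int p dvd w i" "\<not> int p dvd w j"
    using M1 i j prime_gt_1_nat[OF p(1)] by (auto simp: w_def simp del: of_nat_power)
  from lin_auts_elementary[OF p uV w(1) i w(2)] obtain g where g: "g \<in> lin_auts n (p ^ k)" "g u = w" by blast
  from lin_auts_elementary[OF p w(1) vV j(1) w(3) j(2)] obtain h where h: "h \<in> lin_auts n (p ^ k)" "h w = v" by blast
  have "compose (int_vecs n (p ^ k)) h g u = v" using uV g h by (simp add: compose_eq)
  moreover have "compose (int_vecs n (p ^ k)) h g \<in> lin_auts n (p ^ k)"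
    using g h prime_gt_0_nat[OF p(1)] by (intro compose_lin_auts) auto
  ultimately show ?thesis by blast
qed

text \<open>Composition with an automorphism taking \<open>v\<close> to \<open>v'\<close> embeds the
  automorphisms with \<open>g u = v\<close> into those with \<open>g u = v'\<close>. By symmetry all
  these fibres have equal size, so \<open>g u\<close> is uniformly distributed.\<close>

lemma sum_lin_auts:
  fixes \<phi> :: "(nat \<Rightarrow> int) \<Rightarrow> nat"
  assumes p: "prime p" "k > 0" and u: "u \<in> unimodular_vecs n (p ^ k)"
  shows "card (unimodular_vecs n (p ^ k)) * (\<Sum>g\<in>lin_auts n (p ^ k). \<phi> (g u))
       = card (lin_auts n (p ^ k)) * (\<Sum>v\<in>unimodular_vecs n (p ^ k). \<phi> v)"
proof -
  let ?D = "unimodular_vecs n (p ^ k)" and ?G = "lin_auts n (p ^ k)" and ?V = "int_vecs n (p ^ k)"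
  have M0: "p ^ k > 0" using prime_gt_0_nat[OF p(1)] by simp
  have uV: "u \<in> ?V" using u by (simp add: unimodular_vecs_def)
  define c where "c v = card {g \<in> ?G. g u = v}" for v
  have le: "c v \<le> c v'" if "v \<in> ?D" "v' \<in> ?D" for v v'
  proof -
    from lin_auts_transitive[OF p that] obtain h where h: "h \<in> ?G" "h v = v'" by (elim bexE)
    have inj: "inj_on (compose ?V h) {g \<in> ?G. g u = v}"
    proof (rule inj_onI)
      fix g g' assume g: "g \<in> {g \<in> ?G. g u = v}" "g' \<in> {g \<in> ?G. g u = v}" and eq: "compose ?V h g = compose ?V h g'"
      then have gG: "g \<in> ?G" "g' \<in> ?G" by simp_all
      show "g = g'"
      proof (rule PiE_ext[of _ ?V "\<lambda>_. ?V"])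
        fix x assume x: "x \<in> ?V"
        have "h (g x) = h (g' x)" using fun_cong[OF eq, of x] by (simp only: compose_eq[OF x])
        then show "g x = g' x"
          by (rule inj_onD[OF bij_betw_imp_inj_on[OF lin_autsD(2)[OF h(1)]] _
                lin_autsD(3)[OF gG(1) x] lin_autsD(3)[OF gG(2) x]])
      qed (fact lin_autsD(1)[OF gG(1)], fact lin_autsD(1)[OF gG(2)])
    qed
    have "compose ?V h ` {g \<in> ?G. g u = v} \<subseteq> {g \<in> ?G. g u = v'}"
    proof
      fix g' assume "g' \<in> compose ?V h ` {g \<in> ?G. g u = v}"
      then obtain g where g: "g \<in> ?G" "g u = v" "g' = compose ?V h g" by blast
      then show "g' \<in> {g \<in> ?G. g u = v'}"
        using compose_lin_auts[OF M0 g(1) h(1)] h(2) compose_eq[OF uV, of h g] by simp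
    qed
    then have "card (compose ?V h ` {g \<in> ?G. g u = v}) \<le> card {g \<in> ?G. g u = v'}"
      using finite_lin_auts by (intro card_mono) auto
    then show ?thesis unfolding c_def card_image[OF inj] .
  qed
  then have c: "c v = c u" if "v \<in> ?D" for v by (intro antisym le that u)
  have split: "(\<Sum>g\<in>?G. \<phi> (g u)) = (\<Sum>v\<in>?D. c v * \<phi> v)" for \<phi> :: "(nat \<Rightarrow> int) \<Rightarrow> nat"
  proof -
    have "(\<Sum>g\<in>?G. \<phi> (g u)) = (\<Sum>v\<in>?D. \<Sum>g\<in>{g \<in> ?G. g u = v}. \<phi> (g u))"
      using lin_auts_unimodular[OF p _ u]
      by (intro sum.group[symmetric] finite_lin_auts finite_unimodular_vecs image_subsetI)
    also have "\<dots> = (\<Sum>v\<in>?D. c v * \<phi> v)" by (intro sum.cong refl) (simp add: c_def)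
    finally show ?thesis .
  qed
  have "card ?G = c u * card ?D" using split[of "\<lambda>_. 1"] c by simp
  moreover have "(\<Sum>g\<in>?G. \<phi> (g u)) = c u * (\<Sum>v\<in>?D. \<phi> v)"
    unfolding split sum_distrib_left using c by (intro sum.cong) auto
  ultimately show ?thesis by simp
qed

text \<open>The parameters below \<open>M * P\<close> run through the line \<open>P\<close> times
  and split into the \<open>P\<close> progressions \<open>c + t * P\<close>. Some progression
  carries at least the mean, which is the weight of the line. The sum counts parameters, so points
  repeated along the multiple direction count repeatedly.\<close>

lemma line_along_multiple:
  fixes \<mu> :: "(nat \<Rightarrow> int) \<Rightarrow> nat"
  assumes "P > 0" "M > 0"
  shows "\<exists>a'\<in>int_vecs n M. (\<Sum>t<M. \<mu> (line_point n M a (int t) u)) \<le>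
           (\<Sum>t<M. \<mu> (line_point n M a' (int t) (\<lambda>l. int P * u l)))"
proof -
  define F where "F s = \<mu> (line_point n M a (int s) u)" for s
  have per: "F (s + M * m) = F s" for s m
  proof -
    have "(a l + int (s + M * m) * u l) mod int M = (a l + int s * u l) mod int M" for l
      using mod_mult_self2[of "a l + int s * u l" "int M" "int m * u l"] by (simp add: algebra_simps)
    then show ?thesis by (simp add: F_def line_point_def)
  qed
  have "(\<Sum>c<P. \<Sum>t<M. F (c + t * P)) = (\<Sum>t<M. \<Sum>c<P. F (c + t * P))" by (rule sum.swap)
  also have "\<dots> = (\<Sum>t<M. sum F {t * P..<t * P + P})"
  proof (rule sum.cong[OF refl])
    fix t
    show "(\<Sum>c<P. F (c + t * P)) = sum F {t * P..<t * P + P}"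
      by (intro sum.reindex_bij_witness[of _ "\<lambda>s. s - t * P" "\<lambda>c. c + t * P"]) auto
  qed
  also have "\<dots> = sum F {..<M * P}" by (rule sum.nat_group)
  also have "\<dots> = (\<Sum>m<P. sum F {m * M..<m * M + M})" by (subst mult.commute, rule sum.nat_group[symmetric])
  also have "\<dots> = (\<Sum>m<P. sum F {..<M})"
  proof (rule sum.cong[OF refl])
    fix m
    have "sum F {m * M..<m * M + M} = (\<Sum>s<M. F (s + M * m))"
      by (intro sum.reindex_bij_witness[of _ "\<lambda>s. s + M * m" "\<lambda>s. s - M * m"]) (auto simp: mult.commute)
    then show "sum F {m * M..<m * M + M} = sum F {..<M}" by (simp add: per)
  qed
  finally have eq: "(\<Sum>c<P. \<Sum>t<M. F (c + t * P)) = (\<Sum>c<P. sum F {..<M})" .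
  have "\<exists>c<P. sum F {..<M} \<le> (\<Sum>t<M. F (c + t * P))"
  proof (rule ccontr)
    assume "\<not> ?thesis"
    then have "(\<Sum>c<P. \<Sum>t<M. F (c + t * P)) < (\<Sum>c<P. sum F {..<M})"
      using assms(1) by - (rule sum_strict_mono, auto simp: not_le)
    with eq show False by simp
  qed
  then obtain c where c: "sum F {..<M} \<le> (\<Sum>t<M. F (c + t * P))" by blast
  define a' where "a' = line_point n M a (int c) u"
  have "line_point n M a' (int t) (\<lambda>l. int P * u l) = line_point n M a (int (c + t * P)) u" for t
    unfolding line_point_def
  proof (rule restrict_ext)
    fix l assume "l \<in> {..<n}"
    then have "(a' l + int t * (int P * u l)) mod int M = (a l + int c * u l + int t * (int P * u l)) mod int M"
      by (simp add: a'_def line_point_def mod_add_left_eq)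
    also have "a l + int c * u l + int t * (int P * u l) = a l + int (c + t * P) * u l"
      by (simp add: algebra_simps)
    finally show "(a' l + int t * (int P * u l)) mod int M = (a l + int (c + t * P) * u l) mod int M" .
  qed
  then have "sum F {..<M} \<le> (\<Sum>t<M. \<mu> (line_point n M a' (int t) (\<lambda>l. int P * u l)))"
    using c by (simp add: F_def)
  moreover have "a' \<in> int_vecs n M" unfolding a'_def using assms(2) by (intro line_point_in_vecs) auto
  ultimately show ?thesis by (auto simp: F_def)
qed

text \<open>The exponent vectors produced by row selection may be divisible by \<open>p\<close>, or
  even vanish modulo \<open>p^k\<close>; their power of \<open>p\<close> is split off here.\<close>

lemma exists_unimodular_multiple:
  fixes u :: "nat \<Rightarrow> nat"
  assumes p: "prime p" "k > 0" and n: "n > 0"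
  shows "\<exists>v\<in>unimodular_vecs n (p ^ k). \<exists>j. \<forall>l<n. [int (u l) = int (p ^ j) * v l] (mod int (p ^ k))"
proof -
  note D = unimodular_vecs_prime_power[OF p]
  have M1: "p ^ k > 1" using prime_gt_1_nat[OF p(1)] p(2) by (intro one_less_power) auto
  show ?thesis
  proof (cases "\<forall>l<n. p ^ k dvd u l")
    case True
    have "(\<lambda>l\<in>{..<n}. 1) \<in> unimodular_vecs n (p ^ k)"
      using M1 n prime_gt_1_nat[OF p(1)] by (auto simp: D simp del: of_nat_power)
    with True show ?thesis
      by (intro bexI[of _ "\<lambda>l\<in>{..<n}. 1"] exI[of _ k]) (auto simp: Cong.cong_def simp flip: of_nat_power zmod_int)
  next
    case False
    define j where "j = (GREATEST j. \<forall>l<n. p ^ j dvd u l)"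
    have bound: "j' \<le> k" if "\<forall>l<n. p ^ j' dvd u l" for j'
      using that False by (meson dvd_trans le_imp_power_dvd nat_le_linear)
    have j: "\<forall>l<n. p ^ j dvd u l"
      unfolding j_def by (rule GreatestI_nat[of _ 0 k]) (use bound in auto)
    have "\<not> (\<forall>l<n. p ^ Suc j dvd u l)"
    proof
      assume "\<forall>l<n. p ^ Suc j dvd u l"
      then have "Suc j \<le> j" unfolding j_def by (rule Greatest_le_nat[of _ _ k]) (use bound in auto)
      then show False by simp
    qed
    then obtain i where i: "i < n" "\<not> p ^ Suc j dvd u i" by blast
    have uj: "u l = p ^ j * (u l div p ^ j)" if "l < n" for l using j that by simp
    have ndvd: "\<not> p dvd u i div p ^ j"
      using i(2) uj[OF i(1)] by (metis mult_dvd_mono dvd_refl power_Suc2)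
    define v where "v = (\<lambda>l\<in>{..<n}. int ((u l div p ^ j) mod p ^ k))"
    have "\<not> int p dvd v i"
      using ndvd i(1) p(2) by (simp add: v_def dvd_mod_iff del: of_nat_mod)
    then have "v \<in> unimodular_vecs n (p ^ k)" using i M1 prime_gt_0_nat[OF p(1)]
      by (auto simp: D v_def simp del: of_nat_mod of_nat_power intro!: mod_less_divisor)
    moreover have "[int (u l) = int (p ^ j) * v l] (mod int (p ^ k))" if "l < n" for l
    proof -
      have "[int (p ^ j) * v l = int (p ^ j) * int (u l div p ^ j)] (mod int (p ^ k))"
        using that by (intro cong_mult cong_refl) (simp add: v_def Cong.cong_def zmod_int)
      also have "int (p ^ j) * int (u l div p ^ j) = int (u l)" using uj[OF that] by (metis of_nat_mult)
      finally show ?thesis by (rule cong_sym)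
    qed
    ultimately show ?thesis by blast
  qed
qed

text \<open>For one automorphism \<open>g\<close>, \<open>card_good_rows_le\<close> with
  multiplicities \<open>s * f (g x)\<close> counts the rows with
  \<open>\<iota> i < s * w (g (v0 i))\<close>. The direction \<open>v0 i\<close> of a row is fixed
  but unknown; summing over \<open>g\<close> distributes \<open>g (v0 i)\<close> evenly, so each row
  is tested against the threshold of every direction.\<close>

lemma sum_multiplicities_ge:
  fixes f w :: "(nat \<Rightarrow> int) \<Rightarrow> nat"
  assumes p: "prime p" "k > 0" and n: "n > 0"
    and es: "distinct es" "\<And>e. e \<in> set es \<Longrightarrow> length e = n"
    and w: "\<And>v. v \<in> unimodular_vecs n (p ^ k) \<Longrightarrow>
        \<exists>a\<in>int_vecs n (p ^ k). w v \<le> (\<Sum>t<p ^ k. f (line_point n (p ^ k) a (int t) v))"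
  shows "(\<Sum>v\<in>unimodular_vecs n (p ^ k). card {e \<in> set es. (\<Sum>l<n. node_fact_val p k (e ! l)) < s * w v})
      \<le> card (unimodular_vecs n (p ^ k)) * (\<Sum>x\<in>int_vecs n (p ^ k). (s * f x + n - 1) choose n)"
proof -
  let ?M = "p ^ k" and ?D = "unimodular_vecs n (p ^ k)" and ?G = "lin_auts n (p ^ k)" and ?V = "int_vecs n (p ^ k)"
  let ?K = "\<Sum>x\<in>?V. (s * f x + n - 1) choose n" and ?R = "length es"
  have M0: "?M > 0" using prime_gt_0_nat[OF p(1)] by simp
  obtain h \<iota> where \<iota>: "\<And>i. i < ?R \<Longrightarrow> \<iota> i \<le> (\<Sum>l<n. node_fact_val p k (es ! i ! l))"
    and det: "\<not> int p dvd det_fun ?R (\<lambda>i j. coeff (\<Prod>l<n. (node_poly p k (h i l) - 1) ^ (es ! j ! l)) (\<iota> i))"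
    using node_poly_basis[OF p(1) es, where k = k] by blast
  have ex: "\<exists>v. v \<in> ?D \<and> (\<exists>j. \<forall>l<n. [int (h i l) = int (p ^ j) * v l] (mod int ?M))" for i
    using exists_unimodular_multiple[OF p n, of "h i"] unfolding Bex_def .
  have "\<forall>i. \<exists>v. v \<in> ?D \<and> (\<exists>j. \<forall>l<n. [int (h i l) = int (p ^ j) * v l] (mod int ?M))" by (rule allI) (rule ex)
  from choice[OF this] obtain v0
    where v0': "\<forall>i. v0 i \<in> ?D \<and> (\<exists>j. \<forall>l<n. [int (h i l) = int (p ^ j) * v0 i l] (mod int ?M))" by (elim exE)
  note v0 = v0'[THEN spec, THEN conjunct1]
  have "\<forall>i. \<exists>j. \<forall>l<n. [int (h i l) = int (p ^ j) * v0 i l] (mod int ?M)"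
    using v0' by (intro allI) (elim allE conjE)
  from choice[OF this] obtain P
    where P': "\<forall>i. \<forall>l<n. [int (h i l) = int (p ^ P i) * v0 i l] (mod int ?M)" by (elim exE)
  have P: "[int (h i l) = int (p ^ P i) * v0 i l] (mod int ?M)" if "l < n" for i l
    using P' that by (elim allE[of _ i] allE[of _ l] impE)
  have card_le: "card {i. i < ?R \<and> \<iota> i < s * w (g (v0 i))} \<le> ?K" if g: "g \<in> ?G" for g
  proof -
    have bij: "bij_betw g ?V ?V" using g by (simp add: lin_auts_def)
    have "card {i. i < ?R \<and> \<iota> i < s * w (g (v0 i))} \<le> (\<Sum>x\<in>?V. (s * f (g x) + n - 1) choose n)"
    proof (rule card_good_rows_le[where \<gamma> = "\<lambda>i l. node_poly p k (h i l)" and u = h and \<iota> = \<iota> and es = es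
          and R = ?R and \<mu> = "\<lambda>x. s * f (g x)", OF p n refl _ det])
      show "poly (map_poly of_int (node_poly p k (h i l))) (z - 1) = z ^ h i l" if "z ^ ?M = 1" for i l and z :: complex
        using that by (rule poly_node_poly_root_of_unity)
      show "{i. i < ?R \<and> \<iota> i < s * w (g (v0 i))} \<subseteq> {..<?R}" by auto
      fix i assume "i \<in> {i. i < ?R \<and> \<iota> i < s * w (g (v0 i))}"
      then have i: "i < ?R" "\<iota> i < s * w (g (v0 i))" by auto
      have v0V: "v0 i \<in> ?V" using v0 by (simp add: unimodular_vecs_def)
      obtain a where a: "a \<in> ?V" "w (g (v0 i)) \<le> (\<Sum>t<?M. f (line_point n ?M a (int t) (g (v0 i))))"
        using w[OF lin_auts_unimodular[OF p g v0[of i]]] by (elim bexE)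
      have "a \<in> g ` ?V" using bij a(1) unfolding bij_betw_def by (elim conjE) (simp only:)
      then obtain a0 where a0: "a0 \<in> ?V" "g a0 = a" by (elim imageE) simp
      have "(\<Sum>t<?M. f (line_point n ?M a (int t) (g (v0 i)))) = (\<Sum>t<?M. (f \<circ> g) (line_point n ?M a0 (int t) (v0 i)))"
        using g a0 v0V by (simp add: lin_auts_def)
      moreover obtain a' where a': "a' \<in> ?V" "(\<Sum>t<?M. (f \<circ> g) (line_point n ?M a0 (int t) (v0 i))) \<le>
           (\<Sum>t<?M. (f \<circ> g) (line_point n ?M a' (int t) (\<lambda>l. int (p ^ P i) * v0 i l)))"
        using line_along_multiple[where P = "p ^ P i" and \<mu> = "f \<circ> g" and n = n and a = a0 and u = "v0 i", OF _ M0, OF zero_less_power[OF prime_gt_0_nat[OF p(1)]]]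
        by (elim bexE)
      moreover have "line_point n ?M a' t (\<lambda>l. int (p ^ P i) * v0 i l) = line_point n ?M a' t (\<lambda>l. int (h i l))" for t
        unfolding line_point_def
      proof (rule restrict_ext)
        fix l assume "l \<in> {..<n}"
        then have "[a' l + t * (int (p ^ P i) * v0 i l) = a' l + t * int (h i l)] (mod int ?M)"
          by (intro cong_add cong_mult cong_refl cong_sym[OF P]) auto
        then show "(a' l + t * (int (p ^ P i) * v0 i l)) mod int ?M = (a' l + t * int (h i l)) mod int ?M"
          by (simp only: Cong.cong_def)
      qed
      ultimately have "w (g (v0 i)) \<le> (\<Sum>t<?M. (f \<circ> g) (line_point n ?M a' (int t) (\<lambda>l. int (h i l))))"
        using a(2) by simp
      then have "s * w (g (v0 i)) \<le> (\<Sum>t<?M. s * f (g (line_point n ?M a' (int t) (\<lambda>l. int (h i l)))))"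
        by (simp add: sum_distrib_left[symmetric])
      with i a'(1) show "\<exists>a\<in>?V. \<iota> i < (\<Sum>t<?M. s * f (g (line_point n ?M a (int t) (\<lambda>l. int (h i l)))))"
        by (meson less_le_trans)
    qed
    also have "\<dots> = ?K" by (rule sum.reindex_bij_betw[OF bij])
    finally show ?thesis .
  qed
  have ind: "card {i. i < r \<and> Q i} = (\<Sum>i<r. if Q i then 1 else 0)" for r and Q :: "nat \<Rightarrow> bool"
    by (simp add: sum.If_cases lessThan_def Int_def)
  have "(\<Sum>v\<in>?D. card {e \<in> set es. (\<Sum>l<n. node_fact_val p k (e ! l)) < s * w v})
      \<le> (\<Sum>v\<in>?D. card {i. i < ?R \<and> \<iota> i < s * w v})"
  proof (intro sum_mono)
    fix v
    have "{e \<in> set es. (\<Sum>l<n. node_fact_val p k (e ! l)) < s * w v} \<subseteq> (!) es ` {i. i < ?R \<and> \<iota> i < s * w v}"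
    proof
      fix e assume e: "e \<in> {e \<in> set es. (\<Sum>l<n. node_fact_val p k (e ! l)) < s * w v}"
      then obtain i where "i < ?R" "e = es ! i" by (auto simp: in_set_conv_nth)
      with e \<iota>[of i] show "e \<in> (!) es ` {i. i < ?R \<and> \<iota> i < s * w v}" by auto
    qed
    then show "card {e \<in> set es. (\<Sum>l<n. node_fact_val p k (e ! l)) < s * w v} \<le> card {i. i < ?R \<and> \<iota> i < s * w v}"
      by (rule surj_card_le[rotated]) auto
  qed
  then have "card ?G * (\<Sum>v\<in>?D. card {e \<in> set es. (\<Sum>l<n. node_fact_val p k (e ! l)) < s * w v})
      \<le> card ?G * (\<Sum>v\<in>?D. \<Sum>i<?R. if \<iota> i < s * w v then 1 else 0)"
    by (simp add: ind)
  also have "\<dots> = (\<Sum>i<?R. card ?G * (\<Sum>v\<in>?D. if \<iota> i < s * w v then 1 else 0))"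
    unfolding sum_distrib_left by (rule sum.swap)
  also have "\<dots> = (\<Sum>i<?R. card ?D * (\<Sum>g\<in>?G. if \<iota> i < s * w (g (v0 i)) then 1 else 0))"
    by (intro sum.cong refl sum_lin_auts[OF p v0, symmetric])
  also have "\<dots> = card ?D * (\<Sum>g\<in>?G. card {i. i < ?R \<and> \<iota> i < s * w (g (v0 i))})"
    unfolding ind sum_distrib_left by (rule sum.swap)
  also have "\<dots> \<le> card ?D * (\<Sum>g\<in>?G. ?K)"
    by (intro mult_left_mono sum_mono card_le) auto
  also have "\<dots> = card ?G * (card ?D * ?K)" by simp
  finally have "card ?G * (\<Sum>v\<in>?D. card {e \<in> set es. (\<Sum>l<n. node_fact_val p k (e ! l)) < s * w v})
      \<le> card ?G * (card ?D * ?K)" .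
  moreover have "card ?G > 0"
    using lin_auts_transitive[OF p v0 v0] finite_lin_auts[of n ?M] card_gt_0_iff[of ?G] by blast
  ultimately show ?thesis by simp
qed

section \<open>Maximal inequalities modulo prime powers\<close>

text \<open>The weights \<open>w\<close> are merely dominated by line sums: in the product argument
  they are weights of fibres, which need not be maximal. The parameter \<open>m\<close> lets the
  constant depend on a bound for the weights.\<close>

definition max_ineq :: "nat \<Rightarrow> nat \<Rightarrow> nat \<Rightarrow> real \<Rightarrow> bool" where
  "max_ineq n N m c \<longleftrightarrow> (\<forall>(f :: (nat \<Rightarrow> int) \<Rightarrow> nat) (w :: (nat \<Rightarrow> int) \<Rightarrow> nat).
     (\<forall>v\<in>unimodular_vecs n N. w v \<le> m \<and>
        (\<exists>a\<in>int_vecs n N. w v \<le> (\<Sum>t<N. f (line_point n N a (int t) v)))) \<longrightarrow>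
     c * (\<Sum>v\<in>unimodular_vecs n N. real (w v) ^ n)
       \<le> real (card (unimodular_vecs n N)) * (\<Sum>x\<in>int_vecs n N. real (f x) ^ n))"

section \<open>Rising factorials and counting exponents\<close>

lemma fact_times_binomial_Suc:
  assumes "q > 0"
  shows "fact (Suc n) * ((q + Suc n - 1) choose Suc n) = (q + n) * (fact n * ((q + n - 1) choose n) :: nat)"
proof -
  obtain q' where q: "q = Suc q'" using assms by (cases q) auto
  show ?thesis using Suc_times_binomial_eq[of "q' + n" n] by (simp add: q algebra_simps)
qed

text \<open>The right-hand side is the rising factorial \<open>q (q + 1) ... (q + n - 1)\<close>,
  which also explains the companion upper bound \<open>(q + n - 1)^n\<close>.\<close>

lemma power_le_fact_binomial:
  assumes "q > 0"
  shows "q ^ n \<le> fact n * ((q + n - 1) choose n)"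
proof (induction n)
  case (Suc n)
  have "q * q ^ n \<le> (q + n) * (fact n * ((q + n - 1) choose n))" using Suc by (intro mult_le_mono) auto
  then show ?case using fact_times_binomial_Suc[OF assms, of n] by simp
qed simp

lemma fact_binomial_le_power:
  assumes "q > 0"
  shows "fact n * ((q + n - 1) choose n) \<le> (q + n - 1) ^ n"
proof (induction n)
  case (Suc n)
  have "(q + n) * (fact n * ((q + n - 1) choose n)) \<le> (q + n) * (q + n - 1) ^ n"
    using Suc by (intro mult_le_mono) auto
  also have "\<dots> \<le> (q + n) * (q + n) ^ n" by (intro mult_le_mono power_mono) auto
  finally show ?case using fact_times_binomial_Suc[OF assms, of n] by simp
qed simp

lemma card_exponents_ge:
  assumes "n > 0" "c > 0"
  shows "(real W / real c) ^ n \<le> fact n * real (card {e :: nat list. length e = n \<and> sum_list e * c < W})"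
proof (cases "W = 0")
  case False
  \<comment> \<open>The quotient \<open>W / c\<close> rounded up, so that \<open>y * c < W\<close>
    is equivalent to \<open>y < q\<close>.\<close>
  define q where "q = (W + c - 1) div c"
  have q0: "q > 0" using False assms by (auto simp: q_def div_greater_zero_iff)
  have "W \<le> q * c"
  proof -
    have "W + c - 1 = q * c + (W + c - 1) mod c" by (simp add: q_def)
    moreover have "(W + c - 1) mod c < c" using assms by simp
    ultimately show ?thesis by linarith
  qed
  then have Wq: "real W / real c \<le> real q" using assms
    by (simp add: pos_divide_le_eq flip: of_nat_mult)
  have eq: "y * c < W \<longleftrightarrow> y < q" for y
  proof -
    have "y < q \<longleftrightarrow> Suc y * c \<le> W + c - 1"
      unfolding q_def using assms by (simp add: less_eq_div_iff_mult_less_eq flip: Suc_le_eq)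
    then show ?thesis using False assms by auto
  qed
  have "(real W / real c) ^ n \<le> real q ^ n" using Wq by (intro power_mono) auto
  also have "\<dots> = real (q ^ n)" by simp
  also have "\<dots> \<le> real (fact n * ((q + n - 1) choose n))"
    using power_le_fact_binomial[OF q0] by (intro of_nat_mono)
  finally show ?thesis unfolding eq by (simp add: card_sum_list_less[OF assms(1)])
qed (use assms in \<open>simp add: zero_power\<close>)

text \<open>Here \<open>c\<close> is the price of one unit of degree: a line of weight
  \<open>w\<close> reaches the exponents of total degree below \<open>s w / c\<close>, at least
  \<open>(s w / c)^n / n!\<close> of them. At a point with \<open>f x \<ge> 1\<close> the conditions
  number at most \<open>((s + n - 1) f x)^n / n!\<close>, and \<open>r\<close> is the resulting
  loss. A larger \<open>s\<close> brings \<open>r\<close> closer to 1 but requires the price on a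
  longer range of exponents.\<close>

lemma prime_power_weight_ineq:
  fixes f w :: "(nat \<Rightarrow> int) \<Rightarrow> nat"
  assumes p: "prime p" "k > 0" and n: "n > 0" and c: "c > 0"
    and cost: "\<And>e. e * c < s * m \<Longrightarrow> node_fact_val p k e \<le> e * c"
    and w: "\<And>v. v \<in> unimodular_vecs n (p ^ k) \<Longrightarrow> w v \<le> m"
      "\<And>v. v \<in> unimodular_vecs n (p ^ k) \<Longrightarrow>
        \<exists>a\<in>int_vecs n (p ^ k). w v \<le> (\<Sum>t<p ^ k. f (line_point n (p ^ k) a (int t) v))"
    and r: "s > 0" "real s + real n - 1 \<le> r * real s"
  shows "(\<Sum>v\<in>unimodular_vecs n (p ^ k). (real (w v) / real c) ^ n)
      \<le> real (card (unimodular_vecs n (p ^ k))) * (\<Sum>x\<in>int_vecs n (p ^ k). (r * real (f x)) ^ n)"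
proof -
  let ?D = "unimodular_vecs n (p ^ k)" and ?V = "int_vecs n (p ^ k)"
  \<comment> \<open>One list of exponents serves all directions: prices are at least 1, so no
    threshold \<open>s * w v\<close> reaches total degree \<open>s * m\<close>.\<close>
  obtain es where es: "set es = {e :: nat list. length e = n \<and> sum_list e < s * m}" "distinct es"
    using finite_distinct_list[OF finite_sum_list_less[of n "s * m"]] by blast
  have card_le: "(real s * (real (w v) / real c)) ^ n
      \<le> fact n * real (card {e \<in> set es. (\<Sum>l<n. node_fact_val p k (e ! l)) < s * w v})" if v: "v \<in> ?D" for v
  proof -
    have "{e :: nat list. length e = n \<and> sum_list e * c < s * w v} \<subseteq>
      {e \<in> set es. (\<Sum>l<n. node_fact_val p k (e ! l)) < s * w v}"
    proof
      fix e :: "nat list" assume "e \<in> {e. length e = n \<and> sum_list e * c < s * w v}"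
      then have e: "length e = n" "sum_list e * c < s * w v" by auto
      have sm: "s * w v \<le> s * m" using w(1)[OF v] by simp
      have se: "sum_list e = (\<Sum>l<n. e ! l)" by (simp add: sum_list_sum_nth e(1) lessThan_atLeast0)
      have "node_fact_val p k (e ! l) \<le> e ! l * c" if "l < n" for l
      proof (rule cost)
        have "e ! l \<le> sum_list e" using that e(1) by (intro member_le_sum_list) auto
        then have "e ! l * c \<le> sum_list e * c" by simp
        with e(2) sm show "e ! l * c < s * m" by linarith
      qed
      then have "(\<Sum>l<n. node_fact_val p k (e ! l)) \<le> (\<Sum>l<n. e ! l * c)" by (intro sum_mono) auto
      also have "\<dots> = sum_list e * c" by (simp add: se sum_distrib_right)
      finally have "(\<Sum>l<n. node_fact_val p k (e ! l)) < s * w v" using e(2) by simp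
      moreover have "sum_list e \<le> sum_list e * c" using c by simp
      then have "sum_list e < s * m" using e(2) sm by linarith
      ultimately show "e \<in> {e \<in> set es. (\<Sum>l<n. node_fact_val p k (e ! l)) < s * w v}"
        using e(1) by (simp add: es)
    qed
    then have "card {e :: nat list. length e = n \<and> sum_list e * c < s * w v} \<le>
      card {e \<in> set es. (\<Sum>l<n. node_fact_val p k (e ! l)) < s * w v}" by (intro card_mono) auto
    then have "fact n * real (card {e :: nat list. length e = n \<and> sum_list e * c < s * w v}) \<le>
      fact n * real (card {e \<in> set es. (\<Sum>l<n. node_fact_val p k (e ! l)) < s * w v})"
      by (intro mult_left_mono of_nat_mono) auto
    moreover have "(real s * (real (w v) / real c)) ^ n = (real (s * w v) / real c) ^ n" by simp
    ultimately show ?thesis using card_exponents_ge[OF n c, of "s * w v"] by linarith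
  qed
  have point: "fact n * real ((s * f x + n - 1) choose n) \<le> (real s * (r * real (f x))) ^ n" for x
  proof (cases "f x = 0")
    case True
    then show ?thesis using n by (simp add: binomial_eq_0)
  next
    case False
    then have q: "s * f x > 0" using r by simp
    have "real (fact n * ((s * f x + n - 1) choose n)) \<le> real ((s * f x + n - 1) ^ n)"
      using fact_binomial_le_power[OF q] by (intro of_nat_mono)
    also have "\<dots> = (real (s * f x + n - 1)) ^ n" by simp
    also have "\<dots> \<le> (real s * (r * real (f x))) ^ n"
    proof (intro power_mono)
      have "real (s * f x + n - 1) = real s * real (f x) + (real n - 1)" using n by simp
      also have "\<dots> \<le> real s * real (f x) + (real n - 1) * real (f x)"
        using n False mult_left_mono[of 1 "real (f x)" "real n - 1"] by simp
      also have "\<dots> = (real s + real n - 1) * real (f x)" by (simp add: algebra_simps)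
      also have "\<dots> \<le> (r * real s) * real (f x)" by (intro mult_right_mono r) auto
      finally show "real (s * f x + n - 1) \<le> real s * (r * real (f x))" by (simp add: mult_ac)
    qed auto
    finally show ?thesis by simp
  qed
  have "real s ^ n * (\<Sum>v\<in>?D. (real (w v) / real c) ^ n) = (\<Sum>v\<in>?D. (real s * (real (w v) / real c)) ^ n)"
    by (simp only: sum_distrib_left power_mult_distrib)
  also have "\<dots> \<le> (\<Sum>v\<in>?D. fact n * real (card {e \<in> set es. (\<Sum>l<n. node_fact_val p k (e ! l)) < s * w v}))"
    by (intro sum_mono card_le)
  also have "\<dots> = fact n * real (\<Sum>v\<in>?D. card {e \<in> set es. (\<Sum>l<n. node_fact_val p k (e ! l)) < s * w v})"
    by (simp add: sum_distrib_left)
  also have "\<dots> \<le> fact n * real (card ?D * (\<Sum>x\<in>?V. (s * f x + n - 1) choose n))"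
    using sum_multiplicities_ge[OF p n es(2) _ w(2), where s = s] es(1)
    by (intro mult_left_mono of_nat_mono) auto
  also have "\<dots> = real (card ?D) * (\<Sum>x\<in>?V. fact n * real ((s * f x + n - 1) choose n))"
    by (simp add: sum_distrib_left mult_ac)
  also have "\<dots> \<le> real (card ?D) * (\<Sum>x\<in>?V. (real s * (r * real (f x))) ^ n)"
    by (intro mult_left_mono sum_mono point) auto
  also have "\<dots> = real s ^ n * (real (card ?D) * (\<Sum>x\<in>?V. (r * real (f x)) ^ n))"
    by (simp add: sum_distrib_left power_mult_distrib mult_ac)
  finally show ?thesis using r(1) by simp
qed

lemma max_ineqI_prime_power:
  assumes p: "prime p" "k > 0" and n: "n > 0" and c: "c > 0"
    and cost: "\<And>e. e * c < s * m \<Longrightarrow> node_fact_val p k e \<le> e * c"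
    and r: "s > 0" "real s + real n - 1 \<le> r * real s" "r > 0"
    and C: "0 \<le> C" "C * r * real c \<le> 1"
  shows "max_ineq n (p ^ k) m (C ^ n)"
  unfolding max_ineq_def
proof (intro allI impI)
  let ?D = "unimodular_vecs n (p ^ k)" and ?V = "int_vecs n (p ^ k)"
  fix f w :: "(nat \<Rightarrow> int) \<Rightarrow> nat"
  assume w: "\<forall>v\<in>?D. w v \<le> m \<and> (\<exists>a\<in>?V. w v \<le> (\<Sum>t<p ^ k. f (line_point n (p ^ k) a (int t) v)))"
  have "C ^ n * (\<Sum>v\<in>?D. real (w v) ^ n) = (\<Sum>v\<in>?D. (C * real (w v)) ^ n)"
    by (simp add: sum_distrib_left power_mult_distrib)
  also have "\<dots> \<le> (\<Sum>v\<in>?D. (1 / r * (real (w v) / real c)) ^ n)"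
  proof (intro sum_mono power_mono)
    fix v
    have "C \<le> 1 / (r * real c)" using C r c by (simp add: field_simps)
    from mult_right_mono[OF this, of "real (w v)"]
    show "C * real (w v) \<le> 1 / r * (real (w v) / real c)" by simp
  qed (use C in auto)
  also have "\<dots> = (1 / r) ^ n * (\<Sum>v\<in>?D. (real (w v) / real c) ^ n)"
    by (simp only: sum_distrib_left power_mult_distrib)
  also have "\<dots> \<le> (1 / r) ^ n * (real (card ?D) * (\<Sum>x\<in>?V. (r * real (f x)) ^ n))"
    using r w by (intro mult_left_mono prime_power_weight_ineq[OF p n c cost _ _ r(1,2)]) auto
  also have "\<dots> = real (card ?D) * (\<Sum>x\<in>?V. (1 / r * (r * real (f x))) ^ n)"
    by (simp only: sum_distrib_left power_mult_distrib mult_ac)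
  also have "\<dots> = real (card ?D) * (\<Sum>x\<in>?V. real (f x) ^ n)" using r(3) by simp
  finally show "C ^ n * (\<Sum>v\<in>?D. real (w v) ^ n) \<le> real (card ?D) * (\<Sum>x\<in>?V. real (f x) ^ n)" .
qed

text \<open>With \<open>s = n\<close> the loss is below 2. The exponents within reach are below
  \<open>n * m \<le> p^T\<close>, so \<open>node_fact_val_le_log\<close> gives the price
  \<open>T\<close>, positive because \<open>m * n > 1\<close>.\<close>

lemma max_ineq_bounded_weight:
  assumes p: "prime p" "k > 0" and n: "n > 0" and mn: "m > 0" "m * n > 1"
  shows "max_ineq n (p ^ k) m
    ((1 / (2 * real_of_int \<lceil>log (real p) (real m) + log (real p) (real n)\<rceil>)) ^ n)"
proof -
  have p1: "real p > 1" using prime_gt_1_nat[OF p(1)] by simp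
  have lg: "log (real p) (real m) + log (real p) (real n) = log (real p) (real (m * n))"
    using mn n by (simp add: log_mult_pos)
  define T where "T = nat \<lceil>log (real p) (real (m * n))\<rceil>"
  have "log (real p) (real (m * n)) > 0" using mn n p1 by (subst zero_less_log_cancel_iff) (auto simp flip: of_nat_mult)
  then have T0: "T > 0" and T: "real T = real_of_int \<lceil>log (real p) (real (m * n))\<rceil>"
    by (simp_all add: T_def)
  have "real (m * n) = real p powr log (real p) (real (m * n))"
    using p1 mn n by (simp flip: of_nat_mult)
  also have "\<dots> \<le> real p powr real T" using p1 unfolding T by (intro powr_mono) auto
  also have "\<dots> = real (p ^ T)" using p1 by (simp add: powr_realpow)
  finally have le: "m * n \<le> p ^ T" by (simp only: of_nat_le_iff)
  have "max_ineq n (p ^ k) m ((1 / (2 * real T)) ^ n)"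
  proof (rule max_ineqI_prime_power[where s = n and c = T and r = 2, OF p n T0])
    fix e assume lt: "e * T < n * m"
    have "e \<le> e * T" using T0 by simp
    also note lt
    also have "n * m \<le> p ^ T" using le by (simp only: mult.commute)
    finally have "e < p ^ T" .
    then show "node_fact_val p k e \<le> e * T" by (rule node_fact_val_le_log[OF p(1)])
  qed (use n T0 in auto)
  then show ?thesis unfolding lg T .
qed

text \<open>A unimodular vector has trivial annihilator: a prime of \<open>N / gcd N d\<close> would
  divide all its coordinates. This yields both the distinctness of the points of a line and the
  freeness of the action of the units.\<close>

lemma dvd_if_dvd_unimodular_multiple:
  assumes u: "u \<in> unimodular_vecs n N" and N: "N > 0" and dvd: "\<And>l. l < n \<Longrightarrow> int N dvd d * u l"
  shows "int N dvd d"
proof (rule ccontr)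
  assume ndvd: "\<not> int N dvd d"
  define g where "g = gcd (int N) d"
  have g0: "g > 0" using N by (simp add: g_def)
  obtain N' d' where N': "int N = N' * g" "d = d' * g" "coprime N' d'"
    using gcd_coprime_exists[of "int N" d] g0 unfolding g_def by auto
  have "N' > 0" using N' N g0 by (metis of_nat_0_less_iff zero_less_mult_pos2)
  moreover have "N' \<noteq> 1" using ndvd N' by auto
  ultimately obtain q where q: "prime q" "q dvd N'"
    using prime_divisor_exists[of N'] by (auto simp: zdvd1_eq)
  have q0: "q > 0" using q(1) by (rule prime_gt_0_int)
  have "int (nat q) dvd int N" using q N' q0 by simp
  then have "nat q dvd N" by (simp only: of_nat_dvd_iff)
  then have "nat q \<in> prime_factors N" using q(1) N q0 by (simp add: prime_factors_dvd)
  with u obtain j where j: "j < n" "\<not> q dvd u j" using q0 by (auto simp: unimodular_vecs_def)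
  have "N' * g dvd (d' * u j) * g" using dvd[OF j(1)] N' by (simp add: mult_ac)
  then have "N' dvd d' * u j" using g0 by simp
  then have "N' dvd u j" using N'(3) by (simp add: coprime_dvd_mult_right_iff)
  with q(2) j(2) show False by (meson dvd_trans)
qed

lemma inj_on_line_point:
  assumes u: "u \<in> unimodular_vecs n N" and N: "N > 0"
  shows "inj_on (\<lambda>t. line_point n N a (int t) u) {..<N}"
proof (rule inj_onI)
  fix s t assume st: "s \<in> {..<N}" "t \<in> {..<N}" and eq: "line_point n N a (int s) u = line_point n N a (int t) u"
  have "int N dvd int s - int t"
  proof (rule dvd_if_dvd_unimodular_multiple[OF u N])
    fix l assume "l < n"
    with fun_cong[OF eq, of l] have "(a l + int s * u l) mod int N = (a l + int t * u l) mod int N"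
      by (simp add: line_point_def)
    then have "int N dvd (a l + int s * u l) - (a l + int t * u l)" by (simp only: mod_eq_dvd_iff)
    then show "int N dvd (int s - int t) * u l" by (simp add: algebra_simps)
  qed
  then have "int s mod int N = int t mod int N" by (simp only: mod_eq_dvd_iff)
  with st show "s = t" by simp
qed

text \<open>A line in a unimodular direction has distinct points, so its weight is at most the total
  mass, which for exponent 1 is already the right-hand side.\<close>

lemma max_ineq_one_dim:
  assumes "N > 0" and "0 \<le> c" "c \<le> 1"
  shows "max_ineq 1 N m c"
  unfolding max_ineq_def
proof (intro allI impI)
  let ?D = "unimodular_vecs 1 N" and ?V = "int_vecs 1 N"
  fix f w :: "(nat \<Rightarrow> int) \<Rightarrow> nat"
  assume w: "\<forall>v\<in>?D. w v \<le> m \<and> (\<exists>a\<in>?V. w v \<le> (\<Sum>t<N. f (line_point 1 N a (int t) v)))"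
  have "w v \<le> (\<Sum>x\<in>?V. f x)" if v: "v \<in> ?D" for v
  proof -
    obtain a where "w v \<le> (\<Sum>t<N. f (line_point 1 N a (int t) v))"
      using bspec[OF w v] by (elim conjE bexE)
    also have "\<dots> = (\<Sum>x\<in>(\<lambda>t. line_point 1 N a (int t) v) ` {..<N}. f x)"
      by (simp only: sum.reindex[OF inj_on_line_point[OF v assms(1)]] comp_def)
    also have "\<dots> \<le> (\<Sum>x\<in>?V. f x)"
      by (intro sum_mono2 finite_int_vecs image_subsetI line_point_in_vecs[OF assms(1)]) simp
    finally show ?thesis .
  qed
  then have "(\<Sum>v\<in>?D. w v) \<le> card ?D * (\<Sum>x\<in>?V. f x)"
    using sum_bounded_above[of ?D w "\<Sum>x\<in>?V. f x"] by simp
  then have "real (\<Sum>v\<in>?D. w v) \<le> real (card ?D * (\<Sum>x\<in>?V. f x))" by (rule of_nat_mono)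
  then have "(\<Sum>v\<in>?D. real (w v)) \<le> real (card ?D) * (\<Sum>x\<in>?V. real (f x))" by simp
  moreover have "c * (\<Sum>v\<in>?D. real (w v)) \<le> 1 * (\<Sum>v\<in>?D. real (w v))"
    using assms by (intro mult_right_mono sum_nonneg) auto
  ultimately show "c * (\<Sum>v\<in>?D. real (w v) ^ 1) \<le> real (card ?D) * (\<Sum>x\<in>?V. real (f x) ^ 1)"
    by simp
qed

text \<open>The price is \<open>k + 2\<close>. Taking \<open>s = 3 * n\<close> lowers the loss to
  \<open>4 / 3\<close>, and \<open>4 / 3 * (k + 2) \<le> 2 * (k + L)\<close> holds for
  \<open>k \<ge> 1\<close> and \<open>L \<ge> 1\<close>, with equality at \<open>k = L = 1\<close>.
  In dimension one the rounded logarithm \<open>L\<close> is 0, and \<open>max_ineq_one_dim\<close>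
  takes over.\<close>

lemma max_ineq_unbounded_weight:
  assumes p: "prime p" "k > 0" and n: "n > 0"
  shows "max_ineq n (p ^ k) m ((1 / (2 * (real k + real_of_int \<lceil>log (real p) (real n)\<rceil>))) ^ n)"
proof (cases "n = 1")
  case True
  have "1 / (2 * real k) \<le> 1" using p(2) by simp
  then show ?thesis
    using max_ineq_one_dim[of "p ^ k" "1 / (2 * real k)" m] prime_gt_0_nat[OF p(1)] unfolding True by simp
next
  case False
  let ?L = "\<lceil>log (real p) (real n)\<rceil>"
  have p1: "real p > 1" using prime_gt_1_nat[OF p(1)] by simp
  have "log (real p) (real n) > 0" using False n p1 by (subst zero_less_log_cancel_iff) auto
  then have "?L \<ge> 1" by linarith
  then have L: "real_of_int ?L \<ge> 1" by simp
  have k1: "real k \<ge> 1" using p(2) by simp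
  show ?thesis
  proof (rule max_ineqI_prime_power[where s = "3 * n" and c = "k + 2" and r = "4 / 3", OF p n])
    show "node_fact_val p k e \<le> e * (k + 2)" for e by (rule node_fact_val_le[OF p(1)])
    have "1 / (2 * (x + y)) * (4 / 3) * (x + 2) \<le> 1" if "x \<ge> 1" "y \<ge> 1" for x y :: real
      using that by (simp add: divide_simps)
    from this[OF k1 L] show "1 / (2 * (real k + real_of_int ?L)) * (4 / 3) * real (k + 2) \<le> 1"
      by (simp only: of_nat_add of_nat_numeral)
  qed (use n L in auto)
qed

section \<open>Products of coprime moduli\<close>

lemma reduce_vec_in [intro]: "M > 0 \<Longrightarrow> reduce_vec n M x \<in> int_vecs n M"
  by (auto simp: reduce_vec_def)

lemma mod_vecs_eq: "mod_vecs n N = int_vecs n N"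
proof -
  have "{0..int N - 1} = {0..<int N}" by auto
  then show ?thesis by (simp add: mod_vecs_def residue_ring_def)
qed

lemma card_int_vecs: "card (int_vecs n N) = N ^ n"
  by (simp add: card_PiE)

lemma inj_on_imp_bij_betw_card:
  assumes "inj_on g A" "g ` A \<subseteq> B" "finite B" "card B \<le> card A"
  shows "bij_betw g A B"
  unfolding bij_betw_def
  using assms card_image[OF assms(1)] card_seteq[OF assms(3,2)] by simp

context
  fixes M N1 :: nat
  assumes cop: "coprime M N1" and pos: "M > 0" "N1 > 0"
begin

lemma mod_product_eqI: "x mod int M = y mod int M \<Longrightarrow> x mod int N1 = y mod int N1 \<Longrightarrow> x mod int (M * N1) = y mod int (M * N1)"
  using cop coprime_cong_mult[of x y "int M" "int N1"] unfolding Cong.cong_def by simp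

lemma crt_bij:
  "bij_betw (\<lambda>y. (reduce_vec n M y, reduce_vec n N1 y)) (int_vecs n (M * N1)) (int_vecs n M \<times> int_vecs n N1)"
proof (rule inj_on_imp_bij_betw_card)
  show "inj_on (\<lambda>y. (reduce_vec n M y, reduce_vec n N1 y)) (int_vecs n (M * N1))"
  proof (rule inj_onI)
    fix x y assume xy: "x \<in> int_vecs n (M * N1)" "y \<in> int_vecs n (M * N1)"
      and eq: "(reduce_vec n M x, reduce_vec n N1 x) = (reduce_vec n M y, reduce_vec n N1 y)"
    show "x = y"
    proof (rule int_vecs_eqI[OF xy])
      fix l assume l: "l < n"
      from eq have "reduce_vec n M x l = reduce_vec n M y l" "reduce_vec n N1 x l = reduce_vec n N1 y l" by simp_all
      with l have "x l mod int M = y l mod int M" "x l mod int N1 = y l mod int N1" by (simp_all add: reduce_vec_def)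
      then show "[x l = y l] (mod int (M * N1))" unfolding Cong.cong_def by (rule mod_product_eqI)
    qed
  qed
  show "(\<lambda>y. (reduce_vec n M y, reduce_vec n N1 y)) ` int_vecs n (M * N1) \<subseteq> int_vecs n M \<times> int_vecs n N1"
    by (intro image_subsetI SigmaI reduce_vec_in pos)
qed (simp_all only: card_int_vecs card_cartesian_product power_mult_distrib finite_cartesian_product
       finite_int_vecs order_refl)

lemma crt_vec_inverse:
  assumes "x \<in> int_vecs n M" "z \<in> int_vecs n N1"
  shows "crt_vec n M N1 (x, z) \<in> int_vecs n (M * N1)" "reduce_vec n M (crt_vec n M N1 (x, z)) = x"
    "reduce_vec n N1 (crt_vec n M N1 (x, z)) = z"
proof -
  have mem: "(x, z) \<in> (\<lambda>y. (reduce_vec n M y, reduce_vec n N1 y)) ` int_vecs n (M * N1)"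
    using crt_bij[of n] assms by (simp add: bij_betw_def)
  show "crt_vec n M N1 (x, z) \<in> int_vecs n (M * N1)"
    unfolding crt_vec_def mod_vecs_eq by (rule inv_into_into[OF mem])
  from f_inv_into_f[OF mem] show "reduce_vec n M (crt_vec n M N1 (x, z)) = x"
    "reduce_vec n N1 (crt_vec n M N1 (x, z)) = z"
    unfolding crt_vec_def mod_vecs_eq by simp_all
qed

lemma crt_vec_reduce:
  assumes "y \<in> int_vecs n (M * N1)"
  shows "crt_vec n M N1 (reduce_vec n M y, reduce_vec n N1 y) = y"
  unfolding crt_vec_def mod_vecs_eq
  using inv_into_f_f[OF bij_betw_imp_inj_on[OF crt_bij] assms] by simp

lemma bij_betw_crt_vec: "bij_betw (crt_vec n M N1) (int_vecs n M \<times> int_vecs n N1) (int_vecs n (M * N1))"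
  unfolding crt_vec_def mod_vecs_eq by (rule bij_betw_inv_into[OF crt_bij])

lemma unimodular_vecs_mult_iff:
  assumes "v \<in> int_vecs n (M * N1)"
  shows "v \<in> unimodular_vecs n (M * N1) \<longleftrightarrow>
     reduce_vec n M v \<in> unimodular_vecs n M \<and> reduce_vec n N1 v \<in> unimodular_vecs n N1"
proof -
  have red: "int q dvd reduce_vec n K v l \<longleftrightarrow> int q dvd v l" if "q \<in> prime_factors K" "l < n" for q K l
    using that by (auto simp: reduce_vec_def dvd_mod_iff in_prime_factors_iff)
  have "prime_factors (M * N1) = prime_factors M \<union> prime_factors N1"
    using pos by (simp add: prime_factorization_mult)
  then show ?thesis
    using assms reduce_vec_in[OF pos(1)] reduce_vec_in[OF pos(2)] red
    unfolding unimodular_vecs_def by (simp add: ball_Un cong: conj_cong)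
qed

lemma bij_betw_crt_unimodular:
  "bij_betw (crt_vec n M N1) (unimodular_vecs n M \<times> unimodular_vecs n N1) (unimodular_vecs n (M * N1))"
proof -
  let ?A = "unimodular_vecs n M \<times> unimodular_vecs n N1"
  have sub: "?A \<subseteq> int_vecs n M \<times> int_vecs n N1" by (auto simp: unimodular_vecs_def simp del: PiE_iff)
  have "crt_vec n M N1 ` ?A = unimodular_vecs n (M * N1)"
  proof (intro equalityI subsetI)
    fix v assume "v \<in> crt_vec n M N1 ` ?A"
    then obtain x z where xz: "x \<in> unimodular_vecs n M" "z \<in> unimodular_vecs n N1" "v = crt_vec n M N1 (x, z)" by blast
    then have "x \<in> int_vecs n M" "z \<in> int_vecs n N1" by (simp_all add: unimodular_vecs_def)
    from crt_vec_inverse[OF this] show "v \<in> unimodular_vecs n (M * N1)"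
      using unimodular_vecs_mult_iff xz by simp
  next
    fix v assume v: "v \<in> unimodular_vecs n (M * N1)"
    then have vV: "v \<in> int_vecs n (M * N1)" by (simp add: unimodular_vecs_def)
    have "(reduce_vec n M v, reduce_vec n N1 v) \<in> ?A" using unimodular_vecs_mult_iff[OF vV] v by simp
    from imageI[OF this, of "crt_vec n M N1"] show "v \<in> crt_vec n M N1 ` ?A" by (simp only: crt_vec_reduce[OF vV])
  qed
  then show ?thesis using bij_betw_imp_inj_on[OF bij_betw_crt_vec[of n]] sub
    by (auto simp: bij_betw_def intro: inj_on_subset)
qed

lemma reduce_line_point:
  assumes "K dvd N"
  shows "reduce_vec n K (line_point n N a t v) = line_point n K (reduce_vec n K a) (t mod int K) (reduce_vec n K v)"
proof -
  have "int K dvd int N" using assms by simp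
  then have "(x mod int N) mod int K = x mod int K" for x by (rule mod_mod_cancel)
  moreover have "(x mod int K + t mod int K * (y mod int K)) mod int K = (x + t * y) mod int K" for x y
    by (metis mod_add_left_eq mod_add_right_eq mod_mult_eq)
  ultimately show ?thesis by (auto simp: reduce_vec_def line_point_def intro!: restrict_ext)
qed

text \<open>The parameter of a line splits into independent residues, so the sum over a line becomes
  a double sum over the product of its two factors.\<close>

lemma sum_crt:
  fixes F :: "nat \<Rightarrow> nat \<Rightarrow> nat"
  shows "(\<Sum>t<M * N1. F (t mod M) (t mod N1)) = (\<Sum>r<N1. \<Sum>s<M. F s r)"
proof -
  have "bij_betw (\<lambda>t. (t mod N1, t mod M)) {..<M * N1} ({..<N1} \<times> {..<M})"
  proof (rule inj_on_imp_bij_betw_card)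
    show "inj_on (\<lambda>t. (t mod N1, t mod M)) {..<M * N1}"
    proof (rule inj_onI)
      fix s t assume st: "s \<in> {..<M * N1}" "t \<in> {..<M * N1}" "(s mod N1, s mod M) = (t mod N1, t mod M)"
      then have "int s mod int (M * N1) = int t mod int (M * N1)"
        by (intro mod_product_eqI) (simp_all flip: zmod_int)
      then have "s mod (M * N1) = t mod (M * N1)" by (simp only: zmod_int[symmetric] of_nat_eq_iff)
      with st(1,2) show "s = t" by simp
    qed
  qed (use pos in \<open>auto simp: card_cartesian_product\<close>)
  from sum.reindex_bij_betw[OF this, of "\<lambda>(r, s). F s r"] show ?thesis
    by (simp add: sum.cartesian_product)
qed

lemma line_point_crt:
  assumes "a \<in> int_vecs n (M * N1)"
  shows "line_point n (M * N1) a (int t) v = crt_vec n M N1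
    (line_point n M (reduce_vec n M a) (int (t mod M)) (reduce_vec n M v),
     line_point n N1 (reduce_vec n N1 a) (int (t mod N1)) (reduce_vec n N1 v))"
proof -
  have "line_point n (M * N1) a (int t) v \<in> int_vecs n (M * N1)" using pos by (intro line_point_in_vecs) simp
  from crt_vec_reduce[OF this] show ?thesis by (simp add: reduce_line_point zmod_int)
qed

text \<open>For fixed \<open>u\<close>, \<open>G u z\<close> is the largest weight that a chosen line assigns to its fibre over \<open>z\<close>; the inequality
  modulo \<open>M\<close> is applied on each fibre, the one modulo \<open>N1\<close> to \<open>G u\<close>.\<close>

lemma product_ineq:
  fixes f w :: "(nat \<Rightarrow> int) \<Rightarrow> nat"
  assumes ineqM: "max_ineq n M m c1" and ineqN: "\<And>m. max_ineq n N1 m c2" and c1: "c1 \<ge> 0"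
    and a: "\<And>v. v \<in> unimodular_vecs n (M * N1) \<Longrightarrow> a v \<in> int_vecs n (M * N1)"
    and w: "\<And>v. v \<in> unimodular_vecs n (M * N1) \<Longrightarrow> w v \<le> (\<Sum>t<M * N1. f (line_point n (M * N1) (a v) (int t) v))"
    and fibre: "\<And>v r. v \<in> unimodular_vecs n (M * N1) \<Longrightarrow> r < N1 \<Longrightarrow>
      (\<Sum>s<M. f (crt_vec n M N1 (line_point n M (reduce_vec n M (a v)) (int s) (reduce_vec n M v),
                  line_point n N1 (reduce_vec n N1 (a v)) (int r) (reduce_vec n N1 v)))) \<le> m"
  shows "c1 * c2 * (\<Sum>v\<in>unimodular_vecs n (M * N1). real (w v) ^ n)
     \<le> real (card (unimodular_vecs n (M * N1))) * (\<Sum>x\<in>int_vecs n (M * N1). real (f x) ^ n)"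
proof -
  let ?D = "unimodular_vecs n M" and ?E = "unimodular_vecs n N1" and ?V = "int_vecs n M" and ?W = "int_vecs n N1"
  let ?c = "\<lambda>x z. crt_vec n M N1 (x, z)"
  have DV: "u \<in> ?V" if "u \<in> ?D" for u using that by (simp add: unimodular_vecs_def)
  have EW: "u \<in> ?W" if "u \<in> ?E" for u using that by (simp add: unimodular_vecs_def)
  have cD: "?c u u1 \<in> unimodular_vecs n (M * N1)" if "u \<in> ?D" "u1 \<in> ?E" for u u1
    using bij_betw_crt_unimodular that by (auto simp: bij_betw_def)
  define aM where "aM u u1 = reduce_vec n M (a (?c u u1))" for u u1
  define aN where "aN u u1 = reduce_vec n N1 (a (?c u u1))" for u u1
  define h where "h u u1 z = (\<Sum>s<M. f (?c (line_point n M (aM u u1) (int s) u) z))" for u u1 z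
  \<comment> \<open>The inserted 0 covers points \<open>z\<close> that lie on no chosen
    line.\<close>
  define G where "G u z = Max (insert 0 ((\<lambda>u1. h u u1 z) `
      {u1 \<in> ?E. z \<in> (\<lambda>r. line_point n N1 (aN u u1) (int r) u1) ` {..<N1}}))" for u z
  have G_cases: "G u z = 0 \<or> (\<exists>u1\<in>?E. \<exists>r<N1. z = line_point n N1 (aN u u1) (int r) u1 \<and> G u z = h u u1 z)" for u z
  proof -
    have "G u z \<in> insert 0 ((\<lambda>u1. h u u1 z) `
      {u1 \<in> ?E. z \<in> (\<lambda>r. line_point n N1 (aN u u1) (int r) u1) ` {..<N1}})"
      unfolding G_def by (intro Max_in) auto
    then show ?thesis by blast
  qed
  have G_ge: "h u u1 (line_point n N1 (aN u u1) (int r) u1) \<le> G u (line_point n N1 (aN u u1) (int r) u1)"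
    if "u1 \<in> ?E" "r < N1" for u u1 r
    unfolding G_def using that by (intro Max_ge) auto
  have fib: "h u u1 (line_point n N1 (aN u u1) (int r) u1) \<le> m" if "u \<in> ?D" "u1 \<in> ?E" "r < N1" for u u1 r
    using fibre[OF cD[OF that(1,2)] that(3)] crt_vec_inverse[OF DV[OF that(1)] EW[OF that(2)]]
    by (simp add: h_def aM_def aN_def)
  have step1: "c1 * (\<Sum>u\<in>?D. real (G u z) ^ n) \<le> real (card ?D) * (\<Sum>x\<in>?V. real (f (?c x z)) ^ n)" for z
  proof -
    have "G u z \<le> m \<and> (\<exists>b\<in>?V. G u z \<le> (\<Sum>s<M. f (?c (line_point n M b (int s) u) z)))" if u: "u \<in> ?D" for u
    proof (cases "G u z = 0")
      case True
      have "line_point n M u 0 u \<in> ?V" by (rule line_point_in_vecs[OF pos(1)])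
      then show ?thesis unfolding True by blast
    next
      case False
      with G_cases[of u z] obtain u1 r where u1: "u1 \<in> ?E" "r < N1" "z = line_point n N1 (aN u u1) (int r) u1" "G u z = h u u1 z"
        by blast
      have "aM u u1 \<in> ?V" unfolding aM_def by (rule reduce_vec_in[OF pos(1)])
      moreover have "G u z \<le> m" using fib[OF u u1(1,2)] u1(3,4) by simp
      moreover have "G u z \<le> (\<Sum>s<M. f (?c (line_point n M (aM u u1) (int s) u) z))" by (simp add: u1(4) h_def)
      ultimately show ?thesis by blast
    qed
    then show ?thesis
      using ineqM[unfolded max_ineq_def, THEN spec, of "\<lambda>x. f (?c x z)", THEN spec, of "\<lambda>u. G u z"] by blast
  qed
  have step2: "c2 * (\<Sum>u1\<in>?E. real (w (?c u u1)) ^ n) \<le> real (card ?E) * (\<Sum>z\<in>?W. real (G u z) ^ n)"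
    if u: "u \<in> ?D" for u
  proof -
    have "w (?c u u1) \<le> (\<Sum>v\<in>?E. w (?c u v)) \<and>
        (\<exists>b\<in>?W. w (?c u u1) \<le> (\<Sum>r<N1. G u (line_point n N1 b (int r) u1)))" if u1: "u1 \<in> ?E" for u1
    proof
      \<comment> \<open>The inequality modulo \<open>N1\<close> holds for every weight bound, so any
        finite one serves here.\<close>
      show "w (?c u u1) \<le> (\<Sum>v\<in>?E. w (?c u v))" using u1 by (intro member_le_sum) auto
      note inv = crt_vec_inverse[OF DV[OF u] EW[OF u1]]
      have "w (?c u u1) \<le> (\<Sum>t<M * N1. f (line_point n (M * N1) (a (?c u u1)) (int t) (?c u u1)))"
        by (rule w[OF cD[OF u u1]])
      also have "\<dots> = (\<Sum>t<M * N1. f (?c (line_point n M (aM u u1) (int (t mod M)) u)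
            (line_point n N1 (aN u u1) (int (t mod N1)) u1)))"
        by (simp only: line_point_crt[OF a[OF cD[OF u u1]]] inv aM_def aN_def)
      also have "\<dots> = (\<Sum>r<N1. h u u1 (line_point n N1 (aN u u1) (int r) u1))"
        unfolding h_def by (rule sum_crt)
      also have "\<dots> \<le> (\<Sum>r<N1. G u (line_point n N1 (aN u u1) (int r) u1))"
        using u1 by (intro sum_mono G_ge) auto
      finally show "\<exists>b\<in>?W. w (?c u u1) \<le> (\<Sum>r<N1. G u (line_point n N1 b (int r) u1))"
        using reduce_vec_in[OF pos(2), of n "a (?c u u1)"] unfolding aN_def by blast
    qed
    then show ?thesis
      using ineqN[of "\<Sum>v\<in>?E. w (?c u v)", unfolded max_ineq_def, THEN spec, of "G u", THEN spec, of "\<lambda>u1. w (?c u u1)"]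
      by blast
  qed
  have "c1 * c2 * (\<Sum>v\<in>unimodular_vecs n (M * N1). real (w v) ^ n)
      = c1 * (\<Sum>u\<in>?D. c2 * (\<Sum>u1\<in>?E. real (w (?c u u1)) ^ n))"
    by (simp add: sum.reindex_bij_betw[OF bij_betw_crt_unimodular, symmetric] sum.cartesian_product' sum_distrib_left mult_ac)
  also have "\<dots> \<le> c1 * (\<Sum>u\<in>?D. real (card ?E) * (\<Sum>z\<in>?W. real (G u z) ^ n))"
    by (intro mult_left_mono sum_mono step2 c1)
  also have "\<dots> = real (card ?E) * (\<Sum>z\<in>?W. c1 * (\<Sum>u\<in>?D. real (G u z) ^ n))"
    by (simp add: sum_distrib_left mult_ac) (rule sum.swap)
  also have "\<dots> \<le> real (card ?E) * (\<Sum>z\<in>?W. real (card ?D) * (\<Sum>x\<in>?V. real (f (?c x z)) ^ n))"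
    by (intro mult_left_mono sum_mono step1) auto
  also have "\<dots> = real (card ?D * card ?E) * (\<Sum>x\<in>?V. \<Sum>z\<in>?W. real (f (?c x z)) ^ n)"
    by (simp add: sum_distrib_left mult_ac) (rule sum.swap)
  also have "card ?D * card ?E = card (unimodular_vecs n (M * N1))"
    using bij_betw_same_card[OF bij_betw_crt_unimodular[of n]] by (simp add: card_cartesian_product)
  also have "(\<Sum>x\<in>?V. \<Sum>z\<in>?W. real (f (?c x z)) ^ n) = (\<Sum>x\<in>int_vecs n (M * N1). real (f x) ^ n)"
    using sum.reindex_bij_betw[OF bij_betw_crt_vec[of n], of "\<lambda>x. real (f x) ^ n"]
    by (simp only: sum.cartesian_product')
  finally show ?thesis .
qed

text \<open>A bound on full line weights is not passed to the fibres chosen here, so both factors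
  are assumed to satisfy their inequality for all \<open>m\<close>; the total mass times
  \<open>M\<close> bounds the fibre weights.\<close>

lemma max_ineq_mult:
  assumes "\<And>m. max_ineq n M m c1" "\<And>m. max_ineq n N1 m c2" "c1 \<ge> 0"
  shows "max_ineq n (M * N1) m (c1 * c2)"
  unfolding max_ineq_def
proof (intro allI impI)
  let ?V = "int_vecs n (M * N1)" and ?D = "unimodular_vecs n (M * N1)"
  fix f w :: "(nat \<Rightarrow> int) \<Rightarrow> nat"
  assume "\<forall>v\<in>?D. w v \<le> m \<and> (\<exists>a\<in>?V. w v \<le> (\<Sum>t<M * N1. f (line_point n (M * N1) a (int t) v)))"
  note w = this
  let ?good = "\<lambda>v a. a \<in> ?V \<and> w v \<le> (\<Sum>t<M * N1. f (line_point n (M * N1) a (int t) v))"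
  have ex: "\<exists>a. v \<in> ?D \<longrightarrow> ?good v a" for v
  proof (cases "v \<in> ?D")
    case True
    from bspec[OF w this] obtain a where "?good v a" by (elim conjE bexE) (simp only: simp_thms)
    then show ?thesis by (intro exI[of _ a] impI)
  qed simp
  have "\<forall>v. \<exists>a. v \<in> ?D \<longrightarrow> ?good v a" by (rule allI) (rule ex)
  from choice[OF this] obtain a where a': "\<forall>v. v \<in> ?D \<longrightarrow> ?good v (a v)" by (elim exE)
  then have good: "?good v (a v)" if "v \<in> ?D" for v using that by (elim allE[of _ v] impE)
  note a = good[THEN conjunct1] good[THEN conjunct2]
  show "c1 * c2 * (\<Sum>v\<in>?D. real (w v) ^ n) \<le> real (card ?D) * (\<Sum>x\<in>?V. real (f x) ^ n)"
  proof (rule product_ineq[OF assms a])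
    fix v r
    have "f (crt_vec n M N1 (line_point n M (reduce_vec n M (a v)) (int s) (reduce_vec n M v),
                  line_point n N1 (reduce_vec n N1 (a v)) (int r) (reduce_vec n N1 v))) \<le> (\<Sum>x\<in>?V. f x)" for s
      by (intro member_le_sum finite_int_vecs crt_vec_inverse line_point_in_vecs pos) simp
    from sum_bounded_above[of "{..<M}", OF this]
    show "(\<Sum>s<M. f (crt_vec n M N1 (line_point n M (reduce_vec n M (a v)) (int s) (reduce_vec n M v),
                  line_point n N1 (reduce_vec n N1 (a v)) (int r) (reduce_vec n N1 v)))) \<le> M * (\<Sum>x\<in>?V. f x)"
      by simp
  qed
qed

end

lemma max_ineq_1: "max_ineq n 1 m 1"
  unfolding max_ineq_def
proof (intro allI impI)
  fix f w :: "(nat \<Rightarrow> int) \<Rightarrow> nat"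
  define z where "z = (\<lambda>l\<in>{..<n}. 0 :: int)"
  have V: "int_vecs n 1 = {z}" by (auto simp: z_def PiE_eq_singleton)
  have D: "unimodular_vecs n 1 = {z}" unfolding unimodular_vecs_def V by simp
  assume "\<forall>v\<in>unimodular_vecs n 1. w v \<le> m \<and> (\<exists>a\<in>int_vecs n 1. w v \<le> (\<Sum>t<1. f (line_point n 1 a (int t) v)))"
  then obtain a where "w z \<le> (\<Sum>t<1. f (line_point n 1 a (int t) z))" using D by blast
  moreover have "line_point n 1 a 0 z = z" using line_point_in_vecs[of 1 n a 0 z] unfolding V by simp
  ultimately have "w z \<le> f z" by simp
  then show "1 * (\<Sum>v\<in>unimodular_vecs n 1. real (w v) ^ n)
      \<le> real (card (unimodular_vecs n 1)) * (\<Sum>x\<in>int_vecs n 1. real (f x) ^ n)"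
    unfolding D V by (simp add: power_mono)
qed

section \<open>Projective space and maximal lines\<close>

lemma prime_part_gt_1:
  assumes "N > 0" "q \<in> prime_factors N"
  shows "prime q" "prime_part N q > 1" "q dvd prime_part N q"
proof -
  show q: "prime q" using assms by auto
  have "multiplicity q N > 0" using assms by (simp add: prime_factors_multiplicity)
  then show "prime_part N q > 1" "q dvd prime_part N q"
    using one_less_power[OF prime_gt_1_nat[OF q]] unfolding prime_part_def by auto
qed

lemma direction_vecs_eq:
  assumes "N > 0"
  shows "direction_vecs n N = unimodular_vecs n N"
proof -
  have "reduce_vec n (prime_part N q) u j \<in> Units (ZMod (prime_part N q)) \<longleftrightarrow> \<not> int q dvd u j"
    if q: "q \<in> prime_factors N" and j: "j < n" for q j and u :: "nat \<Rightarrow> int"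
  proof -
    note Q = prime_part_gt_1[OF assms q]
    interpret residues "int (prime_part N q)" "ZMod (prime_part N q)"
      by unfold_locales (use Q(2) in simp_all)
    have m: "multiplicity q N > 0" using assms q by (simp add: prime_factors_multiplicity)
    have q': "prime (int q)" using Q(1) by simp
    have "coprime x (int q) \<longleftrightarrow> \<not> int q dvd x" for x
    proof
      assume "coprime x (int q)"
      then show "\<not> int q dvd x" using coprime_common_divisor[of x "int q" "int q"] not_prime_unit[of "int q"] q' dvd_refl[of "int q"] by argo
    next
      assume "\<not> int q dvd x"
      then show "coprime x (int q)" using prime_imp_coprime[OF q'] by (simp add: coprime_commute)
    qed
    then have cop: "coprime x (int (prime_part N q)) \<longleftrightarrow> \<not> int q dvd x" for x
      using m by (simp add: prime_part_def)
    have dv: "int q dvd x mod int (prime_part N q) \<longleftrightarrow> int q dvd x" for x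
      using Q(3) by (intro dvd_mod_iff) (simp only: of_nat_dvd_iff)
    have "x mod int (prime_part N q) \<in> Units (ZMod (prime_part N q)) \<longleftrightarrow> \<not> int q dvd x" for x
    proof -
      have bnd: "x mod int (prime_part N q) \<ge> 0" "x mod int (prime_part N q) < int (prime_part N q)"
        using Q(2) by simp_all
      \<comment> \<open>The description of the units by \<open>res_units_eq\<close> asks for a
        positive residue in addition to coprimality.\<close>
      have "x mod int (prime_part N q) \<noteq> 0" if "\<not> int q dvd x" using that dv[of x] by auto
      with bnd show ?thesis
        unfolding res_units_eq mem_Collect_eq cop dv by (cases "int q dvd x") simp_all
    qed
    then show ?thesis using j by (simp only: reduce_vec_def restrict_apply' lessThan_iff)
  qed
  then have "(\<exists>j<n. reduce_vec n (prime_part N q) u j \<in> Units (ZMod (prime_part N q))) \<longleftrightarrow> (\<exists>j<n. \<not> int q dvd u j)"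
    if "q \<in> prime_factors N" for q and u :: "nat \<Rightarrow> int"
    using that by (intro ex_cong1 conj_cong refl)
  then show ?thesis unfolding direction_vecs_def unimodular_vecs_def mod_vecs_eq
    by (intro Collect_cong conj_cong refl ball_cong)
qed

lemma add_smult_eq_line_point: "add_vec n N a (Defs.smult_vec n N t u) = line_point n N a t u"
  by (auto simp: add_vec_def Defs.smult_vec_def line_point_def residue_ring_def mod_simps intro!: restrict_ext)

lemma line_eq_image:
  assumes "N > 0"
  shows "line n N a u = (\<lambda>t. line_point n N a (int t) u) ` {..<N}"
proof -
  have "carrier (ZMod N) = int ` {..<N}"
    using assms by (auto simp: residue_ring_def image_iff intro!: bexI[of _ "nat _"])
  then show ?thesis unfolding line_def add_smult_eq_line_point by auto
qed

section \<open>Unit multiples, projective classes and their lines\<close>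

context
  fixes n N :: nat
  assumes N: "N > 1"
begin

interpretation residues "int N" "ZMod N"
  by unfold_locales (use N in simp_all)

lemma smult_vec_apply: "l < n \<Longrightarrow> Defs.smult_vec n N c u l = (c * u l) mod int N"
  by (simp add: Defs.smult_vec_def res_mult_eq)

lemma smult_vec_in: "Defs.smult_vec n N c u \<in> int_vecs n N"
  using N by (auto simp: Defs.smult_vec_def res_mult_eq)

lemma smult_vec_smult_vec: "Defs.smult_vec n N c (Defs.smult_vec n N d u) = Defs.smult_vec n N (c \<otimes>\<^bsub>ZMod N\<^esub> d) u"
proof -
  have "(c * (d * x mod int N)) mod int N = (c * d mod int N * x) mod int N" for x
    by (metis mod_mult_left_eq mod_mult_right_eq mult.assoc)
  then show ?thesis by (simp add: Defs.smult_vec_def res_mult_eq cong: restrict_cong)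
qed

lemma smult_vec_one: "u \<in> int_vecs n N \<Longrightarrow> Defs.smult_vec n N 1 u = u"
  by (rule int_vecs_eqI[OF smult_vec_in]) (simp_all add: smult_vec_apply Cong.cong_def)

lemma unit_smult_vec_unimodular:
  assumes "c \<in> Units (ZMod N)" "u \<in> unimodular_vecs n N"
  shows "Defs.smult_vec n N c u \<in> unimodular_vecs n N"
proof -
  have c: "coprime c (int N)" using assms(1) by (simp add: res_units_eq)
  have "int q dvd Defs.smult_vec n N c u l \<longleftrightarrow> int q dvd u l" if "q \<in> prime_factors N" "l < n" for q l
  proof -
    have q: "prime (int q)" "int q dvd int N" using that by auto
    have "\<not> int q dvd c"
      using coprime_common_divisor[OF c _ q(2)] not_prime_unit[of "int q"] q(1) by blast
    moreover have "int q dvd Defs.smult_vec n N c u l \<longleftrightarrow> int q dvd c * u l"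
      using q(2) by (simp only: smult_vec_apply[OF that(2)] dvd_mod_iff)
    ultimately show ?thesis using q(1) by (simp add: prime_dvd_mult_iff)
  qed
  then have "(\<exists>l<n. \<not> int q dvd Defs.smult_vec n N c u l) \<longleftrightarrow> (\<exists>l<n. \<not> int q dvd u l)"
    if "q \<in> prime_factors N" for q
    using that by (intro ex_cong1 conj_cong arg_cong[of _ _ Not] refl)
  then show ?thesis using assms(2) smult_vec_in unfolding unimodular_vecs_def mem_Collect_eq by simp
qed

lemma inj_on_unit_smult:
  assumes u: "u \<in> unimodular_vecs n N"
  shows "inj_on (\<lambda>c. Defs.smult_vec n N c u) (Units (ZMod N))"
proof (rule inj_onI)
  fix c d assume cd: "c \<in> Units (ZMod N)" "d \<in> Units (ZMod N)" and eq: "Defs.smult_vec n N c u = Defs.smult_vec n N d u"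
  have "int N dvd c - d"
  proof (rule dvd_if_dvd_unimodular_multiple[OF u])
    fix l assume l: "l < n"
    from fun_cong[OF eq, of l] have "(c * u l) mod int N = (d * u l) mod int N" by (simp only: smult_vec_apply[OF l])
    then have "int N dvd c * u l - d * u l" by (simp only: mod_eq_dvd_iff)
    then show "int N dvd (c - d) * u l" by (simp only: left_diff_distrib)
  qed (use N in simp)
  then have "c mod int N = d mod int N" by (simp only: mod_eq_dvd_iff)
  with cd show "c = d" by (simp add: res_units_eq)
qed

lemma unit_multiple_rel_eq:
  "unit_multiple_rel n N = {(u, v). u \<in> unimodular_vecs n N \<and> (\<exists>c\<in>Units (ZMod N). v = Defs.smult_vec n N c u)}"
proof -
  have "N > 0" using N by simp
  show ?thesis
    unfolding unit_multiple_rel_def direction_vecs_eq[OF \<open>N > 0\<close>]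
    by (auto intro: unit_smult_vec_unimodular)
qed

lemma equiv_unit_multiple_rel: "equiv (unimodular_vecs n N) (unit_multiple_rel n N)"
proof (rule equivI)
  show "unit_multiple_rel n N \<subseteq> unimodular_vecs n N \<times> unimodular_vecs n N"
    using unit_smult_vec_unimodular by (auto simp: unit_multiple_rel_eq)
  show "refl_on (unimodular_vecs n N) (unit_multiple_rel n N)"
  proof (rule refl_onI)
    fix u assume u: "u \<in> unimodular_vecs n N"
    then have "u = Defs.smult_vec n N 1 u" using smult_vec_one by (simp add: unimodular_vecs_def)
    moreover have "1 \<in> Units (ZMod N)" using Units_one_closed by (simp add: res_one_eq)
    ultimately show "(u, u) \<in> unit_multiple_rel n N" using u by (auto simp: unit_multiple_rel_eq)
  qed
  show "sym (unit_multiple_rel n N)"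
  proof (rule symI)
    fix u v assume "(u, v) \<in> unit_multiple_rel n N"
    then obtain c where c: "u \<in> unimodular_vecs n N" "c \<in> Units (ZMod N)" "v = Defs.smult_vec n N c u"
      by (auto simp: unit_multiple_rel_eq)
    have "Defs.smult_vec n N (inv\<^bsub>ZMod N\<^esub> c) v = Defs.smult_vec n N 1 u"
      using c(2) by (simp add: c(3) smult_vec_smult_vec Units_l_inv res_one_eq)
    then have "u = Defs.smult_vec n N (inv\<^bsub>ZMod N\<^esub> c) v" using c(1) smult_vec_one by (simp add: unimodular_vecs_def)
    moreover have "v \<in> unimodular_vecs n N" using c unit_smult_vec_unimodular by simp
    ultimately show "(v, u) \<in> unit_multiple_rel n N" using Units_inv_Units[OF c(2)] by (auto simp: unit_multiple_rel_eq)
  qed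
  show "trans (unit_multiple_rel n N)"
  proof (rule transI)
    fix u v w assume "(u, v) \<in> unit_multiple_rel n N" "(v, w) \<in> unit_multiple_rel n N"
    then obtain c d where "u \<in> unimodular_vecs n N" "c \<in> Units (ZMod N)" "d \<in> Units (ZMod N)"
      "w = Defs.smult_vec n N d (Defs.smult_vec n N c u)" by (auto simp: unit_multiple_rel_eq)
    then show "(u, w) \<in> unit_multiple_rel n N"
      unfolding unit_multiple_rel_eq smult_vec_smult_vec by (blast intro: Units_m_closed)
  qed
qed

lemma proj_space_eq: "proj_space n N = unimodular_vecs n N // unit_multiple_rel n N"
  using N by (simp add: proj_space_def direction_vecs_eq)

lemma card_proj_class:
  assumes "U \<in> proj_space n N"
  shows "card U = card (Units (ZMod N))"
proof -
  obtain u where u: "u \<in> unimodular_vecs n N" "U = unit_multiple_rel n N `` {u}"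
    using assms unfolding proj_space_eq by (rule quotientE)
  then have "U = (\<lambda>c. Defs.smult_vec n N c u) ` Units (ZMod N)" by (auto simp: unit_multiple_rel_eq)
  then show ?thesis by (simp add: card_image inj_on_unit_smult[OF u(1)])
qed

lemma finite_proj_space: "finite (proj_space n N)"
  unfolding proj_space_eq
  by (rule finite_quotient[OF finite_unimodular_vecs equiv_type[OF equiv_unit_multiple_rel]])

text \<open>All classes have as many elements as there are units, so the average over projective
  points equals the average over unimodular vectors.\<close>

lemma sum_over_proj_space:
  fixes F :: "(nat \<Rightarrow> int) set \<Rightarrow> real"
  shows "(\<Sum>v\<in>unimodular_vecs n N. F (unit_multiple_rel n N `` {v}))
    = real (card (Units (ZMod N))) * (\<Sum>U\<in>proj_space n N. F U)"
proof -
  let ?R = "unit_multiple_rel n N" and ?D = "unimodular_vecs n N"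
  have cl: "{v \<in> ?D. ?R `` {v} = U} = U" if U: "U \<in> proj_space n N" for U
  proof -
    obtain u where u: "u \<in> ?D" "U = ?R `` {u}" using U unfolding proj_space_eq by (rule quotientE)
    show ?thesis
    proof (intro equalityI subsetI)
      fix v assume "v \<in> {v \<in> ?D. ?R `` {v} = U}"
      then have "v \<in> ?D" "?R `` {u} = ?R `` {v}" unfolding u(2) by simp_all
      then show "v \<in> U" unfolding u(2) eq_equiv_class_iff[OF equiv_unit_multiple_rel u(1) \<open>v \<in> ?D\<close>] by simp
    next
      fix v assume "v \<in> U"
      then have uv: "(u, v) \<in> ?R" unfolding u(2) by simp
      then have "v \<in> ?D" using equiv_type[OF equiv_unit_multiple_rel] by (elim subsetD[THEN SigmaD2])
      then show "v \<in> {v \<in> ?D. ?R `` {v} = U}"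
        unfolding u(2) equiv_class_eq[OF equiv_unit_multiple_rel uv] by simp
    qed
  qed
  have "(\<Sum>v\<in>?D. F (?R `` {v})) = (\<Sum>U\<in>proj_space n N. \<Sum>v\<in>{v \<in> ?D. ?R `` {v} = U}. F (?R `` {v}))"
    by (intro sum.group[symmetric] finite_proj_space finite_unimodular_vecs image_subsetI) (simp add: proj_space_eq quotientI)
  also have "\<dots> = (\<Sum>U\<in>proj_space n N. real (card U) * F U)"
  proof (rule sum.cong[OF refl])
    fix U assume U: "U \<in> proj_space n N"
    have "(\<Sum>v\<in>{v \<in> ?D. ?R `` {v} = U}. F (?R `` {v})) = (\<Sum>v\<in>{v \<in> ?D. ?R `` {v} = U}. F U)"
      by (rule sum.cong) auto
    then show "(\<Sum>v\<in>{v \<in> ?D. ?R `` {v} = U}. F (?R `` {v})) = real (card U) * F U" using cl[OF U] by simp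
  qed
  also have "\<dots> = real (card (Units (ZMod N))) * (\<Sum>U\<in>proj_space n N. F U)"
    by (simp add: card_proj_class sum_distrib_left)
  finally show ?thesis .
qed

lemma line_subset_of_unit_multiple:
  assumes "(u, v) \<in> unit_multiple_rel n N"
  shows "line n N a v \<subseteq> line n N a u"
proof
  have "N > 0" using N by simp
  note lines = line_eq_image[OF this]
  fix x assume "x \<in> line n N a v"
  then obtain t where t: "x = line_point n N a (int t) v" unfolding lines by (elim imageE)
  obtain c where c: "v = Defs.smult_vec n N c u" using assms by (auto simp: unit_multiple_rel_eq)
  define s where "s = nat ((int t * c) mod int N)"
  have s: "int s = (int t * c) mod int N" "s < N" using N by (simp_all add: s_def nat_less_iff)
  have "x = line_point n N a (int s) u"
  proof -
    have "(y + int t * (c * z mod int N)) mod int N = (y + int t * c mod int N * z) mod int N" for y z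
    proof -
      have "(int t * (c * z mod int N)) mod int N = (int t * c mod int N * z) mod int N"
        by (simp only: mod_mult_right_eq mod_mult_left_eq mult.assoc)
      then show ?thesis by (metis mod_add_right_eq)
    qed
    then show ?thesis
      unfolding t c s(1) line_point_def by (intro restrict_ext) (simp add: smult_vec_apply)
  qed
  then show "x \<in> line n N a u" unfolding lines using s(2) by (intro image_eqI[of _ _ s]) simp_all
qed

lemma line_unit_multiple:
  assumes "(u, v) \<in> unit_multiple_rel n N"
  shows "line n N a v = line n N a u"
proof (rule equalityI)
  have "sym (unit_multiple_rel n N)" using equiv_unit_multiple_rel by (rule equivE)
  then have "(v, u) \<in> unit_multiple_rel n N" using assms by (rule symD)
  then show "line n N a u \<subseteq> line n N a v" by (rule line_subset_of_unit_multiple)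
qed (rule line_subset_of_unit_multiple[OF assms])

end

section \<open>Assembling the constant\<close>

lemma max_ineq_trivial:
  assumes "c = 0 \<or> m = 0" "n > 0"
  shows "max_ineq n N m c"
  unfolding max_ineq_def
proof (intro allI impI)
  fix f w :: "(nat \<Rightarrow> int) \<Rightarrow> nat"
  assume "\<forall>v\<in>unimodular_vecs n N. w v \<le> m \<and> (\<exists>a\<in>int_vecs n N. w v \<le> (\<Sum>t<N. f (line_point n N a (int t) v)))"
  then have "m = 0 \<Longrightarrow> v \<in> unimodular_vecs n N \<Longrightarrow> w v = 0" for v by fastforce
  then have "c * (\<Sum>v\<in>unimodular_vecs n N. real (w v) ^ n) = 0"
    using assms by (auto simp: zero_power)
  moreover have "0 \<le> real (card (unimodular_vecs n N)) * (\<Sum>x\<in>int_vecs n N. real (f x) ^ n)"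
    by (intro mult_nonneg_nonneg sum_nonneg) simp_all
  ultimately show "c * (\<Sum>v\<in>unimodular_vecs n N. real (w v) ^ n)
      \<le> real (card (unimodular_vecs n N)) * (\<Sum>x\<in>int_vecs n N. real (f x) ^ n)"
    by (simp only:)
qed

text \<open>In the main case \<open>ln (real m) + 1 \<ge> 1\<close>, so the constant of
  \<open>max_ineq_bounded_weight\<close> dominates. The other cases rest on default values:
  \<open>m = 0\<close> forces all weights to vanish, and for \<open>m = n = 1\<close> the rounded
  logarithm is 0, so division by zero makes the constant 0.\<close>

lemma max_ineq_log_weight:
  assumes p: "prime p" "k > 0" and n: "n > 0"
  shows "\<exists>c\<ge>0. max_ineq n (p ^ k) m c \<and>
    (1 / (2 * (ln (real m) + 1) * real_of_int \<lceil>log (real p) (real m) + log (real p) (real n)\<rceil>)) ^ n \<le> c"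
proof -
  define T where "T = real_of_int \<lceil>log (real p) (real m) + log (real p) (real n)\<rceil>"
  consider "m = 0" | "m > 0" "m * n > 1" | "m = 1" "n = 1"
    using n by (metis One_nat_def Suc_lessI gr0I mult_eq_1_iff nat_0_less_mult_iff)
  then have "\<exists>c\<ge>0. max_ineq n (p ^ k) m c \<and> (1 / (2 * (ln (real m) + 1) * T)) ^ n \<le> c"
  proof cases
    case 1
    then show ?thesis using max_ineq_trivial n
      by (intro exI[of _ "\<bar>(1 / (2 * (ln (real m) + 1) * T)) ^ n\<bar>"]) auto
  next
    case 2
    have p1: "real p > 1" using prime_gt_1_nat[OF p(1)] by simp
    have "log (real p) (real m) \<ge> 0" "log (real p) (real n) \<ge> 0" using 2 n p1 by auto
    then have T: "T \<ge> 0" unfolding T_def by simp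
    have l: "ln (real m) \<ge> 0" using 2 by simp
    have "1 / (2 * (ln (real m) + 1) * T) \<le> 1 / (2 * T)"
    proof (cases "T = 0")
      case False
      with T have "T > 0" by simp
      moreover from this l have "2 * T \<le> 2 * (ln (real m) + 1) * T" by simp
      ultimately show ?thesis by (intro divide_left_mono) (use l in auto)
    qed simp
    then have "(1 / (2 * (ln (real m) + 1) * T)) ^ n \<le> (1 / (2 * T)) ^ n"
      using T l by (intro power_mono) auto
    then show ?thesis using max_ineq_bounded_weight[OF p n 2] T unfolding T_def[symmetric]
      by (intro exI[of _ "(1 / (2 * T)) ^ n"]) auto
  next
    case 3
    then have "T = 0" by (simp add: T_def)
    then show ?thesis using max_ineq_trivial n by (intro exI[of _ 0]) (auto simp: zero_power)
  qed
  then show ?thesis unfolding T_def .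
qed

lemma max_ineq_prod:
  assumes "finite A" "inj_on p A" "\<And>i. i \<in> A \<Longrightarrow> prime (p i)" "\<And>i. i \<in> A \<Longrightarrow> k i > 0" and n: "n > 0"
  shows "max_ineq n (\<Prod>i\<in>A. p i ^ k i) m
     ((\<Prod>i\<in>A. 1 / (2 * (real (k i) + real_of_int \<lceil>log (real (p i)) (real n)\<rceil>))) ^ n)"
  using assms(1-4)
proof (induction A arbitrary: m rule: finite_induct)
  case empty
  show ?case using max_ineq_1 by simp
next
  case (insert i A)
  define c where "c i = 1 / (2 * (real (k i) + real_of_int \<lceil>log (real (p i)) (real n)\<rceil>))" for i
  have cop: "coprime (p i ^ k i) (\<Prod>i\<in>A. p i ^ k i)"
  proof (rule prod_coprime_right)
    fix j assume "j \<in> A"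
    then have "p i \<noteq> p j" using insert.hyps insert.prems(1) by (auto simp: inj_on_def)
    then show "coprime (p i ^ k i) (p j ^ k j)"
      using insert.prems(2) \<open>j \<in> A\<close> by (simp add: primes_coprime)
  qed
  have pos: "p i ^ k i > 0" "(\<Prod>i\<in>A. p i ^ k i) > 0"
    using insert.prems(2) prime_gt_0_nat by (auto intro!: prod_pos)
  have "log (real (p i)) (real n) \<ge> 0" using n prime_gt_1_nat[of "p i"] insert.prems(2) by simp
  then have c0: "c i ^ n \<ge> 0" unfolding c_def by (intro zero_le_power) simp
  have IH: "max_ineq n (\<Prod>i\<in>A. p i ^ k i) m ((\<Prod>i\<in>A. c i) ^ n)" for m
    unfolding c_def using insert.prems by (intro insert.IH) auto
  have "max_ineq n (p i ^ k i) m (c i ^ n)" for m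
    unfolding c_def using insert.prems n by (intro max_ineq_unbounded_weight) auto
  from max_ineq_mult[OF cop pos this IH c0] show ?case
    unfolding prod.insert[OF insert.hyps] power_mult_distrib c_def .
qed

lemma unimodular_vecs_nonempty:
  assumes "n > 0" "N > 1"
  shows "unimodular_vecs n N \<noteq> {}"
proof -
  have "(\<lambda>l\<in>{..<n}. 1) \<in> int_vecs n N" using assms(2) by simp
  moreover have "\<not> int q dvd 1" if "q \<in> prime_factors N" for q
    using that prime_gt_1_nat[of q] by auto
  ultimately have "(\<lambda>l\<in>{..<n}. 1) \<in> unimodular_vecs n N"
    unfolding unimodular_vecs_def using assms(1) by (intro CollectI conjI ballI exI[of _ 0]) simp_all
  then show ?thesis by blast
qed

lemma multiplicity_prime_power_mult:
  assumes "prime p" "\<not> p dvd (Q :: nat)"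
  shows "multiplicity p (p ^ k * Q) = k"
  using assms prime_gt_0_nat[of p] prime_gt_1_nat[of p]
  by (intro multiplicity_eqI) auto

text \<open>The chosen line of a class has direction \<open>rep U\<close>, which differs from
  \<open>v\<close> by a unit and thus spans the same point set. Reparametrising by \<open>v\<close>
  matches the product inequality, which runs over vectors instead of classes.\<close>

lemma maximal_line:
  assumes N: "N > 1" and rep: "representatives n N rep" and L: "maximal_lines n N rep f L"
    and v: "v \<in> unimodular_vecs n N"
  defines "U \<equiv> unit_multiple_rel n N `` {v}"
  shows "U \<in> proj_space n N"
    and "\<exists>a\<in>int_vecs n N. L U = (\<lambda>t. line_point n N a (int t) v) ` {..<N}
           \<and> maximal_function n N rep f U = (\<Sum>t<N. f (line_point n N a (int t) v))"
proof -
  show U: "U \<in> proj_space n N" unfolding U_def proj_space_eq[OF N] using v by (rule quotientI)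
  then have "rep U \<in> U" using rep by (simp add: representatives_def)
  then have "(v, rep U) \<in> unit_multiple_rel n N" by (simp add: U_def)
  note lines = line_unit_multiple[OF N this]
  have "\<exists>a\<in>mod_vecs n N. L U = line n N a (rep U)" "(\<Sum>x\<in>L U. f x) = maximal_function n N rep f U"
    using L U by (auto simp: maximal_lines_def)
  then obtain a where a: "a \<in> int_vecs n N" "L U = line n N a (rep U)"
      "(\<Sum>x\<in>L U. f x) = maximal_function n N rep f U"
    unfolding mod_vecs_eq by (elim bexE)
  have N0: "N > 0" using N by simp
  have LU: "L U = (\<lambda>t. line_point n N a (int t) v) ` {..<N}"
    unfolding a(2) lines by (rule line_eq_image[OF N0])
  have "maximal_function n N rep f U = (\<Sum>t<N. f (line_point n N a (int t) v))"
    unfolding a(3)[symmetric] LU sum.reindex[OF inj_on_line_point[OF v N0]] comp_def ..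
  with a(1) LU show "\<exists>a\<in>int_vecs n N. L U = (\<lambda>t. line_point n N a (int t) v) ` {..<N}
           \<and> maximal_function n N rep f U = (\<Sum>t<N. f (line_point n N a (int t) v))"
    by (intro bexI[of _ a] conjI)
qed

lemma fibre_weight_le_mweight:
  assumes N: "N > 1" and M: "M = prime_part N q" and N1: "N1 = coprime_part N q" and MN: "N = M * N1"
    and cop: "coprime M N1"
    and v: "v \<in> unimodular_vecs n N" and U: "U \<in> proj_space n N"
    and LU: "L U = (\<lambda>t. line_point n N a (int t) v) ` {..<N}" and r: "r < N1"
  shows "(\<Sum>s<M. f (crt_vec n M N1 (line_point n M (reduce_vec n M a) (int s) (reduce_vec n M v),
           line_point n N1 (reduce_vec n N1 a) (int r) (reduce_vec n N1 v)))) \<le> mweight n N L f q"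
proof -
  have pos: "M > 0" "N1 > 0" using N MN by (auto intro: gr0I)
  have dvd: "M dvd N" "N1 dvd N" by (simp_all add: MN)
  let ?z = "line_point n N1 (reduce_vec n N1 a) (int r) (reduce_vec n N1 v)"
  let ?X = "(\<lambda>s. line_point n M (reduce_vec n M a) (int s) (reduce_vec n M v)) ` {..<M}"
  have "v \<in> int_vecs n (M * N1)" using v by (simp add: unimodular_vecs_def MN)
  then have "reduce_vec n M v \<in> unimodular_vecs n M"
    using unimodular_vecs_mult_iff[OF cop pos] v MN by blast
  note inj = inj_on_line_point[OF this pos(1)]
  have le: "N1 \<le> N" "M \<le> N" using pos by (simp_all add: MN)
  have z: "?z \<in> reduce_vec n N1 ` L U"
  proof -
    have "reduce_vec n N1 (line_point n N a (int r) v) = ?z"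
      using r by (simp add: reduce_line_point[OF cop pos dvd(2)])
    then show ?thesis unfolding LU using r le by (auto simp: image_image intro!: rev_image_eqI[of r])
  qed
  have "reduce_vec n M ` L U = ?X"
  proof (intro equalityI subsetI)
    fix x assume "x \<in> reduce_vec n M ` L U"
    then obtain t where "x = reduce_vec n M (line_point n N a (int t) v)" unfolding LU by blast
    then have "x = line_point n M (reduce_vec n M a) (int (t mod M)) (reduce_vec n M v)"
      by (simp add: reduce_line_point[OF cop pos dvd(1)] zmod_int)
    then show "x \<in> ?X" using pos by auto
  next
    fix x assume "x \<in> ?X"
    then obtain s where s: "s < M" "x = line_point n M (reduce_vec n M a) (int s) (reduce_vec n M v)" by blast
    then have "x = reduce_vec n M (line_point n N a (int s) v)"
      by (simp add: reduce_line_point[OF cop pos dvd(1)])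
    then show "x \<in> reduce_vec n M ` L U" unfolding LU using s(1) le by auto
  qed
  then have "(\<Sum>s<M. f (crt_vec n M N1 (line_point n M (reduce_vec n M a) (int s) (reduce_vec n M v), ?z)))
      = (\<Sum>x\<in>reduce_vec n M ` L U. f (crt_vec n M N1 (x, ?z)))"
    by (simp only: sum.reindex[OF inj] comp_def)
  also have "\<dots> \<le> mweight n N L f q"
  proof -
    let ?g = "\<lambda>(u, z). \<Sum>x\<in>reduce_vec n M ` L u. f (crt_vec n M N1 (x, z))"
    let ?S = "SIGMA u:proj_space n N. reduce_vec n N1 ` L u"
    \<comment> \<open>On \<open>nat\<close> a supremum bounds its members only if the set is
      bounded, hence the finiteness.\<close>
    have "?S \<subseteq> proj_space n N \<times> int_vecs n N1" using reduce_vec_in[OF pos(2)] by blast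
    then have "finite ?S" by (rule finite_subset) (intro finite_cartesian_product finite_proj_space[OF N] finite_int_vecs)
    then have "bdd_above (?g ` ?S)" by (intro bdd_above_finite finite_imageI)
    moreover have "(U, ?z) \<in> ?S" using U z by blast
    ultimately have "?g (U, ?z) \<le> (SUP y\<in>?S. ?g y)" by (intro cSUP_upper)
    then show ?thesis unfolding mweight_def M[symmetric] N1[symmetric] by simp
  qed
  finally show ?thesis .
qed

text \<open>Each factor \<open>k i * ln (p i) + 1\<close> is at least 1, so the product is compared
  factor by factor.\<close>

lemma kakeya_const_le:
  assumes "r \<ge> 1" and p: "\<And>i. i \<in> {1..r} \<Longrightarrow> prime (p i)" and k: "\<And>i. i \<in> {1..r} \<Longrightarrow> k i > 0" and "n > 0"
    and c: "0 \<le> c" "(1 / (2 * (ln (real m) + 1) *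
        real_of_int \<lceil>log (real (p 1)) (real m) + log (real (p 1)) (real n)\<rceil>)) ^ n \<le> c"
  shows "kakeya_const n r p k m
     \<le> c * (\<Prod>i\<in>{2..r}. 1 / (2 * (real (k i) + real_of_int \<lceil>log (real (p i)) (real n)\<rceil>))) ^ n"
proof -
  define \<kappa> where "\<kappa> i = real (k i) + real_of_int \<lceil>log (real (p i)) (real n)\<rceil>" for i
  have \<kappa>: "\<kappa> i \<ge> 1" if "i \<in> {1..r}" for i
  proof -
    have "log (real (p i)) (real n) \<ge> 0" using \<open>n > 0\<close> prime_gt_1_nat[OF p[OF that]] by simp
    then have "real_of_int \<lceil>log (real (p i)) (real n)\<rceil> \<ge> 0" by simp
    moreover have "real (k i) \<ge> 1" using k[OF that] by simp
    ultimately show ?thesis unfolding \<kappa>_def by linarith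
  qed
  have l: "ln (real (p i)) \<ge> 0" if "i \<in> {1..r}" for i
    using prime_gt_1_nat[OF p[OF that]] by simp
  define A where "A = 1 / (2 * \<kappa> r) * (\<Prod>i = 2..r - 1. 1 / (2 * (real (k i) * ln (real (p i)) + 1) * \<kappa> i))"
  have term0: "0 \<le> 1 / (2 * (real (k i) * ln (real (p i)) + 1) * \<kappa> i)"
    and term1: "1 / (2 * (real (k i) * ln (real (p i)) + 1) * \<kappa> i) \<le> 1 / (2 * \<kappa> i)" if "i \<in> {1..r}" for i
  proof -
    have "real (k i) * ln (real (p i)) + 1 \<ge> 1" using l[OF that] by simp
    then have "2 * (real (k i) * ln (real (p i)) + 1) * \<kappa> i \<ge> 2 * \<kappa> i" using \<kappa>[OF that] by simp
    moreover have "2 * \<kappa> i > 0" using \<kappa>[OF that] by simp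
    ultimately show "0 \<le> 1 / (2 * (real (k i) * ln (real (p i)) + 1) * \<kappa> i)"
      "1 / (2 * (real (k i) * ln (real (p i)) + 1) * \<kappa> i) \<le> 1 / (2 * \<kappa> i)"
      by (simp_all add: frac_le)
  qed
  have r: "\<kappa> r \<ge> 1" using \<kappa>[of r] assms(1) by simp
  have A0: "A \<ge> 0" unfolding A_def using r term0 by (intro mult_nonneg_nonneg prod_nonneg) auto
  have "A \<le> (\<Prod>i\<in>{2..r}. 1 / (2 * \<kappa> i))"
  proof (cases "r = 1")
    \<comment> \<open>For \<open>r = 1\<close> the factor of the last prime belongs to the first
      prime again, while the product over \<open>{2..r}\<close> is empty; that factor is at most
      1.\<close>
    case True
    have "A = 1 / (2 * \<kappa> r)" by (simp add: A_def True)
    also have "\<dots> \<le> 1" using r by simp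
    finally show ?thesis by (simp add: True)
  next
    case False
    with assms(1) have *: "{2..r} = insert r {2..r - 1}" by auto
    have "A \<le> 1 / (2 * \<kappa> r) * (\<Prod>i = 2..r - 1. 1 / (2 * \<kappa> i))"
      unfolding A_def using r assms(1) term0 term1 by (intro mult_left_mono prod_mono) auto
    also have "\<dots> = (\<Prod>i\<in>{2..r}. 1 / (2 * \<kappa> i))"
      unfolding * using False assms(1) by (subst prod.insert) auto
    finally show ?thesis .
  qed
  then have "A ^ n \<le> (\<Prod>i\<in>{2..r}. 1 / (2 * \<kappa> i)) ^ n" using A0 by (rule power_mono)
  moreover have "kakeya_const n r p k m = (1 / (2 * (ln (real m) + 1) *
        real_of_int \<lceil>log (real (p 1)) (real m) + log (real (p 1)) (real n)\<rceil>)) ^ n * A ^ n"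
    unfolding kakeya_const_def A_def \<kappa>_def ..
  ultimately show ?thesis
    unfolding \<kappa>_def[symmetric] using c A0 by (simp only:) (intro mult_mono zero_le_power)
qed

theorem theorem1p9:
  fixes n r N :: nat
    and p k :: "nat \<Rightarrow> nat"
    and f :: "(nat \<Rightarrow> int) \<Rightarrow> nat"
    and rep :: "(nat \<Rightarrow> int) set \<Rightarrow> (nat \<Rightarrow> int)"
    and L :: "(nat \<Rightarrow> int) set \<Rightarrow> (nat \<Rightarrow> int) set"
  assumes "n > 0"
    and "r \<ge> 1"
    and "\<And>i. i \<in> {1..r} \<Longrightarrow> prime (p i)"
    and "inj_on p {1..r}"
    and "\<And>i. i \<in> {1..r} \<Longrightarrow> k i > 0"
    and "N = (\<Prod>i = 1..r. p i ^ k i)"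
    and "representatives n N rep"
    and "maximal_lines n N rep f L"
  defines "C \<equiv> kakeya_const n r p k (mweight n N L f (p 1))"
  shows "(\<Sum>x\<in>mod_vecs n N. real (f x) ^ n) \<ge>
           C * measure_pmf.expectation (pmf_of_set (proj_space n N))
                 (\<lambda>u. real (maximal_function n N rep f u) ^ n)
       \<and> C * measure_pmf.expectation (pmf_of_set (proj_space n N))
                 (\<lambda>u. real (maximal_function n N rep f u) ^ n)
         = C / real (card (proj_space n N)) *
             (\<Sum>u\<in>proj_space n N. real (maximal_function n N rep f u) ^ n)"
proof -
  let ?D = "unimodular_vecs n N" and ?P = "proj_space n N" and ?R = "unit_multiple_rel n N"
  let ?F = "maximal_function n N rep f"
  define M where "M = p 1 ^ k 1"
  define N1 where "N1 = (\<Prod>i\<in>{2..r}. p i ^ k i)"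
  define m where "m = mweight n N L f (p 1)"
  have one: "1 \<in> {1..r}" using assms(2) by simp
  have p1: "prime (p 1)" and k1: "k 1 > 0" using assms(3,5)[OF one] by auto
  have "{1..r} = insert 1 {2..r}" using assms(2) by auto
  then have MN: "N = M * N1" unfolding assms(6) M_def N1_def by simp
  have ndvd: "\<not> p 1 dvd p i ^ k i" if "i \<in> {2..r}" for i
  proof
    assume "p 1 dvd p i ^ k i"
    then have "p 1 dvd p i" using p1 prime_dvd_power by blast
    then have "p 1 = p i" using p1 assms(3)[of i] that by (simp add: primes_dvd_imp_eq)
    then have "1 = i" using inj_onD[OF assms(4), of 1 i] one that by simp
    with that show False by simp
  qed
  then have ndvd1: "\<not> p 1 dvd N1" using p1 unfolding N1_def by (subst prime_dvd_prod_iff) auto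
  then have cop: "coprime M N1" using prime_imp_coprime[OF p1] unfolding M_def by simp
  have pos: "M > 0" "N1 > 0" using p1 prime_gt_0_nat ndvd1 by (auto simp: M_def intro: gr0I)
  have "M > 1" unfolding M_def by (rule one_less_power[OF prime_gt_1_nat[OF p1] k1])
  then have N: "N > 1" unfolding MN using pos(2) by (metis less_1_mult' less_le_trans nat_mult_1_right mult_le_mono2 Suc_leI One_nat_def)
  have part: "prime_part N (p 1) = M"
    unfolding prime_part_def MN M_def multiplicity_prime_power_mult[OF p1 ndvd1] ..
  have copart: "coprime_part N (p 1) = N1" unfolding coprime_part_def part using MN pos by simp

  let ?good = "\<lambda>v a. a \<in> int_vecs n N \<and> L (?R `` {v}) = (\<lambda>t. line_point n N a (int t) v) ` {..<N}
           \<and> ?F (?R `` {v}) = (\<Sum>t<N. f (line_point n N a (int t) v))"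
  have ex: "\<exists>a. v \<in> ?D \<longrightarrow> ?good v a" for v
  proof (cases "v \<in> ?D")
    case True
    from maximal_line(2)[OF N assms(7,8) True] obtain a where "a \<in> int_vecs n N"
      "L (?R `` {v}) = (\<lambda>t. line_point n N a (int t) v) ` {..<N}
        \<and> ?F (?R `` {v}) = (\<Sum>t<N. f (line_point n N a (int t) v))" by (elim bexE)
    then show ?thesis by (intro exI[of _ a] impI conjI) simp_all
  qed simp
  have "\<forall>v. \<exists>a. v \<in> ?D \<longrightarrow> ?good v a" by (rule allI) (rule ex)
  from choice[OF this] obtain a where a': "\<forall>v. v \<in> ?D \<longrightarrow> ?good v (a v)" by (elim exE)
  then have good: "?good v (a v)" if "v \<in> ?D" for v using that by (elim allE[of _ v] impE)
  note a = good[THEN conjunct1] good[THEN conjunct2, THEN conjunct1] good[THEN conjunct2, THEN conjunct2]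
  obtain c where c: "c \<ge> 0" "max_ineq n M m c" "(1 / (2 * (ln (real m) + 1) *
      real_of_int \<lceil>log (real (p 1)) (real m) + log (real (p 1)) (real n)\<rceil>)) ^ n \<le> c"
    using max_ineq_log_weight[OF p1 k1 assms(1), of m] unfolding M_def by (elim exE conjE)
  define d where "d = (\<Prod>i\<in>{2..r}. 1 / (2 * (real (k i) + real_of_int \<lceil>log (real (p i)) (real n)\<rceil>))) ^ n"
  have ineqN: "max_ineq n N1 m' d" for m'
    unfolding N1_def d_def using assms(1,3,5) inj_on_subset[OF assms(4)] by (intro max_ineq_prod) auto
  \<comment> \<open>The first prime power serves as the fibre modulus: \<open>mweight\<close> bounds
    exactly the fibre weights of the chosen lines over the cofactor, and the cofactor inequality
    holds for every weight bound.\<close>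
  have "c * d * (\<Sum>v\<in>?D. real (?F (?R `` {v})) ^ n) \<le> real (card ?D) * (\<Sum>x\<in>int_vecs n N. real (f x) ^ n)"
    unfolding MN
  proof (rule product_ineq[OF cop pos c(2) ineqN c(1)])
    show "a v \<in> int_vecs n (M * N1)" if "v \<in> unimodular_vecs n (M * N1)" for v
      using a(1) that unfolding MN .
    show "maximal_function n (M * N1) rep f (unit_multiple_rel n (M * N1) `` {v})
        \<le> (\<Sum>t<M * N1. f (line_point n (M * N1) (a v) (int t) v))" if "v \<in> unimodular_vecs n (M * N1)" for v
      using a(3)[of v] that unfolding MN by simp
    fix v s assume v: "v \<in> unimodular_vecs n (M * N1)" and s: "s < N1"
    have vD: "v \<in> ?D" using v unfolding MN .
    show "(\<Sum>t<M. f (crt_vec n M N1 (line_point n M (reduce_vec n M (a v)) (int t) (reduce_vec n M v),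
                  line_point n N1 (reduce_vec n N1 (a v)) (int s) (reduce_vec n N1 v)))) \<le> m"
      unfolding m_def
      by (rule fibre_weight_le_mweight[where L = L and U = "?R `` {v}" and a = "a v",
            OF N part[symmetric] copart[symmetric] MN cop vD
            maximal_line(1)[OF N assms(7,8) vD] a(2)[OF vD] s])
  qed
  moreover have "C * (\<Sum>v\<in>?D. real (?F (?R `` {v})) ^ n) \<le> c * d * (\<Sum>v\<in>?D. real (?F (?R `` {v})) ^ n)"
  proof (rule mult_right_mono)
    show "C \<le> c * d"
      unfolding C_def d_def m_def[symmetric] using assms(2,3,5,1) c(1,3) by (rule kakeya_const_le)
  qed (simp add: sum_nonneg)
  ultimately have le: "C * (\<Sum>v\<in>?D. real (?F (?R `` {v})) ^ n) \<le> real (card ?D) * (\<Sum>x\<in>int_vecs n N. real (f x) ^ n)"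
    by linarith
  define \<kappa> where "\<kappa> = real (card (Units (ZMod N)))"
  have sum: "(\<Sum>v\<in>?D. real (?F (?R `` {v})) ^ n) = \<kappa> * (\<Sum>u\<in>?P. real (?F u) ^ n)"
    unfolding \<kappa>_def by (rule sum_over_proj_space[OF N])
  have card: "real (card ?D) = \<kappa> * real (card ?P)"
    using sum_over_proj_space[OF N, where F = "\<lambda>_. 1" and n = n] by (simp add: \<kappa>_def)
  have D: "card ?D > 0" using unimodular_vecs_nonempty[OF assms(1) N] by (simp add: card_gt_0_iff)
  then have \<kappa>: "\<kappa> > 0" and P: "card ?P > 0" using card by (auto simp: \<kappa>_def intro: gr0I)
  then have fin: "?P \<noteq> {}" "finite ?P" by (auto simp: card_gt_0_iff)
  have "C * (\<Sum>u\<in>?P. real (?F u) ^ n) \<le> real (card ?P) * (\<Sum>x\<in>int_vecs n N. real (f x) ^ n)"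
    using le \<kappa> unfolding sum card by (simp add: mult.left_commute mult.assoc del: PiE_iff)
  then have main: "C / real (card ?P) * (\<Sum>u\<in>?P. real (?F u) ^ n) \<le> (\<Sum>x\<in>int_vecs n N. real (f x) ^ n)"
    using P by (simp add: pos_divide_le_eq mult.commute del: PiE_iff)
  have "measure_pmf.expectation (pmf_of_set ?P) (\<lambda>u. real (?F u) ^ n) = (\<Sum>u\<in>?P. real (?F u) ^ n) / real (card ?P)"
    using integral_pmf_of_set[OF fin] by simp
  with main show ?thesis unfolding mod_vecs_eq by simp
qed

end
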